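(* For $s\in\mathbb{R}$ let $\rho_s$ be the unitary representation of Thompson's group $T$ on $L^2(S^1,\nu)$ given by $\rho_s(\gamma) f = \left(\frac{d\gamma_*\nu}{d\nu}\right)^{1/2+is} \, f\circ\gamma^{-1}$, where $\nu$ is the pushforward of the Lebesgue measure on $[0,1]$ under $\eta(t)=e^{2\pi i t}$. Then for every $s\in\mathbb{R}$ the representation $\rho_s$ is irreducible, and for $s,t\in\mathbb{R}$ the representations $\rho_s$ and $\rho_t$ are unitarily equivalent if and only if $s-t=2k\pi/\log 2$ for some $k\in\mathbb{Z}$.
   Context: Thompson's group $F$ consists of all orientation-preserving piecewise linear homeomorphisms $\phi$ of the unit interval $[0,1]$ such that (1) $\phi$ preserves the set $\mathbb{Z}[1/2]\cap[0,1]$ of dyadic rationals in $[0,1]$; (2) $\phi$ has finitely many nondifferentiability points, all lying in $\mathbb{Z}[1/2]$; (3) the slopes of $\phi$ are of the form $2^k$, $k\in\mathbb{Z}$. The surjection $\eta\colon[0,1]\to S^1=\{z\in\mathbb{C}:|z|=1\}$, $\eta(t)=e^{2\pi i t}$, induces a faithful action of $F$ on $S^1$ (by $\gamma\cdot\eta(t)=\eta(\gamma(t))$). Let $R$ be the group of rotations of $S^1$ with angles in $\pi\mathbb{Z}[1/2]$. Thompson's group $T$ is the group of homeomorphisms of $S^1$ generated by $F$ (viewed as acting on $S^1$) and $R$; it is regarded as a discrete group. The measure $\nu$ is quasi-invariant under $T$; $\gamma_*\nu$ is its pushforward and $d\gamma_*\nu/d\nu$ the Radon–Nikodym derivative. $\log$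 is the natural logarithm. *)

theory Defs
  imports
    "HOL-Probability.Probability"
    "HOL-Algebra.Bij"
    "HOL-Algebra.Elementary_Groups"
begin

section \<open>Complex inner product spaces\<close>

class complex_inner = real_inner +
  fixes scaleC :: "complex \<Rightarrow> 'a \<Rightarrow> 'a"  (infixr \<open>*\<^sub>C\<close> 75)
    and cinner :: "'a \<Rightarrow> 'a \<Rightarrow> complex"
  assumes scaleC_add_right: "c *\<^sub>C (x + y) = c *\<^sub>C x + c *\<^sub>C y"
    and scaleC_add_left: "(c + d) *\<^sub>C x = c *\<^sub>C x + d *\<^sub>C x"
    and scaleC_scaleC: "c *\<^sub>C d *\<^sub>C x = (c * d) *\<^sub>C x"
    and scaleR_scaleC: "r *\<^sub>R x = complex_of_real r *\<^sub>C x"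
    and cinner_commute: "cinner x y = cnj (cinner y x)"
    and cinner_add_left: "cinner (x + y) z = cinner x z + cinner y z"
    and cinner_scaleC_left: "cinner (c *\<^sub>C x) y = c * cinner x y"
    and inner_eq_Re_cinner: "inner x y = Re (cinner x y)"

global_interpretation complex_vector:
  vector_space "scaleC :: complex \<Rightarrow> 'a \<Rightarrow> 'a::complex_inner"
proof
  fix x :: 'a
  have "1 *\<^sub>R x = complex_of_real 1 *\<^sub>C x"
    by (rule scaleR_scaleC)
  then show "1 *\<^sub>C x = x"
    by simp
qed (simp_all add: scaleC_add_right scaleC_add_left scaleC_scaleC)


section \<open>Unitary representations of discrete groups\<close>

definition unitary_map :: "('a::complex_inner \<Rightarrow> 'b::complex_inner) \<Rightarrow> bool" where
  "unitary_map U \<longleftrightarrow>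
     Vector_Spaces.linear scaleC scaleC U \<and> surj U \<and> (\<forall>x y. cinner (U x) (U y) = cinner x y)"

definition unitary_rep :: "'g monoid \<Rightarrow> ('g \<Rightarrow> 'a::complex_inner \<Rightarrow> 'a) \<Rightarrow> bool" where
  "unitary_rep G \<pi> \<longleftrightarrow> group G \<and> (\<forall>g\<in>carrier G. unitary_map (\<pi> g)) \<and>
     (\<forall>g\<in>carrier G. \<forall>h\<in>carrier G. \<pi> (g \<otimes>\<^bsub>G\<^esub> h) = \<pi> g \<circ> \<pi> h)"

definition irreducible_rep :: "'g monoid \<Rightarrow> ('g \<Rightarrow> 'a::complex_inner \<Rightarrow> 'a) \<Rightarrow> bool" where
  "irreducible_rep G \<pi> \<longleftrightarrow> (\<exists>x::'a. x \<noteq> 0) \<and>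
     (\<forall>V. complex_vector.subspace V \<and> closed V \<and> (\<forall>g\<in>carrier G. \<pi> g ` V \<subseteq> V)
        \<longrightarrow> V = {0} \<or> V = UNIV)"

definition unitarily_equivalent ::
    "'g monoid \<Rightarrow> ('g \<Rightarrow> 'a::complex_inner \<Rightarrow> 'a) \<Rightarrow> ('g \<Rightarrow> 'b::complex_inner \<Rightarrow> 'b) \<Rightarrow> bool" where
  "unitarily_equivalent G \<pi> \<sigma> \<longleftrightarrow>
     (\<exists>U. unitary_map U \<and> (\<forall>g\<in>carrier G. U \<circ> \<pi> g = \<sigma> g \<circ> U))"


section \<open>Thompson's groups\<close>

definition dyadic :: "real set" where
  "dyadic = {real_of_int a / 2 ^ n | a n. True}"

text \<open>The slopes and the points of nondifferentiability of a map of the unit interval are taken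
  relative to the interval, so that at the two end points they are one-sided.\<close>

definition piecewise_linear_01 :: "(real \<Rightarrow> real) \<Rightarrow> bool" where
  "piecewise_linear_01 \<phi> \<longleftrightarrow>
     (\<exists>P. finite P \<and> (\<forall>a b. 0 \<le> a \<and> a < b \<and> b \<le> 1 \<and> {a<..<b} \<inter> P = {}
        \<longrightarrow> (\<exists>m c. \<forall>x\<in>{a..b}. \<phi> x = m * x + c)))"

definition thompson_F :: "(real \<Rightarrow> real) set" where
  "thompson_F = {\<phi> \<in> extensional {0..1}.
     homeomorphism {0..1} {0..1} \<phi> (inv_into {0..1} \<phi>) \<and>
     strict_mono_on {0..1} \<phi> \<and>
     piecewise_linear_01 \<phi> \<and>
     \<phi> ` (dyadic \<inter> {0..1}) = dyadic \<inter> {0..1} \<and>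
     finite {x \<in> {0..1}. \<not> \<phi> differentiable (at x within {0..1})} \<and>
     {x \<in> {0..1}. \<not> \<phi> differentiable (at x within {0..1})} \<subseteq> dyadic \<and>
     (\<forall>x\<in>{0..1}. \<phi> differentiable (at x within {0..1}) \<longrightarrow>
        (\<exists>k::int. (\<phi> has_real_derivative 2 powi k) (at x within {0..1})))}"

definition circle :: "complex set" where
  "circle = {z. norm z = 1}"

definition circle_param :: "real \<Rightarrow> complex" where
  "circle_param t = exp (2 * pi * \<i> * t)"

definition thompson_F_circle :: "(complex \<Rightarrow> complex) set" where
  "thompson_F_circle = {\<gamma> \<in> Bij circle.
     \<exists>\<phi>\<in>thompson_F. \<forall>t\<in>{0..1}. \<gamma> (circle_param t) = circle_param (\<phi> t)}"

definition dyadic_rotations :: "(complex \<Rightarrow> complex) set" where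
  "dyadic_rotations = {restrict (\<lambda>z. exp (\<i> * (pi * q)) * z) circle | q. q \<in> dyadic}"

text \<open>The generators are homeomorphisms, so generating inside the group of all bijections of the
  circle gives the same group as generating inside its homeomorphism group.\<close>

definition thompson_T :: "(complex \<Rightarrow> complex) monoid" where
  "thompson_T = subgroup_generated (BijGroup circle) (thompson_F_circle \<union> dyadic_rotations)"


section \<open>The Hilbert space of square-integrable functions on the circle\<close>

definition circle_measure :: "complex measure" where
  "circle_measure = distr (lebesgue_on {0..1}) (restrict_space borel circle) circle_param"

definition square_integrable :: "(complex \<Rightarrow> complex) \<Rightarrow> bool" where
  "square_integrable f \<longleftrightarrow> f \<in> borel_measurable circle_measure \<and>
     integrable circle_measure (\<lambda>x. (norm (f x))\<^sup>2)"

lemma square_integrable_zero: "square_integrable (\<lambda>_. 0)"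
  by (simp add: square_integrable_def)

lemma square_integrable_scale:
  assumes "square_integrable f"
  shows "square_integrable (\<lambda>x. c * f x)"
  using assms by (auto simp: square_integrable_def norm_mult power_mult_distrib)

lemma square_integrable_add:
  assumes f: "square_integrable f" and g: "square_integrable g"
  shows "square_integrable (\<lambda>x. f x + g x)"
proof -
  have [measurable]: "f \<in> borel_measurable circle_measure" "g \<in> borel_measurable circle_measure"
    using f g by (auto simp: square_integrable_def)
  have le: "(norm (a + b))\<^sup>2 \<le> 2 * (norm a)\<^sup>2 + 2 * (norm b)\<^sup>2" for a b :: complex
  proof -
    have "(norm (a + b))\<^sup>2 \<le> (norm a + norm b)\<^sup>2"
      by (intro power_mono norm_triangle_ineq) auto
    also have "\<dots> \<le> 2 * (norm a)\<^sup>2 + 2 * (norm b)\<^sup>2"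
      using sum_squares_bound[of "norm a" "norm b"] by (simp add: power2_sum)
    finally show ?thesis .
  qed
  have "integrable circle_measure (\<lambda>x. (norm (f x + g x))\<^sup>2)"
  proof (rule Bochner_Integration.integrable_bound)
    show "integrable circle_measure (\<lambda>x. 2 * (norm (f x))\<^sup>2 + 2 * (norm (g x))\<^sup>2)"
      using f g by (auto simp: square_integrable_def)
  qed (use le in auto)
  then show ?thesis
    by (simp add: square_integrable_def)
qed

lemma borel_measurable_cnj [measurable]: "cnj \<in> borel_measurable borel"
  by (intro borel_measurable_continuous_onI continuous_intros)

lemma integrable_mult_cnj:
  assumes f: "square_integrable f" and g: "square_integrable g"
  shows "integrable circle_measure (\<lambda>x. f x * cnj (g x))"
proof (rule Bochner_Integration.integrable_bound)
  show "integrable circle_measure (\<lambda>x. (norm (f x))\<^sup>2 + (norm (g x))\<^sup>2)"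
    using f g by (auto simp: square_integrable_def)
  have "f \<in> borel_measurable circle_measure" "g \<in> borel_measurable circle_measure"
    using f g by (auto simp: square_integrable_def)
  then show "(\<lambda>x. f x * cnj (g x)) \<in> borel_measurable circle_measure"
    by measurable
  have "norm a * norm b \<le> (norm a)\<^sup>2 + (norm b)\<^sup>2" for a b :: complex
  proof -
    have "0 \<le> norm a * norm b"
      by simp
    then show ?thesis
      using sum_squares_bound[of "norm a" "norm b"] by linarith
  qed
  then show "AE x in circle_measure.
      norm (f x * cnj (g x)) \<le> norm ((norm (f x))\<^sup>2 + (norm (g x))\<^sup>2)"
    by (simp add: norm_mult)
qed

quotient_type circle_L2 = "complex \<Rightarrow> complex" / partial:
  "\<lambda>f g. square_integrable f \<and> square_integrable g \<and> (AE x in circle_measure. f x = g x)"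
proof (rule part_equivpI)
  show "\<exists>f. square_integrable f \<and> square_integrable f \<and> (AE x in circle_measure. f x = f x)"
    using square_integrable_zero by auto
  show "symp (\<lambda>f g. square_integrable f \<and> square_integrable g \<and> (AE x in circle_measure. f x = g x))"
    by (auto simp: symp_def elim: eventually_mono)
  show "transp (\<lambda>f g. square_integrable f \<and> square_integrable g \<and> (AE x in circle_measure. f x = g x))"
    by (auto simp: transp_def elim: eventually_elim2)
qed

instantiation circle_L2 :: complex_inner
begin

lift_definition zero_circle_L2 :: circle_L2 is "\<lambda>_. 0"
  by (simp add: square_integrable_zero)

lift_definition plus_circle_L2 :: "circle_L2 \<Rightarrow> circle_L2 \<Rightarrow> circle_L2" is
  "\<lambda>f g x. f x + g x"
  by (auto intro: square_integrable_add)

lift_definition scaleC_circle_L2 :: "complex \<Rightarrow> circle_L2 \<Rightarrow> circle_L2" is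
  "\<lambda>c f x. c * f x"
  by (auto intro: square_integrable_scale)

lift_definition cinner_circle_L2 :: "circle_L2 \<Rightarrow> circle_L2 \<Rightarrow> complex" is
  "\<lambda>f g. \<integral>x. f x * cnj (g x) \<partial>circle_measure"
proof -
  fix f f' g g' :: "complex \<Rightarrow> complex"
  assume *: "square_integrable f \<and> square_integrable f' \<and> (AE x in circle_measure. f x = f' x)"
    "square_integrable g \<and> square_integrable g' \<and> (AE x in circle_measure. g x = g' x)"
  then have [measurable]: "f \<in> borel_measurable circle_measure" "g \<in> borel_measurable circle_measure"
    "f' \<in> borel_measurable circle_measure" "g' \<in> borel_measurable circle_measure"
    by (auto simp: square_integrable_def)
  show "(\<integral>x. f x * cnj (g x) \<partial>circle_measure) = (\<integral>x. f' x * cnj (g' x) \<partial>circle_measure)"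
    using * by (intro integral_cong_AE) auto
qed

definition scaleR_circle_L2 :: "real \<Rightarrow> circle_L2 \<Rightarrow> circle_L2" where
  "scaleR_circle_L2 r f = complex_of_real r *\<^sub>C f"

definition uminus_circle_L2 :: "circle_L2 \<Rightarrow> circle_L2" where
  "uminus_circle_L2 f = (- 1) *\<^sub>C f"

definition minus_circle_L2 :: "circle_L2 \<Rightarrow> circle_L2 \<Rightarrow> circle_L2" where
  "minus_circle_L2 f g = f + - g"

definition inner_circle_L2 :: "circle_L2 \<Rightarrow> circle_L2 \<Rightarrow> real" where
  "inner_circle_L2 f g = Re (cinner f g)"

definition norm_circle_L2 :: "circle_L2 \<Rightarrow> real" where
  "norm_circle_L2 f = sqrt (inner f f)"

definition sgn_circle_L2 :: "circle_L2 \<Rightarrow> circle_L2" where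
  "sgn_circle_L2 f = inverse (norm f) *\<^sub>R f"

definition dist_circle_L2 :: "circle_L2 \<Rightarrow> circle_L2 \<Rightarrow> real" where
  "dist_circle_L2 f g = norm (f - g)"

definition uniformity_circle_L2 :: "(circle_L2 \<times> circle_L2) filter" where
  "uniformity_circle_L2 = (INF e\<in>{0<..}. principal {(f, g). dist f g < e})"

definition open_circle_L2 :: "circle_L2 set \<Rightarrow> bool" where
  "open_circle_L2 U \<longleftrightarrow> (\<forall>f\<in>U. eventually (\<lambda>(f', g). f' = f \<longrightarrow> g \<in> U) uniformity)"

instance
proof
  fix f g h :: circle_L2 and c d :: complex and r s :: real and U :: "circle_L2 set"
  show add_assoc: "f + g + h = f + (g + h)"
    by transfer (auto simp: add.assoc intro!: square_integrable_add)
  show "f + g = g + f"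
    by transfer (auto simp: add.commute intro!: square_integrable_add)
  show "0 + f = f"
    by transfer auto
  show "- f + f = 0"
    unfolding uminus_circle_L2_def
    by transfer
      (auto intro!: square_integrable_add square_integrable_scale square_integrable_zero
        simp del: mult_minus1 simp: algebra_simps)
  show "f - g = f + - g"
    by (simp add: minus_circle_L2_def)
  show addr: "c *\<^sub>C (f + g) = c *\<^sub>C f + c *\<^sub>C g" for c and f g :: circle_L2
    by transfer (auto simp: algebra_simps intro!: square_integrable_add square_integrable_scale)
  show addl: "(c + d) *\<^sub>C f = c *\<^sub>C f + d *\<^sub>C f" for c d and f :: circle_L2
    by transfer (auto simp: algebra_simps intro!: square_integrable_add square_integrable_scale)
  show assoc: "c *\<^sub>C d *\<^sub>C f = (c * d) *\<^sub>C f" for c d and f :: circle_L2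
    by transfer (auto simp: algebra_simps intro!: square_integrable_scale)
  show "r *\<^sub>R f = complex_of_real r *\<^sub>C f"
    by (simp add: scaleR_circle_L2_def)
  show "r *\<^sub>R (f + g) = r *\<^sub>R f + r *\<^sub>R g" "(r + s) *\<^sub>R f = r *\<^sub>R f + s *\<^sub>R f"
    "r *\<^sub>R s *\<^sub>R f = (r * s) *\<^sub>R f"
    by (simp_all add: scaleR_circle_L2_def addr addl assoc)
  show "1 *\<^sub>R f = f"
    unfolding scaleR_circle_L2_def by transfer auto
  show cinner_commute: "cinner f g = cnj (cinner g f)" for f g :: circle_L2
  proof transfer
    fix u v :: "complex \<Rightarrow> complex"
    have "(\<integral>x. cnj (v x * cnj (u x)) \<partial>circle_measure) = cnj (\<integral>x. v x * cnj (u x) \<partial>circle_measure)"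
      by (rule Bochner_Integration.integral_cnj)
    then show "(\<integral>x. u x * cnj (v x) \<partial>circle_measure) = cnj (\<integral>x. v x * cnj (u x) \<partial>circle_measure)"
      by (simp add: mult.commute)
  qed
  show cinner_add: "cinner (f + g) h = cinner f h + cinner g h"
    by transfer (auto simp: distrib_right integrable_mult_cnj)
  show cinner_scale: "cinner (c *\<^sub>C f) g = c * cinner f g" for c
    by transfer (auto simp: mult.assoc)
  show "inner f g = Re (cinner f g)"
    by (simp add: inner_circle_L2_def)
  show "inner f g = inner g f"
    unfolding inner_circle_L2_def by (subst cinner_commute) simp
  show "inner (f + g) h = inner f h + inner g h"
    by (simp add: inner_circle_L2_def cinner_add)
  show "inner (r *\<^sub>R f) g = r * inner f g"
    by (simp add: inner_circle_L2_def scaleR_circle_L2_def cinner_scale)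
  have eq: "(\<integral>x. u x * cnj (u x) \<partial>circle_measure) =
      complex_of_real (\<integral>x. (norm (u x))\<^sup>2 \<partial>circle_measure)" for u :: "complex \<Rightarrow> complex"
    by (subst integral_complex_of_real[symmetric]) (simp only: complex_norm_square)
  show "0 \<le> inner f f"
    unfolding inner_circle_L2_def by transfer (auto simp: eq)
  show "inner f f = 0 \<longleftrightarrow> f = 0"
    unfolding inner_circle_L2_def
  proof transfer
    fix u :: "complex \<Rightarrow> complex"
    assume "square_integrable u \<and> square_integrable u \<and> (AE x in circle_measure. u x = u x)"
    then show "Re (\<integral>x. u x * cnj (u x) \<partial>circle_measure) = 0 \<longleftrightarrow>
      square_integrable u \<and> square_integrable (\<lambda>_. 0) \<and> (AE x in circle_measure. u x = 0)"
      by (subst eq) (auto simp: square_integrable_def integral_nonneg_eq_0_iff_AE)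
  qed
  show "norm f = sqrt (inner f f)"
    by (simp add: norm_circle_L2_def)
  show "sgn f = inverse (norm f) *\<^sub>R f"
    by (simp add: sgn_circle_L2_def)
  show "dist f g = norm (f - g)"
    by (simp add: dist_circle_L2_def)
  show "uniformity = (INF e\<in>{0<..}. principal {(f::circle_L2, g). dist f g < e})"
    by (simp add: uniformity_circle_L2_def)
  show "open U \<longleftrightarrow> (\<forall>f\<in>U. eventually (\<lambda>(f', g). f' = f \<longrightarrow> g \<in> U) uniformity)"
    by (simp add: open_circle_L2_def)
qed

end


section \<open>The representations\<close>

text \<open>Both the representative of the class \<open>f\<close> and the Radon-Nikodym derivative are determined
  only almost everywhere; for \<open>\<gamma>\<close> in the group, quasi-invariance of the measure makes the resulting
  class independent of these choices.\<close>

definition rho :: "real \<Rightarrow> (complex \<Rightarrow> complex) \<Rightarrow> circle_L2 \<Rightarrow> circle_L2" where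
  "rho s \<gamma> f = abs_circle_L2 (\<lambda>x.
     complex_of_real (enn2real (RN_deriv circle_measure
        (distr circle_measure circle_measure \<gamma>) x)) powr (1 / 2 + \<i> * s) *
     rep_circle_L2 f (inv_into circle \<gamma> x))"

end

theory Submission
  imports Defs
begin

text \<open>Every element of \<open>T\<close> has a Radon--Nikodym derivative with values in the powers of \<open>2\<close>, so
  \<open>\<rho>\<^sub>s\<close> depends only on \<open>s\<close> modulo \<open>2\<pi>/log 2\<close>. For a dyadic \<open>a\<close>, an element \<open>\<gamma>\<close> of \<open>F\<close> that fixes
  \<open>[a,1]\<close> pointwise and pushes the interior of \<open>[0,a]\<close> towards \<open>0\<close> satisfies \<open>\<rho>\<^sub>s(\<gamma>)\<^sup>n \<rightarrow> 1\<^bsub>[a,1]\<^esub>\<close> weakly: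
  the mass of a function supported in \<open>[0,b]\<close>, \<open>b < a\<close>, ends up on arcs of vanishing length. Hence a vector \<open>w\<close>
  orthogonal to an invariant subspace \<open>V\<close> satisfies \<open>\<integral>\<^bsub>[0,a]\<^esub> v w\<^sup>* = 0\<close> for all \<open>v\<close> in \<open>V\<close> and all
  dyadic \<open>a\<close>, that is \<open>v w\<^sup>* = 0\<close>, and the ergodicity of the dyadic rotations forces \<open>V = 0\<close> or \<open>w = 0\<close>.
  By the same weak limits a unitary intertwiner \<open>U\<close> commutes with restriction to arcs; it maps \<open>1\<close> to a
  rotation-invariant, hence constant, function, and comparing both sides on an arc where some \<open>\<gamma>\<close> has
  derivative \<open>2\<close> gives \<open>2\<^sup>i\<^sup>s = 2\<^sup>i\<^sup>t\<close>.\<close>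

section \<open>The circle measure in angular coordinates\<close>

text \<open>The operator \<open>rho s \<gamma>\<close> composes with the inverse of
  \<open>\<gamma>\<close>, and for the piecewise linear maps the density of the pushforward under
  \<open>\<gamma>\<close> is the derivative of that inverse. The contracting maps are therefore
  given through their inverses, expanding maps with slopes 2, 1, 1/2 on [0,a]. The limit of the
  powers is only weak because the operators are unitary: no norm is lost on [0,a], it escapes to
  vanishing arcs. Neither the map nor the limit depends on s, so both can be compared between two
  representations. Dyadic a suffice because a finite measure on the circle is determined by its
  values on arcs from 0 to a dyadic point; the same fact stands in for Fourier analysis in the proof
  of ergodicity. No normal form of the elements of T is used: T is placed inside a group of
  measurable bijections whose densities take values in the powers of 2, and only the rotations and
  one family of contractions are written out. A vector orthogonal to V comes from a nearest-point
  projection, which requires completeness of the Hilbert space, here a bare quotient with an inner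
  product.\<close>

definition circle_coord :: "complex \<Rightarrow> real" where
  "circle_coord z = Arg2pi z / (2 * pi)"

lemma space_circle_measure [simp]: "space circle_measure = circle"
  by (simp add: circle_measure_def space_restrict_space)

lemma sets_circle_measure: "sets circle_measure = sets (restrict_space borel circle)"
  by (simp add: circle_measure_def)

lemma circle_param_in_circle [simp]: "circle_param t \<in> circle"
  by (simp add: circle_param_def circle_def norm_exp_eq_Re)

lemma circle_coord_bounds: "0 \<le> circle_coord z" "circle_coord z < 1"
  using Arg2pi[of z] by (auto simp: circle_coord_def field_simps)

lemma circle_param_coord: "z \<in> circle \<Longrightarrow> circle_param (circle_coord z) = z"
  using complex_norm_eq_1_exp[of z]
  by (simp add: circle_param_def circle_coord_def circle_def mult_ac)

lemma circle_param_add: "circle_param (s + t) = circle_param s * circle_param t"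
  by (simp add: circle_param_def algebra_simps exp_add)

lemma circle_param_of_int [simp]: "circle_param (of_int n) = 1"
  by (auto simp: circle_param_def exp_eq_1 algebra_simps)

lemma circle_param_0 [simp]: "circle_param 0 = 1" and circle_param_1 [simp]: "circle_param 1 = 1"
  using circle_param_of_int[of 0] circle_param_of_int[of 1] by auto

lemma circle_coord_param: "0 \<le> t \<Longrightarrow> t < 1 \<Longrightarrow> circle_coord (circle_param t) = t"
  using Arg2pi_exp[of "2 * pi * \<i> * t"] by (simp add: circle_param_def circle_coord_def)

lemma circle_coord_param_frac: "circle_coord (circle_param t) = frac t"
proof -
  have "circle_param t = circle_param (frac t) * circle_param (of_int \<lfloor>t\<rfloor>)"
    unfolding circle_param_add[symmetric] by (simp add: frac_def)
  then show ?thesis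
    by (simp add: circle_coord_param frac_lt_1)
qed

lemma measurable_circle_measure_eq: "measurable circle_measure N = measurable (restrict_space borel circle) N"
  "measurable N circle_measure = measurable N (restrict_space borel circle)"
  by (auto intro!: measurable_cong_sets simp: sets_circle_measure)

lemma circle_coord_borel [measurable]: "circle_coord \<in> borel_measurable borel"
proof -
  have "Arg2pi \<in> borel_measurable borel"
    by (subst borel_measurable_iff_le) (auto intro!: borel_closed closed_Arg2pi2pi_le)
  then show ?thesis
    unfolding circle_coord_def by measurable
qed

lemma circle_coord_measurable [measurable]: "circle_coord \<in> borel_measurable circle_measure"
  unfolding measurable_circle_measure_eq by (intro measurable_restrict_space1) measurable

lemma measurable_id_circle_borel: "(\<lambda>x. x) \<in> measurable circle_measure borel"
  unfolding measurable_circle_measure_eq by (intro measurable_restrict_space1) measurable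

lemma circle_param_measurable [measurable]: "circle_param \<in> measurable borel circle_measure"
  unfolding measurable_circle_measure_eq
proof (rule measurable_restrict_space2)
  show "circle_param \<in> borel_measurable borel"
    unfolding circle_param_def by (intro borel_measurable_continuous_onI continuous_intros)
qed auto

lemma sets_circle_coord:
  "A \<in> sets borel \<Longrightarrow> {z \<in> circle. circle_coord z \<in> A} \<in> sets circle_measure"
proof -
  assume "A \<in> sets borel"
  moreover have "{z \<in> circle. circle_coord z \<in> A} = circle_coord -` A \<inter> space circle_measure"
    by auto
  ultimately show ?thesis
    using measurable_sets[OF circle_coord_measurable, of A] by simp
qed

text \<open>This is the bridge to the line: every measure or integral of a function of the angle
  becomes one over [0,1) against \<open>lborel\<close>. The interval is half open because
  \<open>Arg2pi\<close> takes values in [0,2\<pi>).\<close>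

lemma distr_circle_coord:
  "distr circle_measure borel circle_coord = density lborel (indicator {0..<1})"
proof (rule measure_eqI)
  fix A :: "real set" assume "A \<in> sets (distr circle_measure borel circle_coord)"
  then have A [measurable]: "A \<in> sets borel" by simp
  have pm: "circle_param \<in> measurable (lebesgue_on {0..1}) (restrict_space borel circle)"
    by (intro measurable_restrict_space1 measurable_completion)
      (use circle_param_measurable in \<open>simp add: measurable_circle_measure_eq\<close>)
  have qm: "circle_coord \<in> borel_measurable (restrict_space borel circle)"
    by (intro measurable_restrict_space1) measurable
  have "distr circle_measure borel circle_coord =
      distr (lebesgue_on {0..1}) borel (circle_coord \<circ> circle_param)"
    unfolding circle_measure_def by (rule distr_distr[OF qm pm])
  then have "emeasure (distr circle_measure borel circle_coord) A =
      emeasure (lebesgue_on {0..1}) ((circle_coord \<circ> circle_param) -` A \<inter> {0..1})"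
    using measurable_comp[OF pm qm] by (simp add: emeasure_distr space_restrict_space)
  also have "\<dots> = emeasure lebesgue ((circle_coord \<circ> circle_param) -` A \<inter> {0..1})"
    by (subst emeasure_restrict_space) auto
  also have "\<dots> = emeasure lborel ((circle_coord \<circ> circle_param) -` A \<inter> {0..1})"
  proof -
    have [measurable]: "(circle_coord \<circ> circle_param) \<in> borel_measurable borel"
      by measurable
    show ?thesis by (simp add: measurable_sets_borel)
  qed
  \<comment> \<open>The two sets can differ only at 1, whose image on the circle has coordinate
    0.\<close>
  also have "\<dots> = emeasure lborel (A \<inter> {0..<1})"
  proof (rule emeasure_eq_AE)
    have "AE x in lborel. x \<noteq> (1::real)"
      by (rule AE_lborel_singleton)
    then show "AE x in lborel. x \<in> (circle_coord \<circ> circle_param) -` A \<inter> {0..1} \<longleftrightarrow> x \<in> A \<inter> {0..<1}"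
      by eventually_elim (auto simp: circle_coord_param)
    have [measurable]: "(circle_coord \<circ> circle_param) \<in> borel_measurable borel"
      by measurable
    show "(circle_coord \<circ> circle_param) -` A \<inter> {0..1} \<in> sets lborel"
      by (simp add: measurable_sets_borel)
  qed auto
  also have "\<dots> = emeasure (density lborel (indicator {0..<1})) A"
    by (simp add: emeasure_density indicator_inter_arith[symmetric] mult.commute del: nn_integral_indicator)
       (simp add: nn_integral_indicator Int_commute)
  finally show "emeasure (distr circle_measure borel circle_coord) A =
    emeasure (density lborel (indicator {0..<1})) A" .
qed simp

lemma nn_integral_circle_coord:
  assumes [measurable]: "g \<in> borel_measurable borel"
  shows "(\<integral>\<^sup>+z. g (circle_coord z) \<partial>circle_measure) = (\<integral>\<^sup>+t. indicator {0..<1} t * g t \<partial>lborel)"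
proof -
  have "(\<integral>\<^sup>+z. g (circle_coord z) \<partial>circle_measure) = (\<integral>\<^sup>+t. g t \<partial>distr circle_measure borel circle_coord)"
    by (rule nn_integral_distr[symmetric]) auto
  then show ?thesis
    by (simp add: distr_circle_coord nn_integral_density)
qed

lemma emeasure_circle_coord:
  assumes [measurable]: "A \<in> sets borel"
  shows "emeasure circle_measure {z \<in> circle. circle_coord z \<in> A} = emeasure lborel ({0..<1} \<inter> A)"
proof -
  have "{z \<in> circle. circle_coord z \<in> A} = circle_coord -` A \<inter> space circle_measure"
    by auto
  then have "emeasure circle_measure {z \<in> circle. circle_coord z \<in> A} =
      emeasure (distr circle_measure borel circle_coord) A"
    by (simp add: emeasure_distr)
  also have "\<dots> = emeasure lborel ({0..<1} \<inter> A)"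
    by (simp add: distr_circle_coord emeasure_density indicator_inter_arith[symmetric] del: nn_integral_indicator)
       (simp add: nn_integral_indicator)
  finally show ?thesis .
qed

lemma prob_space_circle_measure: "prob_space circle_measure"
proof
  show "emeasure circle_measure (space circle_measure) = 1"
    using emeasure_circle_coord[of UNIV] by simp
qed

interpretation circle_measure: prob_space circle_measure
  by (rule prob_space_circle_measure)

lemma emeasure_circle_coord_le:
  assumes "0 \<le> y" "y < 1"
  shows "emeasure circle_measure {z \<in> circle. circle_coord z \<le> y} = ennreal y"
proof -
  have "{0..<1} \<inter> {..y} = {0..y}"
    using assms by auto
  then show ?thesis
    using emeasure_circle_coord[of "{..y}"] assms by simp
qed

text \<open>Used to discard breakpoints, end points of arcs and the base point 0, which the
  expanding maps fix.\<close>

lemma AE_circle_coord_neq: "AE z in circle_measure. circle_coord z \<noteq> y"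
proof (rule AE_I)
  show "{z \<in> space circle_measure. \<not> circle_coord z \<noteq> y} \<subseteq> {z \<in> circle. circle_coord z \<in> {y}}"
    by auto
  have "emeasure lborel ({0..<1} \<inter> {y}) \<le> emeasure lborel {y}"
    by (intro emeasure_mono) auto
  then show "emeasure circle_measure {z \<in> circle. circle_coord z \<in> {y}} = 0"
    by (subst emeasure_circle_coord) auto
  show "{z \<in> circle. circle_coord z \<in> {y}} \<in> sets circle_measure"
    by (rule sets_circle_coord) simp
qed

section \<open>Dyadic numbers\<close>

lemma dyadic_of_int [simp]: "of_int n \<in> dyadic"
  unfolding dyadic_def by (rule CollectI, rule exI[of _ n], rule exI[of _ 0]) simp

lemma dyadic_0 [simp]: "0 \<in> dyadic" and dyadic_1 [simp]: "1 \<in> dyadic"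
  using dyadic_of_int[of 0] dyadic_of_int[of 1] by auto

lemma dyadic_add: "x \<in> dyadic \<Longrightarrow> y \<in> dyadic \<Longrightarrow> x + y \<in> dyadic"
proof -
  assume "x \<in> dyadic" "y \<in> dyadic"
  then obtain a n b m where "x = of_int a / 2 ^ n" "y = of_int b / 2 ^ m"
    by (auto simp: dyadic_def)
  then have "x + y = of_int (a * 2 ^ m + b * 2 ^ n) / 2 ^ (n + m)"
    by (simp add: add_divide_distrib power_add)
  then show ?thesis
    unfolding dyadic_def by blast
qed

lemma dyadic_mult: "x \<in> dyadic \<Longrightarrow> y \<in> dyadic \<Longrightarrow> x * y \<in> dyadic"
proof -
  assume "x \<in> dyadic" "y \<in> dyadic"
  then obtain a n b m where "x = of_int a / 2 ^ n" "y = of_int b / 2 ^ m"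
    by (auto simp: dyadic_def)
  then have "x * y = of_int (a * b) / 2 ^ (n + m)"
    by (simp add: add_divide_distrib power_add)
  then show ?thesis
    unfolding dyadic_def by blast
qed

lemma dyadic_half: "x \<in> dyadic \<Longrightarrow> x / 2 \<in> dyadic"
proof -
  have "1 / 2 \<in> dyadic"
    unfolding dyadic_def by (rule CollectI, rule exI[of _ 1], rule exI[of _ 1]) simp
  then show "x \<in> dyadic \<Longrightarrow> x / 2 \<in> dyadic"
    using dyadic_mult[of x "1/2"] by simp
qed

lemma dyadic_minus: "x \<in> dyadic \<Longrightarrow> - x \<in> dyadic"
proof -
  have "- 1 \<in> dyadic"
    using dyadic_of_int[of "- 1"] by simp
  then show "x \<in> dyadic \<Longrightarrow> - x \<in> dyadic"
    using dyadic_mult[of "- 1" x] by simp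
qed

lemma dyadic_diff: "x \<in> dyadic \<Longrightarrow> y \<in> dyadic \<Longrightarrow> x - y \<in> dyadic"
  using dyadic_add[of x "- y"] dyadic_minus[of y] by simp

lemma dyadic_nat_fraction: "real m / 2 ^ n \<in> dyadic"
  unfolding dyadic_def by (rule CollectI, rule exI[of _ "int m"], rule exI[of _ n]) simp

lemma countable_dyadic: "countable dyadic"
proof -
  have "dyadic = (\<lambda>(a, n). real_of_int a / 2 ^ n) ` UNIV"
    by (auto simp: dyadic_def)
  then show ?thesis
    by (metis countableI_type countable_image)
qed

lemma dyadic_approx_right:
  assumes "0 \<le> y" "y < 1"
  obtains u where "\<And>n. u n \<in> dyadic" "\<And>n. 0 \<le> u n" "\<And>n. u n \<le> 1" "\<And>n. y < u n" "u \<longlonglongrightarrow> y"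
proof
  \<comment> \<open>Floor plus one, rather than the ceiling, keeps \<open>u n\<close> strictly above
    \<open>y\<close> even for dyadic \<open>y\<close>; the filter \<open>at_right y\<close> below
    demands this. It stays at most 1 because \<open>y < 1\<close>.\<close>
  define u where "u n = of_int (\<lfloor>2 ^ n * y\<rfloor> + 1) / (2 ^ n :: real)" for n :: nat
  show "u n \<in> dyadic" for n
    unfolding u_def dyadic_def by blast
  have less: "y < u n" and le: "u n \<le> y + 1 / 2 ^ n" for n
    by (auto simp: u_def field_simps) linarith+
  show "y < u n" for n by (rule less)
  show "0 \<le> u n" for n using less[of n] assms by linarith
  show "u n \<le> 1" for n
  proof -
    have "2 ^ n * y < of_int (2 ^ n)"
      using assms by simp
    then have "\<lfloor>2 ^ n * y\<rfloor> < 2 ^ n"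
      by (simp only: floor_less_iff)
    then have "\<lfloor>2 ^ n * y\<rfloor> + 1 \<le> 2 ^ n"
      by simp
    then have "real_of_int (\<lfloor>2 ^ n * y\<rfloor> + 1) \<le> real_of_int (2 ^ n)"
      by (simp only: of_int_le_iff)
    then show ?thesis
      by (simp add: u_def)
  qed
  have "(\<lambda>n. y + (1 / 2) ^ n) \<longlonglongrightarrow> y + 0"
    by (intro tendsto_intros) auto
  then have "(\<lambda>n. y + 1 / 2 ^ n) \<longlonglongrightarrow> y"
    by (simp add: power_one_over)
  then show "u \<longlonglongrightarrow> y"
  proof (rule tendsto_sandwich[OF _ _ tendsto_const, rotated 2])
    show "\<forall>\<^sub>F n in sequentially. y \<le> u n" "\<forall>\<^sub>F n in sequentially. u n \<le> y + 1 / 2 ^ n"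
      by (auto intro!: always_eventually less_imp_le[OF less] le)
  qed
qed

text \<open>Transported to the line by \<open>circle_coord\<close>, the measures have distribution
  functions that agree at dyadic points, hence everywhere by right continuity. All identities
  between measures on dyadic arcs pass through this criterion.\<close>

lemma circle_measure_eqI:
  assumes fin: "finite_measure A" "finite_measure B"
    and sets: "sets A = sets circle_measure" "sets B = sets circle_measure"
    and eq: "\<And>y. y \<in> dyadic \<Longrightarrow> 0 \<le> y \<Longrightarrow> y \<le> 1 \<Longrightarrow>
      emeasure A {z \<in> circle. circle_coord z \<le> y} = emeasure B {z \<in> circle. circle_coord z \<le> y}"
  shows "A = B"
proof -
  have sp: "space A = circle" "space B = circle"
    using sets[THEN sets_eq_imp_space_eq] by auto
  have qA [measurable]: "circle_coord \<in> borel_measurable A" "circle_coord \<in> borel_measurable B"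
    using circle_coord_measurable by (auto simp: measurable_cong_sets[OF sets(1) refl] measurable_cong_sets[OF sets(2) refl])
  let ?A = "distr A borel circle_coord" and ?B = "distr B borel circle_coord"
  have fA: "finite_borel_measure ?A" and fB: "finite_borel_measure ?B"
    using fin by (auto simp: finite_borel_measure_def finite_borel_measure_axioms_def intro!: finite_measure.finite_measure_distr)
  have meas: "cdf ?A y = measure A {z \<in> circle. circle_coord z \<le> y}"
     "cdf ?B y = measure B {z \<in> circle. circle_coord z \<le> y}" for y
    by (auto simp: cdf_def measure_distr sp vimage_def Collect_conj_eq Int_commute)
  have dy: "cdf ?A y = cdf ?B y" if "y \<in> dyadic" "0 \<le> y" "y \<le> 1" for y
    using eq[OF that] by (simp add: meas measure_def)
  have "cdf ?A = cdf ?B"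
  proof
    fix y :: real
    consider "y < 0" | "1 \<le> y" | "0 \<le> y" "y < 1" by linarith
    then show "cdf ?A y = cdf ?B y"
    proof cases
      case 1
      have "\<not> circle_coord z \<le> y" for z
        using 1 circle_coord_bounds(1)[of z] by linarith
      then show ?thesis by (simp add: meas)
    next
      case 2
      have "circle_coord z \<le> y" "circle_coord z \<le> 1" for z
        using 2 circle_coord_bounds(2)[of z] by linarith+
      then show ?thesis using dy[of 1] by (simp add: meas)
    next
      case 3
      then obtain u where u: "\<And>n. u n \<in> dyadic" "\<And>n. 0 \<le> u n" "\<And>n. u n \<le> 1" "\<And>n. y < u n" "u \<longlonglongrightarrow> y"
        using dyadic_approx_right by blast
      have fl: "filterlim u (at_right y) sequentially"
        using u by (auto simp: filterlim_at intro!: always_eventually less_imp_neq[THEN not_sym])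
      have "(\<lambda>n. cdf ?A (u n)) \<longlonglongrightarrow> cdf ?A y" "(\<lambda>n. cdf ?B (u n)) \<longlonglongrightarrow> cdf ?B y"
        using finite_borel_measure.cdf_is_right_cont[OF fA, of y] finite_borel_measure.cdf_is_right_cont[OF fB, of y]
        unfolding continuous_within by (auto intro!: filterlim_compose[OF _ fl])
      then show ?thesis
        using u dy by (auto intro: LIMSEQ_unique)
    qed
  qed
  then have AB: "?A = ?B"
    by (rule cdf_unique'[OF fA fB])
  \<comment> \<open>\<open>circle_param\<close> inverts \<open>circle_coord\<close> on the circle,
    so a measure is recovered from its image on the line.\<close>
  have "distr (distr A borel circle_coord) circle_measure circle_param = A" if "sets A = sets circle_measure" for A
  proof -
    have sp: "space A = circle"
      using that[THEN sets_eq_imp_space_eq] by auto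
    have [measurable]: "circle_coord \<in> borel_measurable A"
      using circle_coord_measurable by (auto simp: measurable_cong_sets[OF that refl])
    have "distr (distr A borel circle_coord) circle_measure circle_param = distr A circle_measure (circle_param \<circ> circle_coord)"
      by (rule distr_distr) auto
    also have "\<dots> = distr A A (\<lambda>z. z)"
      by (rule distr_cong) (auto simp: that sp circle_param_coord)
    also have "\<dots> = A"
      by (rule distr_id)
    finally show ?thesis .
  qed
  from this[OF sets(1)] this[OF sets(2)] AB show ?thesis by metis
qed

text \<open>The positive and negative parts of \<open>g\<close> are densities of two finite measures
  that agree on dyadic arcs, so they are the same measure and the densities agree almost
  everywhere.\<close>

lemma AE_zero_of_dyadic_integrals_real:
  fixes g :: "complex \<Rightarrow> real"
  assumes g: "integrable circle_measure g"
    and zero: "\<And>y. y \<in> dyadic \<Longrightarrow> 0 \<le> y \<Longrightarrow> y \<le> 1 \<Longrightarrow>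
      (\<integral>z. g z * indicator {z. circle_coord z \<le> y} z \<partial>circle_measure) = 0"
  shows "AE z in circle_measure. g z = 0"
proof -
  have [measurable]: "g \<in> borel_measurable circle_measure"
    using g by auto
  define P where "P h = density circle_measure (\<lambda>z. ennreal (h z))" for h :: "complex \<Rightarrow> real"
  let ?p = "\<lambda>z. max 0 (g z)" and ?n = "\<lambda>z. max 0 (- g z)"
  have int: "integrable circle_measure ?p" "integrable circle_measure ?n"
    using g by (auto intro!: integrable_max)
  have em: "emeasure (P h) A = ennreal (\<integral>z. h z * indicator A z \<partial>circle_measure)"
    if "integrable circle_measure h" "\<And>z. 0 \<le> h z" "A \<in> sets circle_measure" for h A
  proof -
    have "emeasure (P h) A = (\<integral>\<^sup>+z. ennreal (h z * indicator A z) \<partial>circle_measure)"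
      using that unfolding P_def
      by (subst emeasure_density) (auto intro!: nn_integral_cong simp: indicator_def)
    also have "\<dots> = ennreal (\<integral>z. h z * indicator A z \<partial>circle_measure)"
      using that by (intro nn_integral_eq_integral integrable_real_mult_indicator) auto
    finally show ?thesis .
  qed
  have split: "(\<integral>z. g z * indicator A z \<partial>circle_measure) =
      (\<integral>z. ?p z * indicator A z \<partial>circle_measure) - (\<integral>z. ?n z * indicator A z \<partial>circle_measure)"
    if "A \<in> sets circle_measure" for A
    using int that
    by (subst Bochner_Integration.integral_diff[symmetric])
       (auto intro!: integrable_real_mult_indicator Bochner_Integration.integral_cong simp: max_def)
  have space: "space (P h) = circle" for h
    by (simp add: P_def)
  have [simp]: "circle \<in> sets circle_measure"
    using sets.top[of circle_measure] by simp
  have PP: "P ?p = P ?n"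
  proof (rule circle_measure_eqI)
    show "finite_measure (P ?p)" "finite_measure (P ?n)"
      using int by (auto intro!: finite_measureI simp: em space)
    show "sets (P ?p) = sets circle_measure" "sets (P ?n) = sets circle_measure"
      by (simp_all add: P_def)
    fix y :: real assume y: "y \<in> dyadic" "0 \<le> y" "y \<le> 1"
    let ?B = "{z \<in> circle. circle_coord z \<le> y}"
    have B: "?B \<in> sets circle_measure"
      using sets_circle_coord[of "{..y}"] by simp
    have "(\<integral>z. g z * indicator ?B z \<partial>circle_measure) =
        (\<integral>z. g z * indicator {z. circle_coord z \<le> y} z \<partial>circle_measure)"
      by (intro Bochner_Integration.integral_cong) (auto simp: indicator_def)
    then show "emeasure (P ?p) ?B = emeasure (P ?n) ?B"
      using zero[OF y] split[OF B] by (simp add: em int B)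
  qed
  have eq: "(\<integral>z. ?p z * indicator A z \<partial>circle_measure) = (\<integral>z. ?n z * indicator A z \<partial>circle_measure)"
    if "A \<in> sets circle_measure" for A
    using em[OF int(1) _ that] em[OF int(2) _ that] by (simp add: PP integral_nonneg_AE)
  have "AE z in circle_measure. ?p z = ?n z"
    using int eq by (intro density_unique_real) (auto simp: set_lebesgue_integral_def mult.commute)
  then show ?thesis
    by eventually_elim (auto simp: max_def split: if_splits)
qed

lemma AE_zero_of_dyadic_integrals:
  fixes f :: "complex \<Rightarrow> complex"
  assumes f: "integrable circle_measure f"
    and zero: "\<And>y. y \<in> dyadic \<Longrightarrow> 0 \<le> y \<Longrightarrow> y \<le> 1 \<Longrightarrow>
      (\<integral>z. f z * indicator {z. circle_coord z \<le> y} z \<partial>circle_measure) = 0"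
  shows "AE z in circle_measure. f z = 0"
proof -
  have int: "integrable circle_measure (\<lambda>z. f z * indicator {z. circle_coord z \<le> y} z)" for y
  proof -
    have "integrable circle_measure (\<lambda>z. indicator {z \<in> circle. circle_coord z \<le> y} z *\<^sub>R f z)"
      using sets_circle_coord[of "{..y}"] by (intro integrable_mult_indicator f) auto
    then show ?thesis
      by (rule Bochner_Integration.integrable_cong[THEN iffD1, rotated 2]) (auto simp: indicator_def)
  qed
  have ind: "Re (w * indicator S z) = Re w * indicator S z" "Im (w * indicator S z) = Im w * indicator S z"
    for S and z w :: complex
    by (simp_all add: indicator_def)
  have "AE z in circle_measure. Re (f z) = 0"
  proof (rule AE_zero_of_dyadic_integrals_real)
    show "integrable circle_measure (\<lambda>z. Re (f z))"
      using f by simp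
    show "(\<integral>z. Re (f z) * indicator {z. circle_coord z \<le> y} z \<partial>circle_measure) = 0"
      if "y \<in> dyadic" "0 \<le> y" "y \<le> 1" for y
      using integral_Re[OF int[of y]] unfolding ind zero[OF that] by simp
  qed
  moreover have "AE z in circle_measure. Im (f z) = 0"
  proof (rule AE_zero_of_dyadic_integrals_real)
    show "integrable circle_measure (\<lambda>z. Im (f z))"
      using f by simp
    show "(\<integral>z. Im (f z) * indicator {z. circle_coord z \<le> y} z \<partial>circle_measure) = 0"
      if "y \<in> dyadic" "0 \<le> y" "y \<le> 1" for y
      using integral_Im[OF int[of y]] unfolding ind zero[OF that] by simp
  qed
  ultimately show ?thesis
    by eventually_elim (simp add: complex_eq_iff)
qed

section \<open>Rotations\<close>

lemma circle_mult: "z \<in> circle \<Longrightarrow> w \<in> circle \<Longrightarrow> z * w \<in> circle"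
  by (simp add: circle_def norm_mult)

lemma circle_coord_rotate:
  assumes "z \<in> circle"
  shows "circle_coord (circle_param r * z) = frac (r + circle_coord z)"
  using circle_coord_param_frac[of "r + circle_coord z"] assms
  by (simp add: circle_param_add circle_param_coord)

lemma rotation_measurable [measurable]:
  "(\<lambda>z. circle_param r * z) \<in> measurable circle_measure circle_measure"
proof -
  have "(\<lambda>z. circle_param r * z) \<in> borel_measurable circle_measure"
    using measurable_id_circle_borel by measurable
  then show ?thesis
    unfolding measurable_circle_measure_eq(2)
    by (rule measurable_restrict_space2[rotated]) (auto intro: circle_mult)
qed

lemma circle_param_frac: "circle_param (frac t) = circle_param t"
proof -
  have "circle_param t = circle_param (frac t) * circle_param (of_int \<lfloor>t\<rfloor>)"
    unfolding circle_param_add[symmetric] by (simp add: frac_def)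
  then show ?thesis
    by simp
qed

lemma frac_add_unit:
  assumes "0 \<le> r" "r < 1" "0 \<le> t" "t < (1::real)"
  shows "frac (r + t) = (if r + t < 1 then r + t else r + t - 1)"
  using assms by (simp add: frac_add frac_eq[THEN iffD2])

text \<open>In the coordinate, a rotation by r in [0,1) is an interval exchange with one wrap at 1 -
  r; a general r is first replaced by its fractional part.\<close>

lemma distr_rotation: "distr circle_measure circle_measure (\<lambda>z. circle_param r * z) = circle_measure"
proof -
  have *: "distr circle_measure circle_measure (\<lambda>z. circle_param r * z) = circle_measure"
    if r: "0 \<le> r" "r < 1" for r
  proof (rule circle_measure_eqI)
    fix y :: real assume y: "0 \<le> y" "y \<le> 1"
    have "emeasure (distr circle_measure circle_measure (\<lambda>z. circle_param r * z)) {z \<in> circle. circle_coord z \<le> y}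
        = emeasure circle_measure ((\<lambda>z. circle_param r * z) -` {z \<in> circle. circle_coord z \<le> y} \<inter> space circle_measure)"
      using sets_circle_coord[of "{..y}"] by (intro emeasure_distr) auto
    also have "(\<lambda>z. circle_param r * z) -` {z \<in> circle. circle_coord z \<le> y} \<inter> space circle_measure =
        {z \<in> circle. circle_coord z \<in> {t. frac (r + t) \<le> y}}"
      by (auto simp: circle_coord_rotate circle_mult)
    also have "emeasure circle_measure \<dots> = emeasure lborel ({0..<1} \<inter> {t. frac (r + t) \<le> y})"
    proof (rule emeasure_circle_coord)
      have "(frac :: real \<Rightarrow> real) \<in> borel_measurable borel"
        unfolding frac_def by measurable
      then show "{t. frac (r + t) \<le> y} \<in> sets borel"
        by measurable
    qed
    also have "\<dots> = ennreal y"
    proof -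
      \<comment> \<open>For y < r only points that wrap around land in [0,y]; for r \<le> y all
        wrapped points do, together with the unwrapped ones up to y - r.\<close>
      consider "y < r" | "r \<le> y" "y < 1" | "y = 1" using y by linarith
      then show ?thesis
      proof cases
        case 1
        then have "{0..<1} \<inter> {t. frac (r + t) \<le> y} = {1 - r..1 - r + y}"
          using r y by (auto simp: frac_add_unit split: if_splits)
        then show ?thesis using y by simp
      next
        case 2
        then have "{0..<1} \<inter> {t. frac (r + t) \<le> y} = {0..y - r} \<union> {1 - r..<1}"
          using r y by (auto simp: frac_add_unit split: if_splits)
        moreover have "{0..y - r} \<inter> {1 - r..<1} = {}"
          using 2 by auto
        ultimately show ?thesis
          using 2 r y by (simp add: plus_emeasure[symmetric] ennreal_plus[symmetric] del: ennreal_plus)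
      next
        case 3
        then have "{0..<1} \<inter> {t. frac (r + t) \<le> y} = {0..<1}"
          by (auto intro: less_imp_le[OF frac_lt_1])
        then show ?thesis using 3 by simp
      qed
    qed
    also have "\<dots> = emeasure circle_measure {z \<in> circle. circle_coord z \<le> y}"
    proof (cases "y = 1")
      case True
      have "{z \<in> circle. circle_coord z \<le> 1} = space circle_measure"
        using circle_coord_bounds(2) by (auto intro: less_imp_le)
      then show ?thesis using True circle_measure.emeasure_space_1 by simp
    next
      case False
      then show ?thesis using y by (simp add: emeasure_circle_coord_le)
    qed
    finally show "emeasure (distr circle_measure circle_measure (\<lambda>z. circle_param r * z)) {z \<in> circle. circle_coord z \<le> y}
      = emeasure circle_measure {z \<in> circle. circle_coord z \<le> y}" .
  qed (auto intro!: circle_measure.finite_measure_distr circle_measure.finite_measure_axioms)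
  show ?thesis
    using *[of "frac r"] by (simp add: circle_param_frac frac_lt_1)
qed

text \<open>Ergodicity of the dyadic rotations. The primitive \<open>J {..<y}\<close> is additive
  under dyadic translations, hence linear at dyadic \<open>y\<close>, so \<open>f\<close> minus its
  mean has zero integral over every dyadic arc.\<close>

lemma AE_const_of_rotation_invariant:
  fixes f :: "complex \<Rightarrow> complex"
  assumes f: "integrable circle_measure f"
    and inv: "\<And>r. r \<in> dyadic \<Longrightarrow> AE z in circle_measure. f (circle_param r * z) = f z"
  shows "\<exists>c. AE z in circle_measure. f z = c"
proof -
  have [measurable]: "f \<in> borel_measurable circle_measure"
    using f by auto
  define J where "J A = (\<integral>z. f z * indicator A (circle_coord z) \<partial>circle_measure)" for A
  have int: "integrable circle_measure (\<lambda>z. f z * indicator A (circle_coord z))" if "A \<in> sets borel" for A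
  proof -
    have "integrable circle_measure (\<lambda>z. indicator {z \<in> circle. circle_coord z \<in> A} z *\<^sub>R f z)"
      using sets_circle_coord[OF that] by (intro integrable_mult_indicator f) auto
    then show ?thesis
      by (rule Bochner_Integration.integrable_cong[THEN iffD1, rotated 2]) (auto simp: indicator_def)
  qed
  have J_add: "J {..<r + y} = J {..<r} + J {..<y}"
    if r: "r \<in> dyadic" "0 \<le> r" and y: "0 < y" "r + y \<le> 1" for r y
  proof -
    have "J {..<r + y} = (\<integral>z. f z * indicator {..<r} (circle_coord z) + f z * indicator {r..<r + y} (circle_coord z) \<partial>circle_measure)"
      unfolding J_def using y by (intro Bochner_Integration.integral_cong) (auto simp: indicator_def)
    also have "\<dots> = J {..<r} + J {r..<r + y}"
      unfolding J_def by (intro Bochner_Integration.integral_add int) auto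
    \<comment> \<open>Substituting the rotation by \<open>r\<close> moves the arc back to [0,y);
      invariance of the measure and of \<open>f\<close> makes this free of charge.\<close>
    also have "J {r..<r + y} = (\<integral>z. f z * indicator {r..<r + y} (circle_coord z)
        \<partial>distr circle_measure circle_measure (\<lambda>z. circle_param r * z))"
      by (simp add: J_def distr_rotation)
    also have "\<dots> = (\<integral>z. f (circle_param r * z) * indicator {r..<r + y} (circle_coord (circle_param r * z)) \<partial>circle_measure)"
      by (rule integral_distr) measurable
    also have "\<dots> = J {..<y}"
      unfolding J_def
    proof (rule integral_cong_AE)
      show "AE z in circle_measure. f (circle_param r * z) * indicator {r..<r + y} (circle_coord (circle_param r * z))
          = f z * indicator {..<y} (circle_coord z)"
        using inv[OF r(1)] AE_space
      proof eventually_elim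
        case (elim z)
        have "circle_coord (circle_param r * z) \<in> {r..<r + y} \<longleftrightarrow> circle_coord z \<in> {..<y}"
          using elim r y circle_coord_bounds[of z] by (auto simp: circle_coord_rotate frac_add_unit split: if_splits)
        then show ?case
          using elim by (simp add: indicator_def)
      qed
    qed measurable
    finally show ?thesis .
  qed
  have J0: "J {..<0} = 0"
    unfolding J_def using circle_coord_bounds(1) by (simp add: indicator_def not_less[THEN iffD2])
  \<comment> \<open>Half-open arcs are used so that they concatenate without overlap. The case m =
    2^n identifies the unit \<open>J {..<1 / 2 ^ n}\<close> as a 2^n-th part of the mean.\<close>
  have J_mult: "J {..<real m / 2 ^ n} = of_nat m * J {..<1 / 2 ^ n}" if "m \<le> 2 ^ n" for m n :: nat
    using that
  proof (induction m)
    case 0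
    then show ?case by (simp add: J0)
  next
    case (Suc m)
    have "real m / 2 ^ n + 1 / 2 ^ n \<le> 1"
      using Suc.prems by (simp add: field_simps) (metis of_nat_Suc of_nat_le_iff of_nat_numeral of_nat_power add.commute)
    then have "J {..<real m / 2 ^ n + 1 / 2 ^ n} = J {..<real m / 2 ^ n} + J {..<1 / 2 ^ n}"
      by (intro J_add) (auto simp: dyadic_nat_fraction)
    then show ?case
      using Suc by (simp add: algebra_simps add_divide_distrib)
  qed
  have J1: "J {..<1} = of_nat (2 ^ n) * J {..<1 / 2 ^ n}" for n
    using J_mult[of "2 ^ n" n] by simp
  have J_dyadic: "J {..<y} = of_real y * J {..<1}" if "y \<in> dyadic" "0 \<le> y" "y \<le> 1" for y
  proof -
    obtain a n where a: "y = of_int a / 2 ^ n"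
      using \<open>y \<in> dyadic\<close> by (auto simp: dyadic_def)
    have "0 \<le> a"
      using \<open>0 \<le> y\<close> by (simp add: a zero_le_divide_iff not_le[THEN iffD2])
    moreover have "a \<le> 2 ^ n"
      using \<open>y \<le> 1\<close> by (simp add: a)
    ultimately have "y = real (nat a) / 2 ^ n" "nat a \<le> 2 ^ n"
      by (auto simp: a nat_le_iff)
    then show ?thesis
      using J_mult[of "nat a" n] J1[of n] by simp
  qed
  have "AE z in circle_measure. f z - J {..<1} = 0"
  proof (rule AE_zero_of_dyadic_integrals)
    show "integrable circle_measure (\<lambda>z. f z - J {..<1})"
      using f by (intro Bochner_Integration.integrable_diff) auto
    fix y assume y: "y \<in> dyadic" "0 \<le> y" "y \<le> (1::real)"
    \<comment> \<open>The criterion speaks of closed arcs and \<open>J\<close> of half-open ones;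
      the end point is null.\<close>
    have "(\<integral>z. (f z - J {..<1}) * indicator {z. circle_coord z \<le> y} z \<partial>circle_measure) =
       (\<integral>z. f z * indicator {..<y} (circle_coord z) - J {..<1} * indicator {..<y} (circle_coord z) \<partial>circle_measure)"
    proof (rule integral_cong_AE)
      have "{z \<in> circle. circle_coord z \<le> y} \<in> sets circle_measure"
        using sets_circle_coord[of "{..y}"] by simp
      then have [measurable]: "(indicator {z. circle_coord z \<le> y} :: _ \<Rightarrow> complex) \<in> borel_measurable circle_measure"
        by (subst borel_measurable_indicator_iff) (simp add: Int_def conj_commute)
      show "(\<lambda>z. (f z - J {..<1}) * indicator {z. circle_coord z \<le> y} z) \<in> borel_measurable circle_measure"
        by measurable
      show "AE z in circle_measure. (f z - J {..<1}) * indicator {z. circle_coord z \<le> y} z =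
        f z * indicator {..<y} (circle_coord z) - J {..<1} * indicator {..<y} (circle_coord z)"
        using AE_circle_coord_neq[of y] by eventually_elim (auto simp: indicator_def)
    qed measurable
    also have "\<dots> = J {..<y} - (\<integral>z. J {..<1} * indicator {..<y} (circle_coord z) \<partial>circle_measure)"
      unfolding J_def[of "{..<y}"]
    proof (rule Bochner_Integration.integral_diff)
      show "integrable circle_measure (\<lambda>z. J {..<1} * indicator {..<y} (circle_coord z))"
        by (rule circle_measure.integrable_const_bound[of _ "norm (J {..<1})"]) (auto simp: indicator_def)
    qed (auto intro: int)
    also have "(\<integral>z. J {..<1} * indicator {..<y} (circle_coord z) \<partial>circle_measure) = J {..<1} * of_real y"
    proof -
      have "(\<integral>z. J {..<1} * indicator {..<y} (circle_coord z) \<partial>circle_measure) =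
        (\<integral>z. indicator {z \<in> circle. circle_coord z \<in> {..<y}} z *\<^sub>R J {..<1} \<partial>circle_measure)"
        by (intro Bochner_Integration.integral_cong) (auto simp: indicator_def)
      also have "\<dots> = measure circle_measure {z \<in> circle. circle_coord z \<in> {..<y}} *\<^sub>R J {..<1}"
      proof -
        have "{z \<in> circle. circle_coord z \<in> {..<y}} \<in> sets circle_measure"
          by (rule sets_circle_coord) simp
        then show ?thesis
          by (intro has_bochner_integral_integral_eq has_bochner_integral_scaleR_left
              has_bochner_integral_real_indicator circle_measure.emeasure_finite) (simp_all add: less_top[symmetric])
      qed
      also have "measure circle_measure {z \<in> circle. circle_coord z \<in> {..<y}} = y"
      proof -
        have "{0..<1} \<inter> {..<y} = {0..<y}"
          using y by auto
        then show ?thesis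
          using y emeasure_circle_coord[of "{..<y}"] by (simp add: measure_def)
      qed
      finally show ?thesis by (simp add: scaleR_conv_of_real mult.commute)
    qed
    finally show "(\<integral>z. (f z - J {..<1}) * indicator {z. circle_coord z \<le> y} z \<partial>circle_measure) = 0"
      using J_dyadic[OF y] by (simp add: mult.commute)
  qed
  then show ?thesis
    by (intro exI[of _ "J {..<1}"]) simp
qed

section \<open>Transformations with dyadic Radon--Nikodym derivative\<close>

definition pow2 :: "real set" where
  "pow2 = range (\<lambda>k::int. 2 powi k)"

lemma pow2_pos: "d \<in> pow2 \<Longrightarrow> 0 < d"
  by (auto simp: pow2_def)

lemma pow2_1 [simp]: "1 \<in> pow2"
  unfolding pow2_def by (rule range_eqI[of _ _ 0]) simp

lemma pow2_mult: "c \<in> pow2 \<Longrightarrow> d \<in> pow2 \<Longrightarrow> c * d \<in> pow2"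
  unfolding pow2_def by (auto simp: power_int_add[symmetric])

lemma pow2_inverse: "d \<in> pow2 \<Longrightarrow> inverse d \<in> pow2"
  unfolding pow2_def by (auto simp: power_int_minus[symmetric])

lemma pow2_borel [measurable]: "pow2 \<in> sets borel"
proof -
  have "countable pow2"
    unfolding pow2_def by (intro countable_image) auto
  then show ?thesis
    by (rule sets.countable[rotated]) simp
qed

text \<open>A chosen version of the Radon-Nikodym derivative. Demanding powers of 2 at every point,
  not just almost everywhere, makes positivity and the algebra of complex powers pointwise
  facts.\<close>

definition pow2_density :: "(complex \<Rightarrow> complex) \<Rightarrow> (complex \<Rightarrow> real) \<Rightarrow> bool" where
  "pow2_density \<gamma> d \<longleftrightarrow> d \<in> borel_measurable circle_measure \<and> (\<forall>z. d z \<in> pow2) \<and>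
     distr circle_measure circle_measure \<gamma> = density circle_measure (\<lambda>z. ennreal (d z))"

text \<open>An ambient group for T that is easy to check on generators; the properties it records
  are all that is needed for \<open>rho\<close> to be well defined and unitary.\<close>

definition circle_auts :: "(complex \<Rightarrow> complex) set" where
  "circle_auts = {\<gamma> \<in> Bij circle. \<gamma> \<in> measurable circle_measure circle_measure \<and>
     inv_into circle \<gamma> \<in> measurable circle_measure circle_measure \<and> (\<exists>d. pow2_density \<gamma> d)}"

lemma circle_autsD:
  assumes "\<gamma> \<in> circle_auts"
  shows "\<gamma> \<in> Bij circle" "\<gamma> \<in> measurable circle_measure circle_measure"
    "inv_into circle \<gamma> \<in> measurable circle_measure circle_measure"
  using assms by (auto simp: circle_auts_def)

lemma Bij_circle_inv:
  assumes "\<gamma> \<in> Bij circle" "z \<in> circle"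
  shows "inv_into circle \<gamma> z \<in> circle" "\<gamma> (inv_into circle \<gamma> z) = z"
    "\<gamma> z \<in> circle" "inv_into circle \<gamma> (\<gamma> z) = z"
  using assms by (auto simp: Bij_def bij_betw_def inv_into_into f_inv_into_f)

lemma inv_into_compose_circle:
  assumes \<gamma>: "\<gamma> \<in> Bij circle" and \<delta>: "\<delta> \<in> Bij circle" and z: "z \<in> circle"
  shows "inv_into circle (compose circle \<gamma> \<delta>) z = inv_into circle \<delta> (inv_into circle \<gamma> z)"
proof (rule inv_into_f_eq)
  show "inj_on (compose circle \<gamma> \<delta>) circle"
    using compose_Bij[OF \<gamma> \<delta>] by (simp add: Bij_def bij_betw_def)
qed (simp_all add: compose_def z Bij_circle_inv[OF \<gamma>] Bij_circle_inv[OF \<delta>])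

text \<open>The chain rule, or cocycle identity, for Radon-Nikodym derivatives; powers of 2 are
  closed under products.\<close>

lemma pow2_density_compose:
  assumes \<gamma>: "\<gamma> \<in> circle_auts" "pow2_density \<gamma> c" and \<delta>: "\<delta> \<in> circle_auts" "pow2_density \<delta> d"
  shows "pow2_density (compose circle \<gamma> \<delta>) (\<lambda>z. c z * d (inv_into circle \<gamma> z))"
  unfolding pow2_density_def
proof (intro conjI allI)
  note [measurable] = circle_autsD(2,3)[OF \<gamma>(1)] circle_autsD(2,3)[OF \<delta>(1)]
  have [measurable]: "c \<in> borel_measurable circle_measure" "d \<in> borel_measurable circle_measure"
    using \<gamma> \<delta> by (auto simp: pow2_density_def)
  have pos: "0 < c z" "0 < d z" for z
    using \<gamma> \<delta> by (auto simp: pow2_density_def pow2_pos)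
  show "(\<lambda>z. c z * d (inv_into circle \<gamma> z)) \<in> borel_measurable circle_measure"
    by measurable
  show "c z * d (inv_into circle \<gamma> z) \<in> pow2" for z
    using \<gamma> \<delta> by (auto simp: pow2_density_def pow2_mult)
  have "distr circle_measure circle_measure (compose circle \<gamma> \<delta>) =
      distr circle_measure circle_measure (\<gamma> \<circ> \<delta>)"
    by (rule distr_cong) (auto simp: compose_def)
  also have "\<dots> = distr (distr circle_measure circle_measure \<delta>) circle_measure \<gamma>"
    by (rule distr_distr[symmetric]) measurable
  also have "distr circle_measure circle_measure \<delta> = density circle_measure (\<lambda>z. ennreal (d z))"
    using \<delta> by (simp add: pow2_density_def)
  \<comment> \<open>Written as a function of \<open>\<gamma> z\<close>, the density can be moved
    outside the pushforward by \<open>\<gamma>\<close>.\<close>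
  also have "\<dots> = density circle_measure (\<lambda>z. ennreal (d (inv_into circle \<gamma> (\<gamma> z))))"
    using Bij_circle_inv[OF circle_autsD(1)[OF \<gamma>(1)]] by (intro density_cong) auto
  also have "distr \<dots> circle_measure \<gamma> =
      density (distr circle_measure circle_measure \<gamma>) (\<lambda>z. ennreal (d (inv_into circle \<gamma> z)))"
    by (rule density_distr[symmetric]) measurable
  also have "\<dots> = density circle_measure (\<lambda>z. ennreal (c z) * ennreal (d (inv_into circle \<gamma> z)))"
    using \<gamma>(2) by (simp add: pow2_density_def density_density_eq)
  also have "\<dots> = density circle_measure (\<lambda>z. ennreal (c z * d (inv_into circle \<gamma> z)))"
    by (intro density_cong) (auto simp: ennreal_mult pos less_imp_le)
  finally show "distr circle_measure circle_measure (compose circle \<gamma> \<delta>) = \<dots>" .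
qed

text \<open>The map \<open>\<delta>\<close> is prescribed on the circle only, so that the lemma
  serves both \<open>inv_into circle \<gamma>\<close>, whose values elsewhere are arbitrary, and its
  extensional restriction.\<close>

lemma pow2_density_inverse:
  assumes \<gamma>: "\<gamma> \<in> Bij circle" "\<gamma> \<in> measurable circle_measure circle_measure"
      "inv_into circle \<gamma> \<in> measurable circle_measure circle_measure"
    and d: "pow2_density \<gamma> d"
    and \<delta>: "\<And>z. z \<in> circle \<Longrightarrow> \<delta> z = inv_into circle \<gamma> z"
  shows "pow2_density \<delta> (\<lambda>z. inverse (d (if z \<in> circle then \<gamma> z else 1)))"
  unfolding pow2_density_def
proof (intro conjI allI)
  note [measurable] = \<gamma>(2,3)
  have [measurable]: "d \<in> borel_measurable circle_measure"
    using d by (auto simp: pow2_density_def)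
  have d2: "d z \<in> pow2" for z
    using d by (auto simp: pow2_density_def)
  let ?e = "\<lambda>z. inverse (d (if z \<in> circle then \<gamma> z else 1))"
  have e: "(\<lambda>z. inverse (d (\<gamma> z))) \<in> borel_measurable circle_measure"
    by measurable
  then show em: "?e \<in> borel_measurable circle_measure"
    by (rule measurable_cong[THEN iffD1, rotated]) auto
  show "?e z \<in> pow2" for z
    using d2 by (auto intro: pow2_inverse)
  \<comment> \<open>Dividing by \<open>d\<close> exhibits the circle measure as the pushforward
    under \<open>\<gamma>\<close> of the measure with density
    \<open>inverse (d (\<gamma> z))\<close>; pushing forward by the inverse then undoes
    \<open>\<gamma>\<close>.\<close>
  have "circle_measure = density (density circle_measure (\<lambda>z. ennreal (d z))) (\<lambda>z. ennreal (inverse (d z)))"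
  proof -
    have "ennreal (d z) * ennreal (inverse (d z)) = 1" for z
      using pow2_pos[OF d2[of z]] by (simp add: ennreal_mult[symmetric])
    then show ?thesis
      by (simp add: density_density_eq density_1)
  qed
  also have "density circle_measure (\<lambda>z. ennreal (d z)) = distr circle_measure circle_measure \<gamma>"
    using d by (simp add: pow2_density_def)
  also have "density \<dots> (\<lambda>z. ennreal (inverse (d z))) =
      distr (density circle_measure (\<lambda>z. ennreal (inverse (d (\<gamma> z))))) circle_measure \<gamma>"
    by (rule density_distr) measurable
  finally have eq: "circle_measure = distr (density circle_measure (\<lambda>z. ennreal (inverse (d (\<gamma> z))))) circle_measure \<gamma>" .
  have "distr circle_measure circle_measure \<delta> = distr circle_measure circle_measure (inv_into circle \<gamma>)"
    by (rule distr_cong) (auto simp: \<delta>)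
  also have "\<dots> = distr (distr (density circle_measure (\<lambda>z. ennreal (inverse (d (\<gamma> z))))) circle_measure \<gamma>)
      circle_measure (inv_into circle \<gamma>)"
    by (simp only: eq[symmetric])
  also have "\<dots> =
      distr (density circle_measure (\<lambda>z. ennreal (inverse (d (\<gamma> z))))) circle_measure (inv_into circle \<gamma> \<circ> \<gamma>)"
    by (rule distr_distr) (auto simp: measurable_cong_sets[OF sets_density refl])
  also have "\<dots> = distr (density circle_measure (\<lambda>z. ennreal (inverse (d (\<gamma> z)))))
      (density circle_measure (\<lambda>z. ennreal (inverse (d (\<gamma> z))))) (\<lambda>z. z)"
    using Bij_circle_inv[OF \<gamma>(1)] by (intro distr_cong) auto
  also have "\<dots> = density circle_measure (\<lambda>z. ennreal (inverse (d (\<gamma> z))))"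
    by (rule distr_id)
  also have "\<dots> = density circle_measure (\<lambda>z. ennreal (?e z))"
    by (intro density_cong measurable_compose[OF em measurable_ennreal]
        measurable_compose[OF e measurable_ennreal]) auto
  finally show "distr circle_measure circle_measure \<delta> = density circle_measure (\<lambda>z. ennreal (?e z))" .
qed

lemma circle_auts_inverse:
  assumes \<gamma>: "\<gamma> \<in> circle_auts"
  shows "restrict (inv_into circle \<gamma>) circle \<in> circle_auts"
proof -
  let ?\<delta> = "restrict (inv_into circle \<gamma>) circle"
  note b = circle_autsD[OF \<gamma>]
  obtain d where d: "pow2_density \<gamma> d"
    using \<gamma> by (auto simp: circle_auts_def)
  have inv: "inv_into circle ?\<delta> z = \<gamma> z" if "z \<in> circle" for z
  proof (rule inv_into_f_eq)
    show "inj_on ?\<delta> circle"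
      using restrict_inv_into_Bij[OF b(1)] by (simp add: Bij_def bij_betw_def)
  qed (use that Bij_circle_inv[OF b(1)] in auto)
  have "pow2_density ?\<delta> (\<lambda>z. inverse (d (if z \<in> circle then \<gamma> z else 1)))"
    by (rule pow2_density_inverse[OF b d]) auto
  moreover have "?\<delta> \<in> measurable circle_measure circle_measure"
    using b(3) by (rule measurable_cong[THEN iffD1, rotated]) auto
  moreover have "inv_into circle ?\<delta> \<in> measurable circle_measure circle_measure"
    using b(2) by (rule measurable_cong[THEN iffD1, rotated]) (auto simp: inv)
  ultimately show ?thesis
    using restrict_inv_into_Bij[OF b(1)] by (auto simp: circle_auts_def)
qed

lemma subgroup_circle_auts: "subgroup circle_auts (BijGroup circle)"
proof (rule group.subgroupI[OF group_BijGroup])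
  show "circle_auts \<subseteq> carrier (BijGroup circle)"
    by (auto simp: circle_auts_def BijGroup_def)
  have id: "(\<lambda>z\<in>circle. z) \<in> Bij circle"
    by (rule id_Bij)
  have meas: "(\<lambda>z\<in>circle. z) \<in> measurable circle_measure circle_measure"
    by (rule measurable_cong[THEN iffD1, OF _ measurable_ident]) auto
  have "inv_into circle (\<lambda>z\<in>circle. z) z = z" if "z \<in> circle" for z
    using Bij_circle_inv(4)[OF id that] that by simp
  then have "inv_into circle (\<lambda>z\<in>circle. z) \<in> measurable circle_measure circle_measure"
    by (intro measurable_cong[THEN iffD1, OF _ measurable_ident]) auto
  moreover have "distr circle_measure circle_measure (\<lambda>z\<in>circle. z) = distr circle_measure circle_measure (\<lambda>z. z)"
    by (rule distr_cong) auto
  then have "pow2_density (\<lambda>z\<in>circle. z) (\<lambda>_. 1)"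
    by (simp add: pow2_density_def density_1)
  ultimately have "(\<lambda>z\<in>circle. z) \<in> circle_auts"
    using id meas by (auto simp: circle_auts_def)
  then show "circle_auts \<noteq> {}"
    by auto
  show "inv\<^bsub>BijGroup circle\<^esub> \<gamma> \<in> circle_auts" if "\<gamma> \<in> circle_auts" for \<gamma>
    using circle_auts_inverse[OF that] circle_autsD(1)[OF that] by (simp add: inv_BijGroup)
  show "\<gamma> \<otimes>\<^bsub>BijGroup circle\<^esub> \<delta> \<in> circle_auts" if \<gamma>: "\<gamma> \<in> circle_auts" and \<delta>: "\<delta> \<in> circle_auts" for \<gamma> \<delta>
  proof -
    note b = circle_autsD[OF \<gamma>] circle_autsD[OF \<delta>]
    note [measurable] = b(2,3,5,6)
    obtain c d where "pow2_density \<gamma> c" "pow2_density \<delta> d"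
      using \<gamma> \<delta> by (auto simp: circle_auts_def)
    then have "\<exists>d. pow2_density (compose circle \<gamma> \<delta>) d"
      using pow2_density_compose \<gamma> \<delta> by blast
    moreover have "(\<lambda>z. \<gamma> (\<delta> z)) \<in> measurable circle_measure circle_measure"
      by measurable
    then have "compose circle \<gamma> \<delta> \<in> measurable circle_measure circle_measure"
      by (rule measurable_cong[THEN iffD1, rotated]) (auto simp: compose_def)
    moreover have "(\<lambda>z. inv_into circle \<delta> (inv_into circle \<gamma> z)) \<in> measurable circle_measure circle_measure"
      by measurable
    then have "inv_into circle (compose circle \<gamma> \<delta>) \<in> measurable circle_measure circle_measure"
      by (rule measurable_cong[THEN iffD1, rotated]) (auto simp: inv_into_compose_circle b)
    ultimately have "compose circle \<gamma> \<delta> \<in> circle_auts"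
      using compose_Bij[OF b(1) b(4)] by (auto simp: circle_auts_def)
    then show ?thesis
      using b by (simp add: BijGroup_def)
  qed
qed

lemma rotation_Bij: "restrict (\<lambda>z. circle_param r * z) circle \<in> Bij circle"
  and rotation_inv: "z \<in> circle \<Longrightarrow>
    inv_into circle (restrict (\<lambda>z. circle_param r * z) circle) z = circle_param (- r) * z"
proof -
  have *: "circle_param (- r) * (circle_param r * z) = z" "circle_param r * (circle_param (- r) * z) = z" for z
    by (simp_all add: mult.assoc[symmetric] circle_param_add[symmetric])
  show Bij: "restrict (\<lambda>z. circle_param r * z) circle \<in> Bij circle"
    unfolding Bij_def
  proof (intro IntI CollectI restrict_extensional)
    show "bij_betw (restrict (\<lambda>z. circle_param r * z) circle) circle circle"
      by (rule bij_betwI[where g = "\<lambda>z. circle_param (- r) * z"]) (auto simp: circle_mult *)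
  qed
  show "inv_into circle (restrict (\<lambda>z. circle_param r * z) circle) z = circle_param (- r) * z"
    if "z \<in> circle"
    by (rule inv_into_f_eq) (use Bij that in \<open>auto simp: Bij_def bij_betw_def circle_mult *\<close>)
qed

lemma rotation_density: "pow2_density (restrict (\<lambda>z. circle_param r * z) circle) (\<lambda>_. 1)"
proof -
  have "distr circle_measure circle_measure (restrict (\<lambda>z. circle_param r * z) circle) =
    distr circle_measure circle_measure (\<lambda>z. circle_param r * z)"
    by (rule distr_cong) auto
  then show ?thesis
    by (simp add: pow2_density_def distr_rotation density_1)
qed

lemma rotation_circle_auts: "restrict (\<lambda>z. circle_param r * z) circle \<in> circle_auts"
proof -
  have "restrict (\<lambda>z. circle_param r * z) circle \<in> measurable circle_measure circle_measure"
    by (rule measurable_cong[THEN iffD1, OF _ rotation_measurable[of r]]) auto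
  moreover have "inv_into circle (restrict (\<lambda>z. circle_param r * z) circle) \<in> measurable circle_measure circle_measure"
    by (rule measurable_cong[THEN iffD1, OF _ rotation_measurable[of "- r"]]) (auto simp: rotation_inv)
  ultimately show ?thesis
    using rotation_Bij rotation_density by (auto simp: circle_auts_def)
qed

section \<open>Elements of Thompson's group F\<close>

lemma thompson_FD:
  assumes "\<phi> \<in> thompson_F"
  shows "continuous_on {0..1} \<phi>" "continuous_on {0..1} (inv_into {0..1} \<phi>)"
    "bij_betw \<phi> {0..1} {0..1}" "strict_mono_on {0..1} \<phi>"
proof -
  have h: "homeomorphism {0..1} {0..1} \<phi> (inv_into {0..1} \<phi>)" and m: "strict_mono_on {0..1} \<phi>"
    using assms by (auto simp: thompson_F_def)
  then show "continuous_on {0..1} \<phi>" "continuous_on {0..1} (inv_into {0..1} \<phi>)" "strict_mono_on {0..1} \<phi>"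
    by (auto simp: homeomorphism_def)
  show "bij_betw \<phi> {0..1} {0..1}"
    using h m by (auto simp: homeomorphism_def bij_betw_def strict_mono_on_imp_inj_on)
qed

lemma thompson_F_range: "\<phi> \<in> thompson_F \<Longrightarrow> t \<in> {0..1} \<Longrightarrow> \<phi> t \<in> {0..1}"
  using bij_betwE[OF thompson_FD(3)] by blast

lemma thompson_F_less_iff:
  assumes "\<phi> \<in> thompson_F" "s \<in> {0..1}" "t \<in> {0..1}"
  shows "\<phi> s < \<phi> t \<longleftrightarrow> s < t"
  using strict_mono_on_less[OF thompson_FD(4)[OF assms(1)] assms(2,3)] .

lemma thompson_F_le_iff:
  assumes "\<phi> \<in> thompson_F" "s \<in> {0..1}" "t \<in> {0..1}"
  shows "\<phi> s \<le> \<phi> t \<longleftrightarrow> s \<le> t"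
  using thompson_F_less_iff[OF assms(1,3,2)] by linarith

lemma thompson_F_0: "\<phi> \<in> thompson_F \<Longrightarrow> \<phi> 0 = 0" and thompson_F_1: "\<phi> \<in> thompson_F \<Longrightarrow> \<phi> 1 = 1"
proof -
  assume \<phi>: "\<phi> \<in> thompson_F"
  obtain a b where a: "a \<in> {0..1}" "\<phi> a = 0" and b: "b \<in> {0..1}" "\<phi> b = 1"
  proof -
    have "\<phi> ` {0..1} = {0..1}"
      using thompson_FD(3)[OF \<phi>] by (simp add: bij_betw_def)
    then have "0 \<in> \<phi> ` {0..1}" "1 \<in> \<phi> ` {0..1}"
      by auto
    then show ?thesis
      using that by (metis imageE)
  qed
  show "\<phi> 0 = 0"
    using thompson_F_le_iff[OF \<phi>, of 0 a] thompson_F_range[OF \<phi>, of 0] a by auto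
  show "\<phi> 1 = 1"
    using thompson_F_le_iff[OF \<phi>, of b 1] thompson_F_range[OF \<phi>, of 1] b by auto
qed

text \<open>Clamping the argument extends a function on [0,1] to a Borel function on the whole line,
  so that restricted measurable spaces are avoided.\<close>

lemma continuous_clamp_borel:
  fixes f :: "real \<Rightarrow> real"
  assumes "continuous_on {0..1} f"
  shows "(\<lambda>t. f (max 0 (min 1 t))) \<in> borel_measurable borel"
proof (rule borel_measurable_continuous_onI, rule continuous_on_compose2[OF assms])
  show "continuous_on UNIV (\<lambda>t::real. max 0 (min 1 t))"
    by (intro continuous_intros)
qed auto

text \<open>Provides a Borel slope function that is a power of 2 everywhere and is the two-sided
  derivative off finitely many interior points.\<close>

lemma thompson_F_slope:
  assumes \<phi>: "\<phi> \<in> thompson_F"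
  obtains d S where "d \<in> borel_measurable borel" "\<And>t. d t \<in> pow2" "finite S"
    "\<And>t. t \<in> {0<..<1} - S \<Longrightarrow> (\<phi> has_real_derivative d t) (at t)"
proof -
  define S where "S = {x \<in> {0..1}. \<not> \<phi> differentiable (at x within {0..1})}"
  define g where "g t = \<phi> (max 0 (min 1 t))" for t
  have [measurable]: "g \<in> borel_measurable borel"
    unfolding g_def by (intro continuous_clamp_borel thompson_FD[OF \<phi>])
  \<comment> \<open>Difference quotients along one fixed sequence of increments: a pointwise limit
    of Borel functions is Borel.\<close>
  define e where "e t = lim (\<lambda>n. (g (t + 1 / real (Suc n)) - g t) / (1 / real (Suc n)))" for t
  have [measurable]: "e \<in> borel_measurable borel"
    unfolding e_def by (rule borel_measurable_lim_metric) measurable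
  \<comment> \<open>The default 1 keeps the values in \<open>pow2\<close> also at the exceptional
    points and outside (0,1).\<close>
  define d where "d t = (if e t \<in> pow2 then e t else 1)" for t
  show ?thesis
  proof (rule that[of d S])
    show "d \<in> borel_measurable borel"
      unfolding d_def by measurable
    show "d t \<in> pow2" for t
      by (simp add: d_def)
    show "finite S"
      using \<phi> by (auto simp: thompson_F_def S_def)
    fix t assume t: "t \<in> {0<..<1} - S"
    then obtain k :: int where k: "(\<phi> has_real_derivative 2 powi k) (at t within {0..1})"
      using \<phi> by (auto simp: thompson_F_def S_def)
    then have D: "(\<phi> has_real_derivative 2 powi k) (at t)"
      using t by (simp add: at_within_Icc_at)
    have lim0: "(\<lambda>n. t + 1 / real (Suc n)) \<longlonglongrightarrow> t + 0"
      by (intro tendsto_add tendsto_const LIMSEQ_Suc[OF lim_1_over_n])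
    then have lim: "filterlim (\<lambda>n. t + 1 / real (Suc n)) (at t) sequentially"
      by (auto simp: filterlim_at)
    have ev: "\<forall>\<^sub>F n in sequentially. t + 1 / real (Suc n) < 1"
      using order_tendstoD(2)[OF lim0, of 1] t by simp
    have "(\<lambda>n. (\<phi> (t + 1 / real (Suc n)) - \<phi> t) / (t + 1 / real (Suc n) - t)) \<longlonglongrightarrow> 2 powi k"
      using D lim unfolding has_field_derivative_iff by (rule filterlim_compose)
    then have "(\<lambda>n. (g (t + 1 / real (Suc n)) - g t) / (1 / real (Suc n))) \<longlonglongrightarrow> 2 powi k"
    proof (rule Lim_transform_eventually)
      show "\<forall>\<^sub>F n in sequentially. (\<phi> (t + 1 / real (Suc n)) - \<phi> t) / (t + 1 / real (Suc n) - t) =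
        (g (t + 1 / real (Suc n)) - g t) / (1 / real (Suc n))"
        using ev by eventually_elim (use t in \<open>auto simp: g_def\<close>)
    qed
    then have "e t = 2 powi k"
      unfolding e_def by (rule limI)
    then have "d t = 2 powi k"
      by (auto simp: d_def pow2_def)
    with D show "(\<phi> has_real_derivative d t) (at t)"
      by simp
  qed
qed

section \<open>Circle maps induced by elements of F\<close>

lemma thompson_F_circle_coord:
  assumes \<phi>: "\<phi> \<in> thompson_F" and \<gamma>: "\<And>t. t \<in> {0..1} \<Longrightarrow> \<gamma> (circle_param t) = circle_param (\<phi> t)"
    and z: "z \<in> circle"
  shows "circle_coord (\<gamma> z) = \<phi> (circle_coord z)"
proof -
  have t: "circle_coord z \<in> {0..1}"
    using circle_coord_bounds[of z] by auto
  then have "\<gamma> z = circle_param (\<phi> (circle_coord z))"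
    using \<gamma>[of "circle_coord z"] circle_param_coord[OF z] by simp
  moreover have "\<phi> (circle_coord z) < 1" "0 \<le> \<phi> (circle_coord z)"
    using thompson_F_less_iff[OF \<phi> t, of 1] thompson_F_1[OF \<phi>] circle_coord_bounds[of z] thompson_F_range[OF \<phi> t]
    by auto
  ultimately show ?thesis
    by (simp add: circle_coord_param)
qed

lemma thompson_F_measurable:
  assumes \<phi>: "\<phi> \<in> thompson_F" and B: "\<gamma> \<in> Bij circle"
    and \<gamma>: "\<And>t. t \<in> {0..1} \<Longrightarrow> \<gamma> (circle_param t) = circle_param (\<phi> t)"
  shows "\<gamma> \<in> measurable circle_measure circle_measure"
    and "inv_into circle \<gamma> \<in> measurable circle_measure circle_measure"
proof -
  have [measurable]: "(\<lambda>t. \<phi> (max 0 (min 1 t))) \<in> borel_measurable borel"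
    "(\<lambda>t. inv_into {0..1} \<phi> (max 0 (min 1 t))) \<in> borel_measurable borel"
    by (intro continuous_clamp_borel thompson_FD[OF \<phi>])+
  have "(\<lambda>z. circle_param (\<phi> (max 0 (min 1 (circle_coord z))))) \<in> measurable circle_measure circle_measure"
    by measurable
  then show "\<gamma> \<in> measurable circle_measure circle_measure"
  proof (rule measurable_cong[THEN iffD1, rotated])
    fix z assume "z \<in> space circle_measure"
    then show "circle_param (\<phi> (max 0 (min 1 (circle_coord z)))) = \<gamma> z"
      using \<gamma>[of "circle_coord z"] circle_coord_bounds[of z] by (simp add: circle_param_coord)
  qed
  have "(\<lambda>z. circle_param (inv_into {0..1} \<phi> (max 0 (min 1 (circle_coord z))))) \<in> measurable circle_measure circle_measure"
    by measurable
  then show "inv_into circle \<gamma> \<in> measurable circle_measure circle_measure"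
  proof (rule measurable_cong[THEN iffD1, rotated])
    fix z assume "z \<in> space circle_measure"
    then have z: "z \<in> circle" by simp
    let ?u = "inv_into {0..1} \<phi> (circle_coord z)"
    have t: "circle_coord z \<in> \<phi> ` {0..1}"
      using circle_coord_bounds[of z] thompson_FD(3)[OF \<phi>] by (auto simp: bij_betw_def)
    have "\<gamma> (circle_param ?u) = circle_param (\<phi> ?u)"
      by (intro \<gamma> inv_into_into t)
    also have "\<dots> = z"
      by (simp add: f_inv_into_f[OF t] circle_param_coord z)
    finally have "circle_param ?u = inv_into circle \<gamma> z"
      using Bij_circle_inv(4)[OF B, of "circle_param ?u"] by simp
    then show "circle_param (inv_into {0..1} \<phi> (max 0 (min 1 (circle_coord z)))) = inv_into circle \<gamma> z"
      using circle_coord_bounds[of z] by simp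
  qed
qed

text \<open>The derivative of \<open>\<phi>\<close> is the density of the pushforward under the
  inverse of \<open>\<gamma>\<close>: the arc up to \<open>y\<close> receives the mass of its image
  under \<open>\<gamma>\<close>, which is \<open>\<phi> y\<close>, the integral of the slope from 0
  to \<open>y\<close>.\<close>

lemma thompson_F_density:
  assumes \<phi>: "\<phi> \<in> thompson_F" and B: "\<gamma> \<in> Bij circle"
    and \<gamma>: "\<And>t. t \<in> {0..1} \<Longrightarrow> \<gamma> (circle_param t) = circle_param (\<phi> t)"
    and d: "d \<in> borel_measurable borel" "\<And>t. d t \<in> pow2"
    and S: "finite S" "\<And>t. t \<in> {0<..<1} - S \<Longrightarrow> (\<phi> has_real_derivative d t) (at t)"
  shows "pow2_density (inv_into circle \<gamma>) (\<lambda>z. d (circle_coord z))"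
  unfolding pow2_density_def
proof (intro conjI allI)
  note [measurable] = d(1) thompson_F_measurable[OF \<phi> B \<gamma>]
  show dm: "(\<lambda>z. d (circle_coord z)) \<in> borel_measurable circle_measure"
    by measurable
  show "d (circle_coord z) \<in> pow2" for z by (rule d)
  have L: "emeasure (distr circle_measure circle_measure (inv_into circle \<gamma>)) {z \<in> circle. circle_coord z \<le> y} = ennreal (\<phi> y)"
    if y: "0 \<le> y" "y \<le> 1" for y
  proof -
    have "emeasure (distr circle_measure circle_measure (inv_into circle \<gamma>)) {z \<in> circle. circle_coord z \<le> y} =
      emeasure circle_measure (inv_into circle \<gamma> -` {z \<in> circle. circle_coord z \<le> y} \<inter> space circle_measure)"
      using sets_circle_coord[of "{..y}"] by (intro emeasure_distr) auto
    also have "inv_into circle \<gamma> -` {z \<in> circle. circle_coord z \<le> y} \<inter> space circle_measure = {z \<in> circle. circle_coord z \<in> {..\<phi> y}}"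
    proof -
      have "circle_coord (inv_into circle \<gamma> z) \<le> y \<longleftrightarrow> circle_coord z \<le> \<phi> y" if z: "z \<in> circle" for z
      proof -
        let ?w = "inv_into circle \<gamma> z"
        have w: "?w \<in> circle" "\<gamma> ?w = z"
          using Bij_circle_inv[OF B z] by auto
        have "circle_coord z = \<phi> (circle_coord ?w)"
          using thompson_F_circle_coord[OF \<phi> \<gamma> w(1)] w(2) by simp
        then show ?thesis
          using thompson_F_le_iff[OF \<phi>, of "circle_coord ?w" y] y circle_coord_bounds[of ?w] by simp
      qed
      then show ?thesis
        using Bij_circle_inv[OF B] by auto
    qed
    also have "emeasure circle_measure \<dots> = emeasure lborel ({0..<1} \<inter> {..\<phi> y})"
      by (rule emeasure_circle_coord) simp
    also have "\<dots> = ennreal (\<phi> y)"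
    \<comment> \<open>Coordinates never reach 1, so in this case the arc is the whole half-open
      interval.\<close>
    proof (cases "\<phi> y = 1")
      case True
      then have "{0..<1} \<inter> {..\<phi> y} = {0..<1}" by auto
      then show ?thesis using True by simp
    next
      case False
      then have "{0..<1} \<inter> {..\<phi> y} = {0..\<phi> y}"
        using thompson_F_range[OF \<phi>, of y] y by auto
      then show ?thesis using thompson_F_range[OF \<phi>, of y] y by simp
    qed
    finally show ?thesis .
  qed
  have R: "emeasure (density circle_measure (\<lambda>z. ennreal (d (circle_coord z)))) {z \<in> circle. circle_coord z \<le> y} = ennreal (\<phi> y)"
    if y: "0 \<le> y" "y \<le> 1" for y
  proof -
    have "{z \<in> circle. circle_coord z \<le> y} \<in> sets circle_measure"
      using sets_circle_coord[of "{..y}"] by simp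
    then have "emeasure (density circle_measure (\<lambda>z. ennreal (d (circle_coord z)))) {z \<in> circle. circle_coord z \<le> y} =
      (\<integral>\<^sup>+z. ennreal (d (circle_coord z)) * indicator {z \<in> circle. circle_coord z \<le> y} z \<partial>circle_measure)"
      by (subst emeasure_density) auto
    also have "\<dots> = (\<integral>\<^sup>+z. ennreal (d (circle_coord z)) * indicator {..y} (circle_coord z) \<partial>circle_measure)"
      by (intro nn_integral_cong) (auto simp: indicator_def)
    also have "\<dots> = (\<integral>\<^sup>+t. indicator {0..<1} t * (ennreal (d t) * indicator {..y} t) \<partial>lborel)"
      by (rule nn_integral_circle_coord) measurable
    also have "\<dots> = (\<integral>\<^sup>+t. ennreal (d t) * indicator {0..y} t \<partial>lborel)"
    proof (rule nn_integral_cong_AE)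
      have "AE t in lborel. t \<noteq> (1::real)"
        by (rule AE_lborel_singleton)
      then show "AE t in lborel. indicator {0..<1} t * (ennreal (d t) * indicator {..y} t) = ennreal (d t) * indicator {0..y} t"
        by eventually_elim (use y in \<open>auto simp: indicator_def\<close>)
    qed
    also have "\<dots> = ennreal (\<phi> y - \<phi> 0)"
    proof (rule nn_integral_has_integral_lebesgue')
      show "0 \<le> d t" for t
        using pow2_pos[OF d(2)] by (simp add: less_imp_le)
      show "(d has_integral \<phi> y - \<phi> 0) {0..y}"
      \<comment> \<open>This form of the theorem tolerates the finite set \<open>S\<close> of
        interior points without derivative, given continuity.\<close>
      proof (rule fundamental_theorem_of_calculus_interior_strong[OF S(1) y(1)])
        show "continuous_on {0..y} \<phi>"
          using continuous_on_subset[OF thompson_FD(1)[OF \<phi>]] y by auto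
      qed (use S(2) y in \<open>auto simp: has_real_derivative_iff_has_vector_derivative[symmetric]\<close>)
    qed
    finally show ?thesis
      by (simp add: thompson_F_0[OF \<phi>])
  qed
  show "distr circle_measure circle_measure (inv_into circle \<gamma>) = density circle_measure (\<lambda>z. ennreal (d (circle_coord z)))"
  proof (rule circle_measure_eqI)
    show "finite_measure (distr circle_measure circle_measure (inv_into circle \<gamma>))"
      by (intro circle_measure.finite_measure_distr) measurable
    have "{z \<in> circle. circle_coord z \<le> 1} = circle"
      using circle_coord_bounds(2) by (auto intro: less_imp_le)
    then show "finite_measure (density circle_measure (\<lambda>z. ennreal (d (circle_coord z))))"
      using R[of 1] by (intro finite_measureI) simp
  qed (simp_all add: L R)
qed

text \<open>The slope gives a density for the inverse of \<open>\<gamma>\<close>; the inversion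
  formula for densities then supplies one for \<open>\<gamma>\<close> itself.\<close>

lemma thompson_F_circle_auts:
  assumes "\<gamma> \<in> thompson_F_circle"
  shows "\<gamma> \<in> circle_auts"
proof -
  from assms obtain \<phi> where B: "\<gamma> \<in> Bij circle" and \<phi>: "\<phi> \<in> thompson_F"
    and \<gamma>: "\<And>t. t \<in> {0..1} \<Longrightarrow> \<gamma> (circle_param t) = circle_param (\<phi> t)"
    by (auto simp: thompson_F_circle_def)
  obtain d S where d: "d \<in> borel_measurable borel" "\<And>t. d t \<in> pow2" "finite S"
    "\<And>t. t \<in> {0<..<1} - S \<Longrightarrow> (\<phi> has_real_derivative d t) (at t)"
    using thompson_F_slope[OF \<phi>] by blast
  note m = thompson_F_measurable[OF \<phi> B \<gamma>]
  let ?\<delta> = "restrict (inv_into circle \<gamma>) circle"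
  have \<delta>: "?\<delta> \<in> Bij circle"
    by (rule restrict_inv_into_Bij[OF B])
  have inv: "inv_into circle ?\<delta> z = \<gamma> z" if "z \<in> circle" for z
  proof (rule inv_into_f_eq)
    show "inj_on ?\<delta> circle"
      using \<delta> by (simp add: Bij_def bij_betw_def)
  qed (use that Bij_circle_inv[OF B] in auto)
  have "distr circle_measure circle_measure ?\<delta> = distr circle_measure circle_measure (inv_into circle \<gamma>)"
    by (rule distr_cong) auto
  then have dens: "pow2_density ?\<delta> (\<lambda>z. d (circle_coord z))"
    using thompson_F_density[OF \<phi> B \<gamma> d] by (simp add: pow2_density_def)
  moreover have "?\<delta> \<in> measurable circle_measure circle_measure"
    using m(2) by (rule measurable_cong[THEN iffD1, rotated]) auto
  moreover have "inv_into circle ?\<delta> \<in> measurable circle_measure circle_measure"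
    using m(1) by (rule measurable_cong[THEN iffD1, rotated]) (auto simp: inv)
  ultimately have "\<exists>e. pow2_density \<gamma> e"
    using pow2_density_inverse[OF \<delta> _ _ dens, of \<gamma>] inv by auto
  then show ?thesis
    using B m by (auto simp: circle_auts_def)
qed

text \<open>Angles \<pi>q and 2\<pi>r correspond through r = q/2, and the dyadic numbers are closed
  under halving and doubling.\<close>

lemma dyadic_rotations_eq:
  "dyadic_rotations = {restrict (\<lambda>z. circle_param r * z) circle | r. r \<in> dyadic}"
proof -
  have eq: "exp (\<i> * complex_of_real (pi * q)) = circle_param (q / 2)" for q
    by (simp add: circle_param_def mult_ac)
  show ?thesis
  proof (intro equalityI subsetI)
    fix \<gamma> assume "\<gamma> \<in> dyadic_rotations"
    then obtain q where "q \<in> dyadic" "\<gamma> = restrict (\<lambda>z. circle_param (q / 2) * z) circle"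
      unfolding dyadic_rotations_def eq by blast
    then show "\<gamma> \<in> {restrict (\<lambda>z. circle_param r * z) circle | r. r \<in> dyadic}"
      using dyadic_half by blast
  next
    fix \<gamma> assume "\<gamma> \<in> {restrict (\<lambda>z. circle_param r * z) circle | r. r \<in> dyadic}"
    then obtain r where "r \<in> dyadic" "\<gamma> = restrict (\<lambda>z. circle_param r * z) circle"
      by blast
    then have "2 * r \<in> dyadic" "\<gamma> = restrict (\<lambda>z. circle_param ((2 * r) / 2) * z) circle"
      using dyadic_mult[OF dyadic_of_int[of 2]] by auto
    then show "\<gamma> \<in> dyadic_rotations"
      unfolding dyadic_rotations_def eq by blast
  qed
qed

section \<open>Thompson's group T as a group of measurable transformations\<close>

lemma thompson_generators_subset: "thompson_F_circle \<union> dyadic_rotations \<subseteq> carrier (BijGroup circle)"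
  using rotation_Bij by (auto simp: thompson_F_circle_def dyadic_rotations_eq BijGroup_def)

lemma thompson_T_carrier:
  "carrier thompson_T = generate (BijGroup circle) (thompson_F_circle \<union> dyadic_rotations)"
  unfolding thompson_T_def carrier_subgroup_generated
  by (subst Int_absorb1[OF thompson_generators_subset]) rule

lemma group_thompson_T: "group thompson_T"
  unfolding thompson_T_def by (intro group.group_subgroup_generated group_BijGroup)

text \<open>T is generated by its generators, all of which lie in the subgroup
  \<open>circle_auts\<close>; words in them need no inspection.\<close>

lemma thompson_T_subset: "carrier thompson_T \<subseteq> circle_auts"
  unfolding thompson_T_carrier
  by (rule group.generate_subgroup_incl[OF group_BijGroup _ subgroup_circle_auts])
     (auto simp: thompson_F_circle_auts dyadic_rotations_eq rotation_circle_auts)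

lemma thompson_T_mult:
  assumes "\<gamma> \<in> carrier thompson_T" "\<delta> \<in> carrier thompson_T"
  shows "\<gamma> \<otimes>\<^bsub>thompson_T\<^esub> \<delta> = compose circle \<gamma> \<delta>"
proof -
  have "\<gamma> \<in> Bij circle" "\<delta> \<in> Bij circle"
    using assms[THEN subsetD[OF thompson_T_subset]] circle_autsD(1) by blast+
  then show ?thesis
    unfolding thompson_T_def mult_subgroup_generated by (simp add: BijGroup_def)
qed

lemma thompson_T_inverse:
  assumes "\<gamma> \<in> carrier thompson_T"
  shows "restrict (inv_into circle \<gamma>) circle \<in> carrier thompson_T"
proof -
  have "\<gamma> \<in> Bij circle"
    using assms[THEN subsetD[OF thompson_T_subset]] circle_autsD(1) by blast
  have "inv\<^bsub>BijGroup circle\<^esub> \<gamma> \<in> generate (BijGroup circle) (thompson_F_circle \<union> dyadic_rotations)"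
    using assms unfolding thompson_T_carrier
    by (rule group.generate_m_inv_closed[OF group_BijGroup thompson_generators_subset])
  then show ?thesis
    using \<open>\<gamma> \<in> Bij circle\<close> by (simp add: thompson_T_carrier inv_BijGroup)
qed

lemma rotation_thompson_T: "r \<in> dyadic \<Longrightarrow> restrict (\<lambda>z. circle_param r * z) circle \<in> carrier thompson_T"
  unfolding thompson_T_carrier by (rule generate.incl) (auto simp: dyadic_rotations_eq)

section \<open>Expanding elements of Thompson's group\<close>

text \<open>A copy on [0,a] of the inverse of the standard generator x/2, x - 1/4, 2x - 1 of F,
  extended by the identity; \<open>contractor\<close> is the generator itself. The lattice form
  gives continuity at once and reduces identities to linear case distinctions.\<close>

definition expander :: "real \<Rightarrow> real \<Rightarrow> real" where
  "expander a t = max t (min (2 * t) (min (t + a / 4) ((t + a) / 2)))"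

definition contractor :: "real \<Rightarrow> real \<Rightarrow> real" where
  "contractor a t = min t (max (t / 2) (max (t - a / 4) (2 * t - a)))"

lemma expander_contractor: "0 < a \<Longrightarrow> 0 \<le> t \<Longrightarrow> expander a (contractor a t) = t"
  unfolding expander_def contractor_def by (simp add: max_def min_def field_simps)

lemma expander_affine:
  assumes "0 < a"
  shows "0 \<le> t \<Longrightarrow> t \<le> a / 4 \<Longrightarrow> expander a t = 2 * t"
    "a / 4 \<le> t \<Longrightarrow> t \<le> a / 2 \<Longrightarrow> expander a t = t + a / 4"
    "a / 2 \<le> t \<Longrightarrow> t \<le> a \<Longrightarrow> expander a t = t / 2 + a / 2"
    "a \<le> t \<Longrightarrow> expander a t = t"
  using assms by (auto simp: expander_def max_def min_def field_simps)

lemma expander_ge: "t \<le> expander a t"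
  by (simp add: expander_def)

lemma expander_continuous: "continuous_on S (expander a)"
  unfolding expander_def by (intro continuous_intros) auto

lemma expander_borel [measurable]: "expander a \<in> borel_measurable borel"
  by (intro borel_measurable_continuous_onI expander_continuous)

lemma expander_strict_mono: "s < t \<Longrightarrow> expander a s < expander a t"
  by (simp add: expander_def max_def min_def)

lemma expander_unit: "0 < a \<Longrightarrow> a \<le> 1 \<Longrightarrow> t \<in> {0..1} \<Longrightarrow> expander a t \<in> {0..1}"
  by (simp add: expander_def max_def min_def)

lemma contractor_unit: "0 < a \<Longrightarrow> t \<in> {0..1} \<Longrightarrow> contractor a t \<in> {0..1}"
  by (simp add: contractor_def max_def min_def)

text \<open>Covers every point of [0,1], breakpoints and end points included, by a nondegenerate
  interval of affinity. Wherever a derivative exists it must equal the slope of such an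
  interval.\<close>

lemma expander_pieces:
  assumes a: "0 < a" "a \<le> 1" and t: "t \<in> {0..1}"
  obtains l r m c where "l < r" "{l..r} \<subseteq> {0..1}" "t \<in> {l..r}" "m \<in> pow2" "\<And>x. x \<in> {l..r} \<Longrightarrow> expander a x = m * x + c"
proof -
  have m: "2 \<in> pow2" "1 / 2 \<in> pow2"
    unfolding pow2_def by (rule range_eqI[of _ _ 1], simp, rule range_eqI[of _ _ "-1"], simp)
  consider "t \<le> a / 4" | "a / 4 \<le> t" "t \<le> a / 2" | "a / 2 \<le> t" "t \<le> a" | "a < t"
    by linarith
  then show thesis
  proof cases
    case 1
    then show thesis
      using a t m expander_affine(1)[OF a(1)] by (intro that[of 0 "a / 4" 2 0]) auto
  next
    case 2
    then show thesis
      using a t m expander_affine(2)[OF a(1)] by (intro that[of "a / 4" "a / 2" 1 "a / 4"]) auto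
  next
    case 3
    then show thesis
      using a t m expander_affine(3)[OF a(1)] by (intro that[of "a / 2" a "1 / 2" "a / 2"]) auto
  next
    case 4
    then show thesis
      using a t m expander_affine(4)[OF a(1)] by (intro that[of a 1 1 0]) auto
  qed
qed

lemma expander_deriv:
  assumes a: "0 < a" and t: "0 < t"
  shows "t < a / 4 \<Longrightarrow> (expander a has_real_derivative 2) (at t)"
    "a / 4 < t \<Longrightarrow> t < a / 2 \<Longrightarrow> (expander a has_real_derivative 1) (at t)"
    "a / 2 < t \<Longrightarrow> t < a \<Longrightarrow> (expander a has_real_derivative 1 / 2) (at t)"
    "a < t \<Longrightarrow> (expander a has_real_derivative 1) (at t)"
proof -
  have *: "(expander a has_real_derivative m) (at t)"
    if "t \<in> S" "open S" "\<And>x. x \<in> S \<Longrightarrow> expander a x = m * x + c" for S m c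
  proof (rule has_field_derivative_transform_within_open[OF _ that(2,1)])
    show "((\<lambda>x. m * x + c) has_real_derivative m) (at t)"
      by (auto intro!: derivative_eq_intros)
  qed (use that in auto)
  show "(expander a has_real_derivative 2) (at t)" if "t < a / 4"
    using that t expander_affine(1)[OF a] by (intro *[of "{0<..<a / 4}" 2 0]) auto
  show "(expander a has_real_derivative 1) (at t)" if "a / 4 < t" "t < a / 2"
    using that t expander_affine(2)[OF a] by (intro *[of "{a / 4<..<a / 2}" 1 "a / 4"]) auto
  show "(expander a has_real_derivative 1 / 2) (at t)" if "a / 2 < t" "t < a"
    using that t expander_affine(3)[OF a] by (intro *[of "{a / 2<..<a}" "1 / 2" "a / 2"]) auto
  show "(expander a has_real_derivative 1) (at t)" if "a < t"
    using that t expander_affine(4)[OF a] by (intro *[of "{a<..}" 1 0]) auto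
qed

lemma dyadic_expander: "a \<in> dyadic \<Longrightarrow> t \<in> dyadic \<Longrightarrow> expander a t \<in> dyadic"
  and dyadic_contractor: "a \<in> dyadic \<Longrightarrow> t \<in> dyadic \<Longrightarrow> contractor a t \<in> dyadic"
proof -
  assume a: "a \<in> dyadic" and t: "t \<in> dyadic"
  have q: "a / 4 \<in> dyadic" "2 * t \<in> dyadic"
    using dyadic_half[OF dyadic_half[OF a]] dyadic_add[OF t t] by auto
  show "expander a t \<in> dyadic"
    unfolding expander_def max_def min_def using a t q by (auto intro: dyadic_add dyadic_half)
  show "contractor a t \<in> dyadic"
    unfolding contractor_def max_def min_def using a t q by (auto intro: dyadic_diff dyadic_half)
qed

lemma expander_image:
  assumes "0 < a" "a \<le> 1"
  shows "expander a ` {0..1} = {0..1}"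
proof (intro equalityI subsetI)
  fix t :: real assume "t \<in> {0..1}"
  then show "t \<in> expander a ` {0..1}"
    using expander_contractor[OF assms(1), of t] contractor_unit[OF assms(1), of t]
    by (intro image_eqI[of _ _ "contractor a t"]) auto
qed (use expander_unit[OF assms] in auto)

lemma expander_thompson_F:
  assumes a: "a \<in> dyadic" "0 < a" "a \<le> 1"
  shows "restrict (expander a) {0..1} \<in> thompson_F"
  unfolding thompson_F_def
proof (intro CollectI conjI)
  let ?f = "restrict (expander a) {0..1}" and ?I = "{0..1::real}" and ?P = "{0, a / 4, a / 2, a}"
  have mono: "strict_mono_on ?I ?f"
    by (auto simp: strict_mono_on_def expander_strict_mono)
  have cont: "continuous_on ?I ?f"
    using expander_continuous[of ?I a] by (rule continuous_on_eq) auto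
  have img: "?f ` ?I = ?I"
    using expander_image[OF a(2,3)] by auto
  have inj: "inj_on ?f ?I"
    using mono by (rule strict_mono_on_imp_inj_on)
  have deriv: "(?f has_real_derivative m) (at x within ?I)" if "x \<in> ?I" "(expander a has_real_derivative m) (at x)" for x m
    using has_field_derivative_at_within[OF that(2), of ?I]
    by (rule has_field_derivative_transform_within[of _ _ _ _ 1]) (use that in auto)
  \<comment> \<open>An upper bound for this set is all that finiteness and dyadicity ask for; 0 is
    put into \<open>?P\<close> because \<open>expander_deriv\<close> covers positive points.\<close>
  have nondiff: "{x \<in> ?I. \<not> ?f differentiable (at x within ?I)} \<subseteq> ?P"
  proof (rule subsetI, rule ccontr)
    fix x assume "x \<in> {x \<in> ?I. \<not> ?f differentiable (at x within ?I)}" and ne: "x \<notin> ?P"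
    then have x: "x \<in> ?I" "\<not> ?f differentiable (at x within ?I)"
      by auto
    consider "0 < x" "x < a / 4" | "0 < x" "a / 4 < x" "x < a / 2" | "0 < x" "a / 2 < x" "x < a" | "0 < x" "a < x"
      using x(1) ne by (cases "x < a / 4"; cases "x < a / 2"; cases "x < a") auto
    then have "\<exists>m. (expander a has_real_derivative m) (at x)"
      using expander_deriv[OF a(2)] by cases blast+
    then show False
      using deriv[OF x(1)] x(2) unfolding real_differentiable_def by blast
  qed
  show "?f \<in> extensional ?I" by simp
  show "homeomorphism ?I ?I ?f (inv_into ?I ?f)"
  proof -
    have "\<forall>x\<in>?I. inv_into ?I ?f (?f x) = x"
      using inv_into_f_f[OF inj] by blast
    then have "continuous_on (?f ` ?I) (inv_into ?I ?f)"
      by (rule continuous_on_inv[OF cont compact_Icc])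
    moreover have "inv_into ?I ?f ` ?I = ?I"
      using inv_into_image_cancel[OF inj order_refl] by (simp only: img)
    ultimately show ?thesis
      unfolding homeomorphism_def using cont img inv_into_f_f[OF inj] f_inv_into_f[of _ ?f ?I] by (simp only: img) blast
  qed
  show "strict_mono_on ?I ?f" by (rule mono)
  show "?f ` (dyadic \<inter> ?I) = dyadic \<inter> ?I"
  proof (intro equalityI subsetI)
    fix t assume "t \<in> dyadic \<inter> ?I"
    then show "t \<in> ?f ` (dyadic \<inter> ?I)"
      using expander_contractor[OF a(2), of t] contractor_unit[OF a(2), of t] dyadic_contractor[OF a(1), of t]
      by (intro image_eqI[of _ _ "contractor a t"]) auto
  qed (use expander_unit[OF a(2,3)] dyadic_expander[OF a(1)] in auto)
  show "finite {x \<in> ?I. \<not> ?f differentiable (at x within ?I)}"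
    using nondiff by (rule finite_subset) simp
  have "?P \<subseteq> dyadic"
    using a dyadic_half[OF a(1)] dyadic_half[OF dyadic_half[OF a(1)]] by auto
  then show "{x \<in> ?I. \<not> ?f differentiable (at x within ?I)} \<subseteq> dyadic"
    using nondiff by blast
  show "piecewise_linear_01 ?f"
    unfolding piecewise_linear_01_def
  proof (intro exI[of _ ?P] conjI allI impI)
    fix l r :: real assume lr: "0 \<le> l \<and> l < r \<and> r \<le> 1 \<and> {l<..<r} \<inter> ?P = {}"
    have out: "p \<le> l \<or> r \<le> p" if "p \<in> ?P" for p
    proof -
      have "p \<notin> {l<..<r}"
        using lr that by blast
      then show ?thesis
        by (simp add: not_less)
    qed
    consider "r \<le> a / 4" | "a / 4 \<le> l" "r \<le> a / 2" | "a / 2 \<le> l" "r \<le> a" | "a \<le> l"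
      using out[of "a / 4"] out[of "a / 2"] out[of a] by auto
    then show "\<exists>m c. \<forall>x\<in>{l..r}. ?f x = m * x + c"
    proof cases
      case 1 then show ?thesis using lr expander_affine(1)[OF a(2)] by (intro exI[of _ 2] exI[of _ 0]) auto
    next
      case 2 then show ?thesis using lr expander_affine(2)[OF a(2)] by (intro exI[of _ 1] exI[of _ "a / 4"]) auto
    next
      case 3 then show ?thesis using lr expander_affine(3)[OF a(2)] by (intro exI[of _ "1 / 2"] exI[of _ "a / 2"]) auto
    next
      case 4 then show ?thesis using lr expander_affine(4)[OF a(2)] by (intro exI[of _ 1] exI[of _ 0]) auto
    qed
  qed simp
  show "\<forall>x\<in>?I. ?f differentiable (at x within ?I) \<longrightarrow> (\<exists>k::int. (?f has_real_derivative 2 powi k) (at x within ?I))"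
  proof (intro ballI impI)
    fix x assume x: "x \<in> ?I" and "?f differentiable (at x within ?I)"
    then obtain D where D: "(?f has_real_derivative D) (at x within ?I)"
      by (auto simp: real_differentiable_def)
    obtain l r m c where p: "l < r" "{l..r} \<subseteq> ?I" "x \<in> {l..r}" "m \<in> pow2"
      "\<And>x. x \<in> {l..r} \<Longrightarrow> expander a x = m * x + c"
      using expander_pieces[OF a(2,3) x] by blast
    \<comment> \<open>Restricting to one affine piece determines \<open>D\<close> even if
      \<open>x\<close> is an end point of the piece.\<close>
    have "(?f has_real_derivative D) (at x within {l..r})"
      using D p(2) by (rule DERIV_subset)
    moreover have "(?f has_real_derivative m) (at x within {l..r})"
    proof (rule has_field_derivative_transform_within[of _ _ _ _ 1])
      show "((\<lambda>x. m * x + c) has_real_derivative m) (at x within {l..r})"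
        by (auto intro!: derivative_eq_intros)
      show "m * y + c = ?f y" if "y \<in> {l..r}" for y
        using p(2) p(5)[OF that] that by auto
    qed (use p in auto)
    moreover have "at x within {l..r} \<noteq> bot"
      using p(1,3) by (simp add: trivial_limit_within islimpt_Icc)
    ultimately have "D = m"
      unfolding has_real_derivative_iff_has_vector_derivative by (blast intro: vector_derivative_unique_within)
    then show "\<exists>k::int. (?f has_real_derivative 2 powi k) (at x within ?I)"
      using D p(4) by (auto simp: pow2_def)
  qed
qed

text \<open>The element \<open>\<gamma>\<close> is the inverse of the map \<open>\<beta>\<close>
  induced by the expander, so \<open>rho s \<gamma>\<close> composes functions with the expander and
  multiplies by a power of its slope. The slope is 2 close to 0 and 1 beyond
  \<open>a\<close>.\<close>

lemma expander_thompson_T: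
  assumes a: "a \<in> dyadic" "0 < a" "a \<le> 1"
  obtains \<gamma> d where "\<gamma> \<in> carrier thompson_T" "d \<in> borel_measurable borel"
    "pow2_density \<gamma> (\<lambda>z. d (circle_coord z))"
    "\<And>z. z \<in> circle \<Longrightarrow> inv_into circle \<gamma> z = circle_param (expander a (circle_coord z))"
    "\<And>z. z \<in> circle \<Longrightarrow> circle_coord (inv_into circle \<gamma> z) = expander a (circle_coord z)"
    "AE z in circle_measure. (circle_coord z < a / 4 \<longrightarrow> d (circle_coord z) = 2) \<and>
       (a < circle_coord z \<longrightarrow> d (circle_coord z) = 1)"
proof -
  let ?\<phi> = "restrict (expander a) {0..1}"
  note \<phi> = expander_thompson_F[OF a]
  define \<beta> where "\<beta> = restrict (\<lambda>z. circle_param (expander a (circle_coord z))) circle"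
  have co: "circle_coord (circle_param (expander a (circle_coord z))) = expander a (circle_coord z)" for z
  proof (rule circle_coord_param)
    show "0 \<le> expander a (circle_coord z)"
      using expander_ge[of "circle_coord z" a] circle_coord_bounds[of z] by linarith
    show "expander a (circle_coord z) < 1"
      using expander_strict_mono[OF circle_coord_bounds(2), of a z] expander_affine(4)[OF a(2), of 1] a by simp
  qed
  have con: "circle_coord (circle_param (contractor a (circle_coord z))) = contractor a (circle_coord z)" for z
    using circle_coord_bounds[of z] contractor_unit[OF a(2), of "circle_coord z"]
    by (intro circle_coord_param) (auto simp: contractor_def)
  have ce: "contractor a (expander a t) = t" if "0 \<le> t" for t
    using that a unfolding expander_def contractor_def by (simp add: max_def min_def field_simps)
  have Bij: "\<beta> \<in> Bij circle"
    unfolding Bij_def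
  proof (intro IntI CollectI)
    show "\<beta> \<in> extensional circle" by (simp add: \<beta>_def)
    show "bij_betw \<beta> circle circle"
      by (rule bij_betwI[where g = "\<lambda>z. circle_param (contractor a (circle_coord z))"])
        (auto simp: \<beta>_def co con ce expander_contractor[OF a(2)] circle_coord_bounds circle_param_coord)
  qed
  \<comment> \<open>The end point 1 is separate because its circle point has coordinate 0; the
    expander fixes both 0 and 1.\<close>
  have \<beta>: "\<beta> (circle_param t) = circle_param (?\<phi> t)" if t: "t \<in> {0..1}" for t
  proof (cases "t = 1")
    case True
    have "1 \<in> circle"
      using circle_param_in_circle[of 0] by simp
    with True show ?thesis
      using circle_coord_param[of 0] expander_affine(1)[OF a(2), of 0] expander_affine(4)[OF a(2), of 1] a
      by (simp add: \<beta>_def)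
  next
    case False
    then show ?thesis
      using t by (simp add: \<beta>_def circle_coord_param)
  qed
  have "\<beta> \<in> thompson_F_circle"
    unfolding thompson_F_circle_def using Bij \<phi> \<beta> by blast
  then have \<beta>T: "\<beta> \<in> carrier thompson_T"
    unfolding thompson_T_carrier by (intro generate.incl) auto
  define \<gamma> where "\<gamma> = restrict (inv_into circle \<beta>) circle"
  have \<gamma>B: "\<gamma> \<in> Bij circle"
    unfolding \<gamma>_def by (rule restrict_inv_into_Bij[OF Bij])
  have inv: "inv_into circle \<gamma> z = \<beta> z" if "z \<in> circle" for z
  proof (rule inv_into_f_eq)
    show "inj_on \<gamma> circle"
      using \<gamma>B by (simp add: Bij_def bij_betw_def)
  qed (use that Bij_circle_inv[OF Bij] in \<open>auto simp: \<gamma>_def\<close>)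
  obtain d S where d: "d \<in> borel_measurable borel" "\<And>t. d t \<in> pow2" "finite S"
    "\<And>t. t \<in> {0<..<1} - S \<Longrightarrow> (?\<phi> has_real_derivative d t) (at t)"
    using thompson_F_slope[OF \<phi>] by blast
  have "distr circle_measure circle_measure \<gamma> = distr circle_measure circle_measure (inv_into circle \<beta>)"
    by (rule distr_cong) (auto simp: \<gamma>_def)
  then have dens: "pow2_density \<gamma> (\<lambda>z. d (circle_coord z))"
    using thompson_F_density[OF \<phi> Bij \<beta> d] by (simp add: pow2_density_def)
  \<comment> \<open>Since \<open>d\<close> is known only through an existence statement, its values
    are recovered from uniqueness of derivatives, off the finite set \<open>S\<close>.\<close>
  have d': "d t = m" if "t \<in> {0<..<1} - S" "(expander a has_real_derivative m) (at t)" for t m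
  proof -
    have "(expander a has_real_derivative d t) (at t)"
      by (rule has_field_derivative_transform_within_open[OF d(4)[OF that(1)], of "{0<..<1}"]) (use that in auto)
    then show ?thesis
      using that(2) by (rule DERIV_unique)
  qed
  have "AE z in circle_measure. \<forall>s\<in>insert 0 S. circle_coord z \<noteq> s"
    using d(3) AE_circle_coord_neq by (intro AE_finite_allI) auto
  then have "AE z in circle_measure. (circle_coord z < a / 4 \<longrightarrow> d (circle_coord z) = 2) \<and>
       (a < circle_coord z \<longrightarrow> d (circle_coord z) = 1)"
  proof eventually_elim
    case (elim z)
    then have "circle_coord z \<in> {0<..<1} - S"
      using circle_coord_bounds[of z] by (auto simp: less_le)
    then show ?case
      using d' expander_deriv(1,4)[OF a(2), of "circle_coord z"] by auto
  qed
  moreover have "\<gamma> \<in> carrier thompson_T"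
    using thompson_T_inverse[OF \<beta>T] by (simp only: \<gamma>_def)
  moreover have "inv_into circle \<gamma> z = circle_param (expander a (circle_coord z))" if "z \<in> circle" for z
    using that inv by (simp add: \<beta>_def)
  ultimately show thesis
    using that[of \<gamma> d] d(1) dens co by auto
qed

section \<open>Representatives of square-integrable classes\<close>

lemma square_integrable_rep [simp]: "square_integrable (rep_circle_L2 x)"
  using Quotient_rep_reflp[OF Quotient_circle_L2, of x] by blast

lemma abs_rep_circle_L2 [simp]: "abs_circle_L2 (rep_circle_L2 x) = x"
  by (rule Quotient_abs_rep[OF Quotient_circle_L2])

lemma rep_abs_circle_L2: "square_integrable f \<Longrightarrow> AE z in circle_measure. rep_circle_L2 (abs_circle_L2 f) z = f z"
  using Quotient_rep_abs[OF Quotient_circle_L2, of f] by simp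

lemma square_integrable_measurable:
  "square_integrable f \<Longrightarrow> f \<in> borel_measurable circle_measure"
  by (simp add: square_integrable_def)

lemma rep_measurable [measurable]: "rep_circle_L2 x \<in> borel_measurable circle_measure"
  by (rule square_integrable_measurable[OF square_integrable_rep])

lemma square_integrable_cong_AE:
  assumes "square_integrable f" "g \<in> borel_measurable circle_measure" "AE z in circle_measure. f z = g z"
  shows "square_integrable g"
proof -
  have [measurable]: "f \<in> borel_measurable circle_measure" "g \<in> borel_measurable circle_measure"
    using assms by (auto intro: square_integrable_measurable)
  have "AE z in circle_measure. (norm (f z))\<^sup>2 = (norm (g z))\<^sup>2"
    using assms(3) by eventually_elim simp
  then have "integrable circle_measure (\<lambda>z. (norm (f z))\<^sup>2) \<longleftrightarrow> integrable circle_measure (\<lambda>z. (norm (g z))\<^sup>2)"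
    using assms(1,2) by (intro integrable_cong_AE) auto
  then show ?thesis
    using assms by (simp add: square_integrable_def)
qed

lemma abs_circle_L2_eq_iff:
  assumes "square_integrable f" "square_integrable g"
  shows "abs_circle_L2 f = abs_circle_L2 g \<longleftrightarrow> (AE z in circle_measure. f z = g z)"
  using Quotient_rel[OF Quotient_circle_L2, of f g] assms by simp

lemma abs_circle_L2_eqI:
  assumes "square_integrable f" "g \<in> borel_measurable circle_measure" "AE z in circle_measure. f z = g z"
  shows "abs_circle_L2 f = abs_circle_L2 g"
  using assms abs_circle_L2_eq_iff[OF assms(1) square_integrable_cong_AE[OF assms]] by simp

lemma circle_L2_eqI:
  assumes "AE z in circle_measure. rep_circle_L2 x z = rep_circle_L2 y z"
  shows "x = y"
  using abs_circle_L2_eqI[OF square_integrable_rep _ assms] by simp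

lemma circle_L2_cases:
  obtains f where "x = abs_circle_L2 f" "square_integrable f"
  using abs_rep_circle_L2[of x] square_integrable_rep[of x] by metis

lemma plus_abs_circle_L2:
  "square_integrable f \<Longrightarrow> square_integrable g \<Longrightarrow>
    abs_circle_L2 f + abs_circle_L2 g = abs_circle_L2 (\<lambda>z. f z + g z)"
  by (rule plus_circle_L2.abs_eq) auto

lemma scaleC_abs_circle_L2:
  "square_integrable f \<Longrightarrow> c *\<^sub>C abs_circle_L2 f = abs_circle_L2 (\<lambda>z. c * f z)"
  by (rule scaleC_circle_L2.abs_eq) auto

lemma cinner_abs_circle_L2:
  "square_integrable f \<Longrightarrow> square_integrable g \<Longrightarrow>
    cinner (abs_circle_L2 f) (abs_circle_L2 g) = (\<integral>z. f z * cnj (g z) \<partial>circle_measure)"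
  by (rule cinner_circle_L2.abs_eq) auto

lemma zero_circle_L2_abs: "0 = abs_circle_L2 (\<lambda>_. 0)"
  by (simp add: zero_circle_L2.abs_eq)

lemma square_integrable_const [simp]: "square_integrable (\<lambda>_. c)"
  by (simp add: square_integrable_def)

section \<open>Transformations acting on functions\<close>

text \<open>The real part 1/2 makes the squared modulus equal to \<open>d\<close>, which is what
  unitarity needs; s enters only through the phase.\<close>

definition weight :: "real \<Rightarrow> real \<Rightarrow> complex" where
  "weight s d = complex_of_real d powr (1 / 2 + \<i> * s)"

lemma weight_1 [simp]: "weight s 1 = 1"
  by (simp add: weight_def)

lemma weight_mult: "0 < c \<Longrightarrow> 0 < d \<Longrightarrow> weight s (c * d) = weight s c * weight s d"
  unfolding weight_def by (simp add: powr_times_real)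

lemma weight_norm: "0 < d \<Longrightarrow> weight s d * cnj (weight s d) = complex_of_real d"
proof -
  assume d: "0 < d"
  have "norm (weight s d) = d powr (1 / 2)"
    using d unfolding weight_def by (subst norm_powr_real_powr) auto
  then have "(norm (weight s d))\<^sup>2 = d"
    using d by (simp add: powr_half_sqrt)
  then show ?thesis
    by (simp add: complex_norm_square[symmetric])
qed

lemma weight_measurable [measurable]: "weight s \<in> borel_measurable borel"
proof -
  have "weight s = (\<lambda>d. if d = 0 then 0 else
      exp ((1 / 2 + \<i> * s) * (complex_of_real (ln \<bar>d\<bar>) + (if d < 0 then pi * \<i> else 0))))"
    by (auto simp: weight_def powr_def fun_eq_iff Ln_of_real')
  also have "\<dots> \<in> borel_measurable borel"
    by measurable
  finally show ?thesis .
qed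

context
  fixes \<gamma> :: "complex \<Rightarrow> complex" and d :: "complex \<Rightarrow> real"
  assumes \<gamma>: "\<gamma> \<in> circle_auts" and d: "pow2_density \<gamma> d"
begin

lemma density_pos: "0 < d z"
  using d by (auto simp: pow2_density_def pow2_pos)

lemma density_measurable: "d \<in> borel_measurable circle_measure"
  using d by (simp add: pow2_density_def)

text \<open>Quasi-invariance: the pushforward under the inverse has a density, hence null sets pull
  back to null sets.\<close>

lemma AE_inv_into:
  assumes "AE z in circle_measure. P z"
  shows "AE z in circle_measure. P (inv_into circle \<gamma> z)"
proof -
  note m = circle_autsD[OF \<gamma>]
  obtain e where e: "pow2_density (inv_into circle \<gamma>) e"
    using pow2_density_inverse[OF m d] by blast
  have "AE z in density circle_measure (\<lambda>z. ennreal (e z)). P z"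
    using assms e by (subst AE_density) (auto simp: pow2_density_def elim: eventually_mono)
  moreover have "distr circle_measure circle_measure (inv_into circle \<gamma>) = density circle_measure (\<lambda>z. ennreal (e z))"
    using e by (simp add: pow2_density_def)
  ultimately have "AE z in distr circle_measure circle_measure (inv_into circle \<gamma>). P z"
    by (simp only:)
  then show ?thesis
    using m(3) by (rule AE_distrD[rotated])
qed

text \<open>Change of variables: multiplying by \<open>d\<close> turns the measure into the
  pushforward under \<open>\<gamma>\<close>, where composition with the inverse cancels.\<close>

lemma
  fixes g :: "complex \<Rightarrow> complex"
  assumes [measurable]: "g \<in> borel_measurable circle_measure"
  shows integral_transform: "(\<integral>z. complex_of_real (d z) * g (inv_into circle \<gamma> z) \<partial>circle_measure) = (\<integral>z. g z \<partial>circle_measure)"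
    and integrable_transform: "integrable circle_measure (\<lambda>z. complex_of_real (d z) * g (inv_into circle \<gamma> z)) \<longleftrightarrow> integrable circle_measure g"
proof -
  note m [measurable] = circle_autsD(2,3)[OF \<gamma>] and [measurable] = density_measurable
  have D: "distr circle_measure circle_measure \<gamma> = density circle_measure (\<lambda>z. ennreal (d z))"
    using d by (simp add: pow2_density_def)
  have cong: "g (inv_into circle \<gamma> (\<gamma> z)) = g z" if "z \<in> circle" for z
    using Bij_circle_inv(4)[OF circle_autsD(1)[OF \<gamma>] that] by simp
  have "(\<integral>z. complex_of_real (d z) * g (inv_into circle \<gamma> z) \<partial>circle_measure) =
     (\<integral>z. g (inv_into circle \<gamma> z) \<partial>density circle_measure (\<lambda>z. ennreal (d z)))"
    using density_pos by (subst integral_density) (auto simp: scaleR_conv_of_real less_imp_le)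
  also have "\<dots> = (\<integral>z. g (inv_into circle \<gamma> (\<gamma> z)) \<partial>circle_measure)"
    unfolding D[symmetric] by (rule integral_distr) measurable
  also have "\<dots> = (\<integral>z. g z \<partial>circle_measure)"
    by (rule Bochner_Integration.integral_cong) (auto simp: cong)
  finally show "(\<integral>z. complex_of_real (d z) * g (inv_into circle \<gamma> z) \<partial>circle_measure) = (\<integral>z. g z \<partial>circle_measure)" .
  have "integrable circle_measure (\<lambda>z. complex_of_real (d z) * g (inv_into circle \<gamma> z)) \<longleftrightarrow>
     integrable (density circle_measure (\<lambda>z. ennreal (d z))) (\<lambda>z. g (inv_into circle \<gamma> z))"
    using density_pos by (subst integrable_density) (auto simp: scaleR_conv_of_real less_imp_le)
  also have "\<dots> \<longleftrightarrow> integrable circle_measure (\<lambda>z. g (inv_into circle \<gamma> (\<gamma> z)))"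
    unfolding D[symmetric] by (rule integrable_distr_eq) measurable
  also have "\<dots> \<longleftrightarrow> integrable circle_measure g"
    by (rule Bochner_Integration.integrable_cong) (auto simp: cong)
  finally show "integrable circle_measure (\<lambda>z. complex_of_real (d z) * g (inv_into circle \<gamma> z)) \<longleftrightarrow> integrable circle_measure g" .
qed

lemma square_integrable_transform:
  assumes f: "square_integrable f"
  shows "square_integrable (\<lambda>z. weight s (d z) * f (inv_into circle \<gamma> z))"
  unfolding square_integrable_def
proof
  note [measurable] = circle_autsD(2,3)[OF \<gamma>] density_measurable square_integrable_measurable[OF f]
  show "(\<lambda>z. weight s (d z) * f (inv_into circle \<gamma> z)) \<in> borel_measurable circle_measure"
    by measurable
  have "integrable circle_measure (\<lambda>z. f z * cnj (f z))"
    using f by (rule integrable_mult_cnj[OF f])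
  then have "integrable circle_measure (\<lambda>z. complex_of_real (d z) * (f (inv_into circle \<gamma> z) * cnj (f (inv_into circle \<gamma> z))))"
    by (subst integrable_transform) auto
  also have "(\<lambda>z. complex_of_real (d z) * (f (inv_into circle \<gamma> z) * cnj (f (inv_into circle \<gamma> z)))) =
    (\<lambda>z. complex_of_real ((norm (weight s (d z) * f (inv_into circle \<gamma> z)))\<^sup>2))"
    by (auto simp: complex_norm_square weight_norm[OF density_pos, symmetric] simp del: of_real_power)
  finally show "integrable circle_measure (\<lambda>z. (norm (weight s (d z) * f (inv_into circle \<gamma> z)))\<^sup>2)"
    by (simp only: complex_of_real_integrable_eq)
qed

text \<open>Frees \<open>rho\<close> from the two arbitrary choices in its definition: any
  square-integrable representative and any density \<open>d\<close> may be used from here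
  on.\<close>

lemma rho_abs:
  assumes f: "square_integrable f"
  shows "rho s \<gamma> (abs_circle_L2 f) = abs_circle_L2 (\<lambda>z. weight s (d z) * f (inv_into circle \<gamma> z))"
proof -
  note [measurable] = circle_autsD(2,3)[OF \<gamma>] density_measurable square_integrable_measurable[OF f]
  have "AE z in circle_measure. ennreal (d z) = RN_deriv circle_measure (distr circle_measure circle_measure \<gamma>) z"
    using d by (intro circle_measure.RN_deriv_unique) (auto simp: pow2_density_def)
  moreover have "AE z in circle_measure. rep_circle_L2 (abs_circle_L2 f) (inv_into circle \<gamma> z) = f (inv_into circle \<gamma> z)"
    by (intro AE_inv_into rep_abs_circle_L2 f)
  ultimately have "AE z in circle_measure. weight s (d z) * f (inv_into circle \<gamma> z) =
     weight s (enn2real (RN_deriv circle_measure (distr circle_measure circle_measure \<gamma>) z)) *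
     rep_circle_L2 (abs_circle_L2 f) (inv_into circle \<gamma> z)"
  proof eventually_elim
    case (elim z)
    have "d z = enn2real (ennreal (d z))"
      using density_pos[of z] by simp
    then have "d z = enn2real (RN_deriv circle_measure (distr circle_measure circle_measure \<gamma>) z)"
      by (simp only: elim(1))
    then show ?case
      by (simp only: elim(2))
  qed
  moreover have "(\<lambda>z. rep_circle_L2 (abs_circle_L2 f) (inv_into circle \<gamma> z)) \<in> borel_measurable circle_measure"
    by (rule measurable_compose[OF circle_autsD(3)[OF \<gamma>] rep_measurable])
  then have "(\<lambda>z. weight s (enn2real (RN_deriv circle_measure (distr circle_measure circle_measure \<gamma>) z)) *
     rep_circle_L2 (abs_circle_L2 f) (inv_into circle \<gamma> z)) \<in> borel_measurable circle_measure"
    by measurable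
  ultimately show ?thesis
    unfolding rho_def weight_def[of s "enn2real _", symmetric]
    by (intro abs_circle_L2_eqI[symmetric] square_integrable_transform f)
qed

lemma rho_cinner: "cinner (rho s \<gamma> x) (rho s \<gamma> y) = cinner x y"
proof -
  obtain f g where f: "x = abs_circle_L2 f" "square_integrable f" and g: "y = abs_circle_L2 g" "square_integrable g"
    by (metis circle_L2_cases)
  have "cinner (rho s \<gamma> x) (rho s \<gamma> y) =
     (\<integral>z. weight s (d z) * f (inv_into circle \<gamma> z) * cnj (weight s (d z) * g (inv_into circle \<gamma> z)) \<partial>circle_measure)"
    by (simp only: f(1) g(1) rho_abs[OF f(2)] rho_abs[OF g(2)]
        cinner_abs_circle_L2[OF square_integrable_transform[OF f(2)] square_integrable_transform[OF g(2)]])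
  also have "\<dots> = (\<integral>z. complex_of_real (d z) * (f (inv_into circle \<gamma> z) * cnj (g (inv_into circle \<gamma> z))) \<partial>circle_measure)"
    by (rule Bochner_Integration.integral_cong) (simp_all add: weight_norm[OF density_pos, symmetric, of _ s] mult_ac)
  also have "\<dots> = (\<integral>z. f z * cnj (g z) \<partial>circle_measure)"
    using f(2)[THEN square_integrable_measurable] g(2)[THEN square_integrable_measurable]
    by (intro integral_transform borel_measurable_times measurable_compose[OF _ borel_measurable_cnj])
  also have "\<dots> = cinner x y"
    using f g by (simp add: cinner_abs_circle_L2)
  finally show ?thesis .
qed

lemma rho_add: "rho s \<gamma> (x + y) = rho s \<gamma> x + rho s \<gamma> y"
proof -
  obtain f g where f: "x = abs_circle_L2 f" "square_integrable f" and g: "y = abs_circle_L2 g" "square_integrable g"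
    by (metis circle_L2_cases)
  show ?thesis
    by (simp add: f(1) g(1) plus_abs_circle_L2[OF f(2) g(2)] rho_abs square_integrable_add f(2) g(2)
        plus_abs_circle_L2 square_integrable_transform distrib_left)
qed

lemma rho_scaleC: "rho s \<gamma> (c *\<^sub>C x) = c *\<^sub>C rho s \<gamma> x"
proof -
  obtain f where f: "x = abs_circle_L2 f" "square_integrable f"
    by (metis circle_L2_cases)
  show ?thesis
    by (simp add: f(1) scaleC_abs_circle_L2[OF f(2)] rho_abs square_integrable_scale f(2)
        scaleC_abs_circle_L2 square_integrable_transform mult.left_commute)
qed

end

text \<open>The chain rule for densities combined with multiplicativity of \<open>weight\<close> on
  positive numbers.\<close>

lemma rho_compose:
  assumes \<gamma>: "\<gamma> \<in> circle_auts" and \<delta>: "\<delta> \<in> circle_auts"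
  shows "rho s (compose circle \<gamma> \<delta>) x = rho s \<gamma> (rho s \<delta> x)"
proof -
  obtain c d where c: "pow2_density \<gamma> c" and d: "pow2_density \<delta> d"
    using \<gamma> \<delta> by (auto simp: circle_auts_def)
  obtain f where f: "x = abs_circle_L2 f" "square_integrable f"
    by (metis circle_L2_cases)
  have "compose circle \<gamma> \<delta> = \<gamma> \<otimes>\<^bsub>BijGroup circle\<^esub> \<delta>"
    using \<gamma> \<delta> by (simp add: BijGroup_def circle_autsD)
  then have co: "compose circle \<gamma> \<delta> \<in> circle_auts"
    using subgroup.m_closed[OF subgroup_circle_auts \<gamma> \<delta>] by simp
  have cd: "pow2_density (compose circle \<gamma> \<delta>) (\<lambda>z. c z * d (inv_into circle \<gamma> z))"
    by (rule pow2_density_compose[OF \<gamma> c \<delta> d])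
  note sq = square_integrable_transform[OF \<delta> d f(2)]
  have "rho s \<gamma> (rho s \<delta> x) = abs_circle_L2 (\<lambda>z. weight s (c z) *
      (weight s (d (inv_into circle \<gamma> z)) * f (inv_into circle \<delta> (inv_into circle \<gamma> z))))"
    by (simp only: f(1) rho_abs[OF \<delta> d f(2)] rho_abs[OF \<gamma> c sq])
  also have "\<dots> = abs_circle_L2 (\<lambda>z. weight s (c z * d (inv_into circle \<gamma> z)) * f (inv_into circle (compose circle \<gamma> \<delta>) z))"
  proof (rule abs_circle_L2_eqI[OF square_integrable_transform[OF \<gamma> c sq]])
    show "(\<lambda>z. weight s (c z * d (inv_into circle \<gamma> z)) * f (inv_into circle (compose circle \<gamma> \<delta>) z)) \<in> borel_measurable circle_measure"
      using square_integrable_transform[OF co cd f(2), of s] by (rule square_integrable_measurable)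
    show "AE z in circle_measure. weight s (c z) *
      (weight s (d (inv_into circle \<gamma> z)) * f (inv_into circle \<delta> (inv_into circle \<gamma> z))) =
      weight s (c z * d (inv_into circle \<gamma> z)) * f (inv_into circle (compose circle \<gamma> \<delta>) z)"
      using AE_space
      by eventually_elim
        (simp add: weight_mult density_pos[OF \<gamma> c] density_pos[OF \<delta> d] inv_into_compose_circle circle_autsD(1)[OF \<gamma>] circle_autsD(1)[OF \<delta>])
  qed
  also have "\<dots> = rho s (compose circle \<gamma> \<delta>) x"
    by (simp only: f(1) rho_abs[OF co cd f(2)])
  finally show ?thesis ..
qed

lemma rho_identity:
  assumes "\<gamma> \<in> circle_auts" "pow2_density \<gamma> (\<lambda>_. 1)" "\<And>z. z \<in> circle \<Longrightarrow> inv_into circle \<gamma> z = z"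
  shows "rho s \<gamma> x = x"
proof -
  obtain f where f: "x = abs_circle_L2 f" "square_integrable f"
    by (metis circle_L2_cases)
  have "abs_circle_L2 f = abs_circle_L2 (\<lambda>z. weight s 1 * f (inv_into circle \<gamma> z))"
  proof (rule abs_circle_L2_eqI[OF f(2)])
    show "(\<lambda>z. weight s 1 * f (inv_into circle \<gamma> z)) \<in> borel_measurable circle_measure"
      using square_integrable_transform[OF assms(1,2) f(2), of s] by (rule square_integrable_measurable)
    show "AE z in circle_measure. f z = weight s 1 * f (inv_into circle \<gamma> z)"
      using AE_space by eventually_elim (simp add: assms(3))
  qed
  then show ?thesis
    unfolding f(1) rho_abs[OF assms(1,2) f(2)] by (rule sym)
qed

lemma unitary_map_rho:
  assumes \<gamma>: "\<gamma> \<in> circle_auts"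
  shows "unitary_map (rho s \<gamma>)"
proof -
  obtain d where d: "pow2_density \<gamma> d"
    using \<gamma> by (auto simp: circle_auts_def)
  let ?\<delta> = "restrict (inv_into circle \<gamma>) circle"
  have \<delta>: "?\<delta> \<in> circle_auts"
    by (rule circle_auts_inverse[OF \<gamma>])
  have "rho s \<gamma> (rho s ?\<delta> x) = x" for x
  proof -
    \<comment> \<open>The identity is presented as the rotation by 0, whose density 1 is already
      known.\<close>
    have "compose circle \<gamma> ?\<delta> = restrict (\<lambda>z. circle_param 0 * z) circle"
      using Bij_circle_inv[OF circle_autsD(1)[OF \<gamma>]] by (auto simp: compose_def)
    then have "rho s \<gamma> (rho s ?\<delta> x) = rho s (restrict (\<lambda>z. circle_param 0 * z) circle) x"
      using rho_compose[OF \<gamma> \<delta>] by simp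
    also have "\<dots> = x"
      using rotation_inv[of _ 0] by (intro rho_identity rotation_circle_auts rotation_density) auto
    finally show ?thesis .
  qed
  then have "surj (rho s \<gamma>)"
    by (metis surjI)
  then show ?thesis
    unfolding unitary_map_def Vector_Spaces.linear_iff
    using rho_add[OF \<gamma> d] rho_scaleC[OF \<gamma> d] rho_cinner[OF \<gamma> d] complex_vector.vector_space_axioms by auto
qed

lemma unitary_rep_rho: "unitary_rep thompson_T (rho s)"
  unfolding unitary_rep_def
  using group_thompson_T unitary_map_rho thompson_T_subset
  by (auto simp: thompson_T_mult rho_compose subset_iff fun_eq_iff)

section \<open>Completeness and orthogonal projection\<close>

text \<open>The nearest-point argument. Completeness is asked of \<open>V\<close> alone, in
  sequential form, since the ambient type class does not contain it.\<close>

lemma orthogonal_projection_exists: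
  fixes V :: "'a::real_inner set"
  assumes V: "\<And>f. (\<And>n. f n \<in> V) \<Longrightarrow> Cauchy f \<Longrightarrow> \<exists>l\<in>V. f \<longlonglongrightarrow> l" "subspace V"
  obtains v where "v \<in> V" "\<And>u. u \<in> V \<Longrightarrow> inner (h - v) u = 0"
proof -
  define d where "d = infdist h V"
  have ne: "V \<noteq> {}"
    using subspace_0[OF V(2)] by auto
  have dle: "d \<le> norm (h - v)" if "v \<in> V" for v
    using infdist_le[OF that, of h] by (simp add: d_def dist_norm)
  have square_add: "(d + x)\<^sup>2 = d\<^sup>2 + (2 * d) * x + x * x" for x :: real
    by (simp add: power2_eq_square algebra_simps)
  have d0: "0 \<le> d"
    by (simp add: d_def infdist_nonneg)
  have "\<exists>v\<in>V. norm (h - v) < d + 1 / Suc n" for n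
  proof (rule ccontr)
    assume "\<not> ?thesis"
    then have "d + 1 / Suc n \<le> dist h v" if "v \<in> V" for v
      using that by (force simp: dist_norm)
    then have "d + 1 / Suc n \<le> infdist h V"
      unfolding infdist_notempty[OF ne] by (intro cINF_greatest ne)
    then show False
      by (simp add: d_def)
  qed
  then obtain v where v: "\<And>n. v n \<in> V" "\<And>n. norm (h - v n) < d + 1 / Suc n"
    by metis
  \<comment> \<open>The midpoint of \<open>v n\<close> and \<open>v m\<close> lies in
    \<open>V\<close>, so \<open>a + b\<close> has norm at least 2d and the parallelogram law
    controls \<open>a - b\<close>. Each squared norm exceeds d^2 by at most (2d + 1)/(N + 1); the
    law counts four of them.\<close>
  have close: "(norm (v n - v m))\<^sup>2 \<le> (8 * d + 4) / Suc N" if "N \<le> n" "N \<le> m" for n m N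
  proof -
    define a where "a = h - v n"
    define b where "b = h - v m"
    have "h - (1 / 2) *\<^sub>R (v n + v m) = (1 / 2) *\<^sub>R (a + b)"
      by (simp add: a_def b_def algebra_simps) (simp add: scaleR_left_distrib[symmetric])
    moreover have "(1 / 2) *\<^sub>R (v n + v m) \<in> V"
      using v V(2) by (intro subspace_scale subspace_add)
    ultimately have "d \<le> norm (a + b) / 2"
      using dle[of "(1 / 2) *\<^sub>R (v n + v m)"] by simp
    then have "(2 * d)\<^sup>2 \<le> (norm (a + b))\<^sup>2"
      using d0 by (intro power_mono) auto
    moreover have "(norm (a - b))\<^sup>2 + (norm (a + b))\<^sup>2 = 2 * (norm a)\<^sup>2 + 2 * (norm b)\<^sup>2"
      by (simp add: power2_norm_eq_inner inner_add inner_diff)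
    moreover have "(norm a)\<^sup>2 \<le> d\<^sup>2 + (2 * d + 1) / Suc N" "(norm b)\<^sup>2 \<le> d\<^sup>2 + (2 * d + 1) / Suc N"
    proof -
      have *: "(norm (h - v k))\<^sup>2 \<le> d\<^sup>2 + (2 * d + 1) / Suc N" if "N \<le> k" for k
      proof -
        have le: "1 / real (Suc k) \<le> 1 / real (Suc N)" "1 / real (Suc N) \<le> 1"
          using that by (auto simp: field_simps)
        then have "norm (h - v k) \<le> d + 1 / Suc N"
          using v(2)[of k] by linarith
        then have "(norm (h - v k))\<^sup>2 \<le> (d + 1 / Suc N)\<^sup>2"
          by (intro power_mono) auto
        also have "\<dots> = d\<^sup>2 + (2 * d) * (1 / Suc N) + (1 / Suc N) * (1 / Suc N)"
          by (rule square_add)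
        also have "\<dots> \<le> d\<^sup>2 + (2 * d) * (1 / Suc N) + 1 * (1 / Suc N)"
          using le by (intro add_left_mono mult_right_mono) auto
        finally show ?thesis
          by (simp add: add_divide_distrib)
      qed
      show "(norm a)\<^sup>2 \<le> d\<^sup>2 + (2 * d + 1) / Suc N" "(norm b)\<^sup>2 \<le> d\<^sup>2 + (2 * d + 1) / Suc N"
        using * that by (auto simp: a_def b_def)
    qed
    moreover have "(8 * d + 4) / Suc N = 4 * ((2 * d + 1) / Suc N)"
      by simp
    moreover have "(norm (v n - v m))\<^sup>2 = (norm (a - b))\<^sup>2"
      by (simp add: a_def b_def norm_minus_commute)
    moreover have "(2 * d)\<^sup>2 = 4 * d\<^sup>2"
      by (simp add: power_mult_distrib)
    ultimately show ?thesis
      by linarith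
  qed
  have "Cauchy v"
    unfolding Cauchy_def
  proof (intro allI impI)
    fix e :: real assume e: "0 < e"
    obtain N where N: "(8 * d + 4) / e\<^sup>2 < real N"
      using reals_Archimedean2 by blast
    then have "(8 * d + 4) / Suc N < e\<^sup>2"
    proof -
      have "8 * d + 4 < real N * e\<^sup>2"
        using N e by (simp add: field_simps)
      also have "\<dots> \<le> real (Suc N) * e\<^sup>2"
        by (intro mult_right_mono) auto
      finally show ?thesis
        by (simp add: field_simps)
    qed
    then have "(norm (v m - v n))\<^sup>2 < e\<^sup>2" if "N \<le> m" "N \<le> n" for m n
      using close[OF that] by linarith
    then show "\<exists>M. \<forall>m\<ge>M. \<forall>n\<ge>M. dist (v m) (v n) < e"
      using e by (intro exI[of _ N]) (auto simp: dist_norm intro!: power_less_imp_less_base[of _ 2 e])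
  qed
  then obtain p where p: "p \<in> V" "v \<longlonglongrightarrow> p"
    using V(1)[of v] v(1) by blast
  have "norm (h - p) \<le> d + 0"
  proof (rule LIMSEQ_le)
    show "(\<lambda>n. norm (h - v n)) \<longlonglongrightarrow> norm (h - p)"
      using p(2) by (intro tendsto_intros)
    show "(\<lambda>n. d + 1 / Suc n) \<longlonglongrightarrow> d + 0"
      by (intro tendsto_add tendsto_const LIMSEQ_Suc[OF lim_1_over_n])
  qed (use v(2) in \<open>auto intro: less_imp_le\<close>)
  then have dp: "norm (h - p) \<le> d"
    by simp
  have "inner (h - p) u = 0" if u: "u \<in> V" for u
  proof (rule ccontr)
    define a where "a = inner (h - p) u"
    assume "inner (h - p) u \<noteq> 0"
    then have a: "a \<noteq> 0" by (simp add: a_def)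
    \<comment> \<open>Moving from \<open>p\<close> along \<open>u\<close> by this amount would bring
      it closer to \<open>h\<close>. The optimal step has denominator
      \<open>(norm u)\<^sup>2\<close>; the added 1 keeps it positive without changing the
      conclusion.\<close>
    define t where "t = a / (1 + (norm u)\<^sup>2)"
    have pos: "0 < 1 + (norm u)\<^sup>2"
      by (simp add: add_pos_nonneg)
    have "p + t *\<^sub>R u \<in> V"
      using p u V(2) by (intro subspace_add subspace_scale)
    then have "norm (h - p) \<le> norm (h - (p + t *\<^sub>R u))"
      using dle dp by fastforce
    then have "(norm (h - p))\<^sup>2 \<le> (norm ((h - p) - t *\<^sub>R u))\<^sup>2"
      by (intro power_mono) (auto simp: algebra_simps)
    also have "\<dots> = (norm (h - p))\<^sup>2 - 2 * t * a + t\<^sup>2 * (norm u)\<^sup>2"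
      unfolding power2_norm_eq_inner a_def
      by (simp add: inner_diff_left inner_diff_right inner_commute algebra_simps power2_eq_square)
    finally have "2 * t * a \<le> t\<^sup>2 * (norm u)\<^sup>2"
      by simp
    also have "\<dots> \<le> t\<^sup>2 * (1 + (norm u)\<^sup>2)"
      by (intro mult_left_mono) auto
    also have "\<dots> = t * a"
      using pos by (simp add: t_def power2_eq_square)
    finally have "t * a \<le> 0"
      by (simp add: mult.commute)
    moreover have "t * a = a\<^sup>2 / (1 + (norm u)\<^sup>2)"
      by (simp add: t_def power2_eq_square)
    then have "0 < t * a"
      using a pos by simp
    ultimately show False by simp
  qed
  then show thesis
    using that p(1) by blast
qed

section \<open>Completeness of the Hilbert space\<close>

lemma norm_circle_L2_sq:
  assumes "square_integrable f"
  shows "(norm (abs_circle_L2 f))\<^sup>2 = (\<integral>z. (norm (f z))\<^sup>2 \<partial>circle_measure)"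
proof -
  have "(norm (abs_circle_L2 f))\<^sup>2 = Re (\<integral>z. f z * cnj (f z) \<partial>circle_measure)"
    using assms by (simp add: power2_norm_eq_inner inner_eq_Re_cinner cinner_abs_circle_L2)
  also have "(\<integral>z. f z * cnj (f z) \<partial>circle_measure) = complex_of_real (\<integral>z. (norm (f z))\<^sup>2 \<partial>circle_measure)"
    by (subst integral_complex_of_real[symmetric]) (simp only: complex_norm_square)
  finally show ?thesis
    by simp
qed

lemma minus_abs_circle_L2:
  assumes "square_integrable f" "square_integrable g"
  shows "abs_circle_L2 f - abs_circle_L2 g = abs_circle_L2 (\<lambda>z. f z - g z)"
proof -
  have "abs_circle_L2 f - abs_circle_L2 g = abs_circle_L2 f + abs_circle_L2 (\<lambda>z. - 1 * g z)"
    by (simp only: minus_circle_L2_def uminus_circle_L2_def scaleC_abs_circle_L2[OF assms(2)])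
  also have "\<dots> = abs_circle_L2 (\<lambda>z. f z + - 1 * g z)"
    by (rule plus_abs_circle_L2[OF assms(1) square_integrable_scale[OF assms(2)]])
  finally show ?thesis
    by simp
qed

lemma square_integrable_diff:
  "square_integrable f \<Longrightarrow> square_integrable g \<Longrightarrow> square_integrable (\<lambda>z. f z - g z)"
  using square_integrable_add[of f "\<lambda>z. - 1 * g z"] square_integrable_scale[of g "- 1"] by simp

text \<open>The circle measure is a probability measure, so this is nonnegativity of the variance of
  \<open>norm (f z)\<close>.\<close>

lemma integral_norm_le_circle_L2:
  assumes f: "square_integrable f"
  shows "integrable circle_measure (\<lambda>z. norm (f z))"
    "(\<integral>z. norm (f z) \<partial>circle_measure) \<le> norm (abs_circle_L2 f)"
proof -
  have sq: "integrable circle_measure (\<lambda>z. (norm (f z))\<^sup>2)" and [measurable]: "f \<in> borel_measurable circle_measure"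
    using f by (auto simp: square_integrable_def)
  show int: "integrable circle_measure (\<lambda>z. norm (f z))"
    by (rule circle_measure.square_integrable_imp_integrable[OF _ sq]) measurable
  have "0 \<le> circle_measure.variance (\<lambda>z. norm (f z))"
    by (rule circle_measure.variance_positive)
  then have "(\<integral>z. norm (f z) \<partial>circle_measure)\<^sup>2 \<le> (norm (abs_circle_L2 f))\<^sup>2"
    using circle_measure.variance_eq[OF int sq] by (simp add: norm_circle_L2_sq f)
  then show "(\<integral>z. norm (f z) \<partial>circle_measure) \<le> norm (abs_circle_L2 f)"
    by (rule power2_le_imp_le) simp
qed

text \<open>Riesz-Fischer: a rapidly Cauchy subsequence has summable increments almost everywhere,
  and Fatou's lemma upgrades pointwise convergence to convergence in norm.\<close>

lemma circle_L2_Cauchy_convergent: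
  fixes X :: "nat \<Rightarrow> circle_L2"
  assumes X: "Cauchy X"
  shows "\<exists>x. X \<longlonglongrightarrow> x"
proof -
  have "\<exists>N. \<forall>m\<ge>N. \<forall>n\<ge>N. dist (X m) (X n) < (1 / 2) ^ k" for k
    using X by (simp add: Cauchy_def)
  then obtain N where N: "\<And>k m n. N k \<le> m \<Longrightarrow> N k \<le> n \<Longrightarrow> dist (X m) (X n) < (1 / 2) ^ k"
    by metis
  \<comment> \<open>The summand \<open>k\<close> makes \<open>r\<close> strictly increasing; the sum
    dominates every \<open>N i\<close> with \<open>i \<le> k\<close>, as \<open>N\<close> need not
    be monotone.\<close>
  define r where "r k = k + (\<Sum>i\<le>k. N i)" for k
  have r: "strict_mono r"
    by (rule strict_mono_Suc_iff[THEN iffD2]) (simp add: r_def)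
  have rN: "N k \<le> r m" if "k \<le> m" for k m
    using member_le_sum[of k "{..m}" N] that by (simp add: r_def)
  define u where "u k = rep_circle_L2 (X (r k))" for k
  have sq: "square_integrable (u k)" for k
    by (simp add: u_def)
  have [measurable]: "u k \<in> borel_measurable circle_measure" for k
    by (simp add: u_def)
  have Xr: "X (r k) = abs_circle_L2 (u k)" for k
    by (simp add: u_def)
  have dist: "norm (abs_circle_L2 (\<lambda>z. u m z - u n z)) < (1 / 2) ^ k" if "k \<le> m" "k \<le> n" for k m n
    using N[OF rN[OF that(1)] rN[OF that(2)]] by (simp add: dist_norm Xr minus_abs_circle_L2 sq)
  have "(\<integral>\<^sup>+z. (\<Sum>k. ennreal (norm (u (Suc k) z - u k z))) \<partial>circle_measure) =
      (\<Sum>k. \<integral>\<^sup>+z. ennreal (norm (u (Suc k) z - u k z)) \<partial>circle_measure)"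
    by (rule nn_integral_suminf) measurable
  also have "\<dots> \<le> (\<Sum>k. ennreal ((1 / 2) ^ k))"
  proof (rule suminf_le)
    fix k
    have "(\<integral>\<^sup>+z. ennreal (norm (u (Suc k) z - u k z)) \<partial>circle_measure) = ennreal (\<integral>z. norm (u (Suc k) z - u k z) \<partial>circle_measure)"
      by (intro nn_integral_eq_integral integral_norm_le_circle_L2 square_integrable_diff sq) auto
    also have "\<dots> \<le> ennreal ((1 / 2) ^ k)"
      using integral_norm_le_circle_L2(2)[OF square_integrable_diff[OF sq sq], of "Suc k" k] dist[of k "Suc k" k]
      by (intro ennreal_leI) simp
    finally show "(\<integral>\<^sup>+z. ennreal (norm (u (Suc k) z - u k z)) \<partial>circle_measure) \<le> ennreal ((1 / 2) ^ k)" .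
  qed auto
  also have "\<dots> < \<infinity>"
  proof -
    have "(\<Sum>k. ennreal ((1 / 2) ^ k)) = ennreal (\<Sum>k. (1 / 2) ^ k)"
      by (intro suminf_ennreal2 summable_geometric) auto
    then show ?thesis
      by simp
  qed
  finally have "AE z in circle_measure. (\<Sum>k. ennreal (norm (u (Suc k) z - u k z))) \<noteq> \<infinity>"
    by (intro nn_integral_noteq_infinite) auto
  then have conv: "AE z in circle_measure. convergent (\<lambda>k. u k z)"
  proof eventually_elim
    case (elim z)
    then have "summable (\<lambda>k. norm (u (Suc k) z - u k z))"
      by (intro summable_suminf_not_top) auto
    then have "summable (\<lambda>k. u (Suc k) z - u k z)"
      by (rule summable_norm_cancel)
    then have "convergent (\<lambda>n. (\<Sum>k<n. u (Suc k) z - u k z))"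
      by (simp add: summable_iff_convergent)
    then have "convergent (\<lambda>n. (u n z - u 0 z) + u 0 z)"
      unfolding sum_lessThan_telescope[of "\<lambda>k. u k z"] by (intro convergent_add convergent_const)
    then show ?case by simp
  qed
  define g where "g z = lim (\<lambda>k. u k z)" for z
  have [measurable]: "g \<in> borel_measurable circle_measure"
    unfolding g_def by (rule borel_measurable_lim_metric) measurable
  \<comment> \<open>Fatou's lemma in \<open>m\<close>: the differences of \<open>u k\<close> and
    \<open>u m\<close> are bounded in norm by (1/2)^k once \<open>m\<close> is at least
    \<open>k\<close>.\<close>
  have bound: "(\<integral>\<^sup>+z. ennreal ((norm (u k z - g z))\<^sup>2) \<partial>circle_measure) \<le> ennreal (((1 / 2) ^ k)\<^sup>2)" for k
  proof -
    have "(\<integral>\<^sup>+z. ennreal ((norm (u k z - g z))\<^sup>2) \<partial>circle_measure) =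
       (\<integral>\<^sup>+z. liminf (\<lambda>m. ennreal ((norm (u k z - u m z))\<^sup>2)) \<partial>circle_measure)"
    proof (rule nn_integral_cong_AE)
      show "AE z in circle_measure. ennreal ((norm (u k z - g z))\<^sup>2) = liminf (\<lambda>m. ennreal ((norm (u k z - u m z))\<^sup>2))"
        using conv
      proof eventually_elim
        case (elim z)
        then have "(\<lambda>m. u m z) \<longlonglongrightarrow> g z"
          by (simp add: g_def convergent_LIMSEQ_iff)
        then have "(\<lambda>m. ennreal ((norm (u k z - u m z))\<^sup>2)) \<longlonglongrightarrow> ennreal ((norm (u k z - g z))\<^sup>2)"
          by (intro tendsto_ennrealI tendsto_intros)
        then show ?case
          by (intro lim_imp_Liminf[symmetric]) auto
      qed
    qed
    also have "\<dots> \<le> liminf (\<lambda>m. \<integral>\<^sup>+z. ennreal ((norm (u k z - u m z))\<^sup>2) \<partial>circle_measure)"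
      by (rule nn_integral_liminf) measurable
    also have "\<dots> \<le> ennreal (((1 / 2) ^ k)\<^sup>2)"
    proof (rule Liminf_le)
      have "(\<integral>\<^sup>+z. ennreal ((norm (u k z - u m z))\<^sup>2) \<partial>circle_measure) \<le> ennreal (((1 / 2) ^ k)\<^sup>2)" if "k \<le> m" for m
      proof -
        have "(\<integral>\<^sup>+z. ennreal ((norm (u k z - u m z))\<^sup>2) \<partial>circle_measure) = ennreal (\<integral>z. (norm (u k z - u m z))\<^sup>2 \<partial>circle_measure)"
          using square_integrable_diff[OF sq sq, of k m] by (intro nn_integral_eq_integral) (auto simp: square_integrable_def)
        also have "\<dots> = ennreal ((norm (abs_circle_L2 (\<lambda>z. u k z - u m z)))\<^sup>2)"
          by (simp add: norm_circle_L2_sq square_integrable_diff sq)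
        also have "\<dots> \<le> ennreal (((1 / 2) ^ k)\<^sup>2)"
          using dist[of k k m] that by (intro ennreal_leI power_mono) auto
        finally show ?thesis .
      qed
      then show "\<forall>\<^sub>F m in sequentially. (\<integral>\<^sup>+z. ennreal ((norm (u k z - u m z))\<^sup>2) \<partial>circle_measure) \<le> ennreal (((1 / 2) ^ k)\<^sup>2)"
        by (auto simp: eventually_sequentially)
    qed simp
    finally show ?thesis .
  qed
  have diff: "square_integrable (\<lambda>z. u k z - g z)" for k
    unfolding square_integrable_def
  proof
    show "integrable circle_measure (\<lambda>z. (norm (u k z - g z))\<^sup>2)"
      using bound[of k] by (intro integrableI_bounded) (auto simp: less_top[symmetric] top_unique)
  qed measurable
  have "square_integrable g"
    using square_integrable_diff[OF sq[of 0] diff[of 0]] by simp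
  have near: "dist (X (r k)) (abs_circle_L2 g) \<le> (1 / 2) ^ k" for k
  proof -
    have "ennreal (\<integral>z. (norm (u k z - g z))\<^sup>2 \<partial>circle_measure) \<le> ennreal (((1 / 2) ^ k)\<^sup>2)"
      using bound[of k] diff[of k] by (subst nn_integral_eq_integral[symmetric]) (auto simp: square_integrable_def)
    then have "(norm (abs_circle_L2 (\<lambda>z. u k z - g z)))\<^sup>2 \<le> ((1 / 2) ^ k)\<^sup>2"
      by (subst (asm) ennreal_le_iff) (simp_all add: norm_circle_L2_sq diff)
    then have "norm (abs_circle_L2 (\<lambda>z. u k z - g z)) \<le> (1 / 2) ^ k"
      by (rule power2_le_imp_le) simp
    then show ?thesis
      by (simp add: dist_norm Xr minus_abs_circle_L2 sq \<open>square_integrable g\<close>)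
  qed
  have "(\<lambda>k. dist (X (r k)) (abs_circle_L2 g)) \<longlonglongrightarrow> 0"
  proof (rule tendsto_sandwich[OF _ _ tendsto_const])
    show "(\<lambda>k. (1 / 2 :: real) ^ k) \<longlonglongrightarrow> 0"
      by (intro LIMSEQ_realpow_zero) auto
  qed (use near in auto)
  then have "(X \<circ> r) \<longlonglongrightarrow> abs_circle_L2 g"
    by (subst tendsto_dist_iff) (simp add: o_def)
  then have "X \<longlonglongrightarrow> abs_circle_L2 g"
    by (rule Cauchy_converges_subseq[OF X r])
  then show ?thesis ..
qed

lemma cinner_scaleC_right: "cinner x (c *\<^sub>C y) = cnj c * cinner x y" for x :: "'a::complex_inner"
  by (subst (1 2) cinner_commute) (simp add: cinner_scaleC_left)

lemma exists_orthogonal_vector: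
  fixes V :: "circle_L2 set"
  assumes V: "complex_vector.subspace V" "closed V" "V \<noteq> UNIV"
  obtains w where "w \<noteq> 0" "\<And>v. v \<in> V \<Longrightarrow> cinner v w = 0"
proof -
  have "\<exists>l\<in>V. f \<longlonglongrightarrow> l" if f: "\<And>n. f n \<in> V" "Cauchy f" for f
  proof -
    obtain l where "f \<longlonglongrightarrow> l"
      using circle_L2_Cauchy_convergent[OF f(2)] by blast
    then show ?thesis
      using closed_sequentially[OF V(2), of f l] f(1) by blast
  qed
  moreover have "subspace V"
    unfolding subspace_def
    using V(1) by (simp add: complex_vector.subspace_def scaleR_scaleC)
  moreover obtain h where h: "h \<notin> V"
    using V(3) by auto
  ultimately obtain p where p: "p \<in> V" "\<And>u. u \<in> V \<Longrightarrow> inner (h - p) u = 0"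
    using orthogonal_projection_exists by blast
  have "cinner (h - p) v = 0" if "v \<in> V" for v
  proof -
    \<comment> \<open>The projection is orthogonal for the real inner product; testing against
      \<open>\<i> *\<^sub>C v\<close> as well kills the imaginary part.\<close>
    have "\<i> *\<^sub>C v \<in> V"
      using that V(1) by (simp add: complex_vector.subspace_def)
    then have "Re (cinner (h - p) v) = 0" "Re (cinner (h - p) (\<i> *\<^sub>C v)) = 0"
      using p(2) that by (simp_all add: inner_eq_Re_cinner)
    then show ?thesis
      by (simp add: cinner_scaleC_right complex_eq_iff)
  qed
  then have "cinner v (h - p) = 0" if "v \<in> V" for v
    using that cinner_commute[of v "h - p"] by simp
  moreover have "h - p \<noteq> 0"
    using h p(1) by auto
  ultimately show thesis
    using that by blast
qed

section \<open>Restricting functions to arcs\<close>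

lemma norm_scaleC: "norm (c *\<^sub>C x) = norm c * norm x" for x :: "'a::complex_inner"
proof -
  have "(norm (c *\<^sub>C x))\<^sup>2 = Re ((c * cnj c) * cinner x x)"
    by (simp add: power2_norm_eq_inner inner_eq_Re_cinner cinner_scaleC_left cinner_scaleC_right algebra_simps)
  also have "\<dots> = (norm c)\<^sup>2 * (norm x)\<^sup>2"
    unfolding complex_norm_square[symmetric]
    by (simp add: power2_norm_eq_inner inner_eq_Re_cinner)
  finally have "(norm (c *\<^sub>C x))\<^sup>2 = (norm c * norm x)\<^sup>2"
    by (simp add: power_mult_distrib)
  then show ?thesis
    by (rule power2_eq_imp_eq) auto
qed

text \<open>Multiplying \<open>x\<close> by a phase makes the inner product real and nonnegative,
  which reduces to the real Cauchy-Schwarz inequality.\<close>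

lemma cinner_norm_le: "norm (cinner x y) \<le> norm x * norm y" for x y :: "'a::complex_inner"
proof (cases "cinner x y = 0")
  case False
  define c where "c = cinner x y"
  have "norm c = Re (cinner ((cnj c / norm c) *\<^sub>C x) y)"
    using False by (simp add: cinner_scaleC_left c_def[symmetric] complex_norm_square[symmetric] mult.commute power2_eq_square)
  also have "\<dots> \<le> norm ((cnj c / norm c) *\<^sub>C x) * norm y"
    unfolding inner_eq_Re_cinner[symmetric] by (rule norm_cauchy_schwarz)
  also have "norm ((cnj c / norm c) *\<^sub>C x) = norm x"
    using False by (simp add: norm_scaleC norm_divide c_def)
  finally show ?thesis
    by (simp add: c_def)
qed simp

text \<open>Multiplication by an indicator in the coordinate. Besides arcs, \<open>A\<close> will be
  a preimage of one under a power of the expander.\<close>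

definition arc_restrict :: "real set \<Rightarrow> circle_L2 \<Rightarrow> circle_L2" where
  "arc_restrict A x = abs_circle_L2 (\<lambda>z. indicator A (circle_coord z) * rep_circle_L2 x z)"

lemma square_integrable_arc:
  assumes "square_integrable f" "A \<in> sets borel"
  shows "square_integrable (\<lambda>z. indicator A (circle_coord z) * f z)"
  unfolding square_integrable_def
proof
  have [measurable]: "f \<in> borel_measurable circle_measure" "A \<in> sets borel"
    using assms by (auto intro: square_integrable_measurable)
  show "(\<lambda>z. indicator A (circle_coord z) * f z) \<in> borel_measurable circle_measure"
    by measurable
  show "integrable circle_measure (\<lambda>z. (norm (indicator A (circle_coord z) * f z))\<^sup>2)"
  proof (rule Bochner_Integration.integrable_bound)
    show "integrable circle_measure (\<lambda>z. (norm (f z))\<^sup>2)"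
      using assms by (simp add: square_integrable_def)
  qed (auto simp: indicator_def)
qed

lemma arc_restrict_abs:
  assumes "square_integrable f" "A \<in> sets borel"
  shows "arc_restrict A (abs_circle_L2 f) = abs_circle_L2 (\<lambda>z. indicator A (circle_coord z) * f z)"
  unfolding arc_restrict_def
proof (rule abs_circle_L2_eqI)
  show "AE z in circle_measure. indicator A (circle_coord z) * rep_circle_L2 (abs_circle_L2 f) z = indicator A (circle_coord z) * f z"
    using rep_abs_circle_L2[OF assms(1)] by eventually_elim simp
qed (use assms in \<open>auto intro!: square_integrable_arc square_integrable_measurable[OF square_integrable_arc]\<close>)

lemma arc_restrict_scaleC:
  assumes "A \<in> sets borel"
  shows "arc_restrict A (c *\<^sub>C x) = c *\<^sub>C arc_restrict A x"
proof -
  obtain f where f: "x = abs_circle_L2 f" "square_integrable f"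
    by (metis circle_L2_cases)
  show ?thesis
    using f(2) assms by (simp add: f(1) scaleC_abs_circle_L2 arc_restrict_abs square_integrable_scale square_integrable_arc mult.left_commute)
qed

lemma arc_restrict_split:
  assumes "A \<in> sets borel" "B \<in> sets borel" "A \<inter> B = {}"
  shows "arc_restrict (A \<union> B) x = arc_restrict A x + arc_restrict B x"
proof -
  have "indicator (A \<union> B) t * c = indicator A t * c + indicator B t * c" for t and c :: complex
    using assms(3) by (auto simp: indicator_def)
  then show ?thesis
    unfolding arc_restrict_def using assms by (simp add: plus_abs_circle_L2 square_integrable_arc)
qed

lemma arc_restrict_UNIV [simp]: "arc_restrict UNIV x = x"
  by (simp add: arc_restrict_def)

lemma arc_restrict_Compl: "arc_restrict {..a} x + arc_restrict {a<..} x = x"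
proof -
  have "{..a} \<union> {a<..} = UNIV"
    by auto
  then show ?thesis
    using arc_restrict_split[of "{..a}" "{a<..}" x] by (simp add: disjoint_iff)
qed

lemma cinner_arc_restrict:
  assumes "A \<in> sets borel"
  shows "cinner (arc_restrict A x) y = (\<integral>z. rep_circle_L2 x z * cnj (rep_circle_L2 y z) * indicator A (circle_coord z) \<partial>circle_measure)"
proof -
  have "cinner (arc_restrict A x) (abs_circle_L2 (rep_circle_L2 y)) =
    (\<integral>z. (indicator A (circle_coord z) * rep_circle_L2 x z) * cnj (rep_circle_L2 y z) \<partial>circle_measure)"
    unfolding arc_restrict_def using assms by (intro cinner_abs_circle_L2 square_integrable_arc) auto
  then show ?thesis
    by (simp add: mult_ac)
qed

lemma cinner_arc_restrict_swap:
  assumes "A \<in> sets borel"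
  shows "cinner (arc_restrict A x) y = cinner x (arc_restrict A y)"
proof -
  have "cinner x (arc_restrict A y) = cnj (cinner (arc_restrict A y) x)"
    by (rule cinner_commute)
  also have "\<dots> = (\<integral>z. cnj (rep_circle_L2 y z * cnj (rep_circle_L2 x z) * indicator A (circle_coord z)) \<partial>circle_measure)"
    unfolding cinner_arc_restrict[OF assms] by (rule Bochner_Integration.integral_cnj[symmetric])
  also have "\<dots> = cinner (arc_restrict A x) y"
    unfolding cinner_arc_restrict[OF assms]
    by (rule Bochner_Integration.integral_cong) (auto simp: indicator_def mult_ac)
  finally show ?thesis ..
qed

lemma norm_arc_restrict_tendsto_0:
  assumes A: "\<And>n. A n \<in> sets borel"
    and ev: "AE z in circle_measure. \<forall>\<^sub>F n in sequentially. circle_coord z \<notin> A n"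
  shows "(\<lambda>n. norm (arc_restrict (A n) x)) \<longlonglongrightarrow> 0"
proof -
  note [measurable] = A
  have "(\<lambda>n. \<integral>z. (norm (indicator (A n) (circle_coord z) * rep_circle_L2 x z))\<^sup>2 \<partial>circle_measure) \<longlonglongrightarrow>
      (\<integral>z. 0 \<partial>circle_measure)"
  proof (rule integral_dominated_convergence)
    show "integrable circle_measure (\<lambda>z. (norm (rep_circle_L2 x z))\<^sup>2)"
      using square_integrable_rep[of x] by (simp add: square_integrable_def)
    show "AE z in circle_measure. (\<lambda>n. (norm (indicator (A n) (circle_coord z) * rep_circle_L2 x z))\<^sup>2) \<longlonglongrightarrow> 0"
      using ev
    proof eventually_elim
      case (elim z)
      then have "\<forall>\<^sub>F n in sequentially. (norm (indicator (A n) (circle_coord z) * rep_circle_L2 x z))\<^sup>2 = 0"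
        by eventually_elim simp
      then show ?case
        by (rule tendsto_eventually)
    qed
  qed (auto simp: indicator_def)
  then have "(\<lambda>n. (norm (arc_restrict (A n) x))\<^sup>2) \<longlonglongrightarrow> 0"
    unfolding arc_restrict_def by (simp add: norm_circle_L2_sq square_integrable_arc)
  then have "(\<lambda>n. sqrt ((norm (arc_restrict (A n) x))\<^sup>2)) \<longlonglongrightarrow> sqrt 0"
    by (rule tendsto_real_sqrt)
  then show ?thesis
    by simp
qed

text \<open>The operator of \<open>\<gamma>\<close> conjugates multiplication by an indicator into
  multiplication by its composition with the inverse of \<open>\<gamma>\<close>.\<close>

lemma rho_arc_restrict:
  assumes \<gamma>: "\<gamma> \<in> circle_auts" "\<And>z. z \<in> circle \<Longrightarrow> circle_coord (inv_into circle \<gamma> z) = \<phi> (circle_coord z)"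
    and \<phi>: "\<phi> \<in> borel_measurable borel" and A: "A \<in> sets borel"
  shows "rho s \<gamma> (arc_restrict A x) = arc_restrict (\<phi> -` A) (rho s \<gamma> x)"
proof -
  obtain d where d: "pow2_density \<gamma> d"
    using \<gamma>(1) by (auto simp: circle_auts_def)
  obtain f where f: "x = abs_circle_L2 f" "square_integrable f"
    by (metis circle_L2_cases)
  have A': "\<phi> -` A \<in> sets borel"
    using measurable_sets[OF \<phi> A] by simp
  have sq: "square_integrable (\<lambda>z. indicator (\<phi> -` A) (circle_coord z) * (weight s (d z) * f (inv_into circle \<gamma> z)))"
    by (rule square_integrable_arc[OF square_integrable_transform[OF \<gamma>(1) d f(2)] A'])
  have "rho s \<gamma> (arc_restrict A x) = abs_circle_L2 (\<lambda>z. weight s (d z) *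
      (indicator A (circle_coord (inv_into circle \<gamma> z)) * f (inv_into circle \<gamma> z)))"
    unfolding f(1) arc_restrict_abs[OF f(2) A]
    by (rule rho_abs[OF \<gamma>(1) d square_integrable_arc[OF f(2) A]])
  also have "\<dots> = abs_circle_L2 (\<lambda>z. indicator (\<phi> -` A) (circle_coord z) * (weight s (d z) * f (inv_into circle \<gamma> z)))"
  proof (rule abs_circle_L2_eqI[OF _ square_integrable_measurable[OF sq]])
    show "square_integrable (\<lambda>z. weight s (d z) *
      (indicator A (circle_coord (inv_into circle \<gamma> z)) * f (inv_into circle \<gamma> z)))"
      by (rule square_integrable_transform[OF \<gamma>(1) d square_integrable_arc[OF f(2) A]])
    show "AE z in circle_measure. weight s (d z) * (indicator A (circle_coord (inv_into circle \<gamma> z)) * f (inv_into circle \<gamma> z)) =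
      indicator (\<phi> -` A) (circle_coord z) * (weight s (d z) * f (inv_into circle \<gamma> z))"
      using AE_space by eventually_elim (simp add: \<gamma>(2) indicator_def)
  qed
  also have "\<dots> = arc_restrict (\<phi> -` A) (rho s \<gamma> x)"
    unfolding f(1) rho_abs[OF \<gamma>(1) d f(2)]
    by (rule arc_restrict_abs[OF square_integrable_transform[OF \<gamma>(1) d f(2)] A', symmetric])
  finally show ?thesis .
qed

section \<open>Weak limits of powers of expanding elements\<close>

text \<open>While an orbit stays in [t,b] it advances by at least a fixed amount, so it must pass
  \<open>b\<close>.\<close>

lemma expander_escape:
  assumes t: "0 < t" and b: "b < a"
  shows "\<forall>\<^sub>F n in sequentially. b < (expander a ^^ n) t"
proof -
  \<comment> \<open>The displacement of the expander at s is s, a/4 and (a - s)/2 on its three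
    pieces; these are the lower bounds for s in [t,b].\<close>
  define e where "e = min t (min (a / 4) ((a - b) / 2))"
  have step: "s + e \<le> expander a s" if "t \<le> s" "s \<le> b" for s
    using that t b by (simp add: e_def expander_def max_def min_def field_simps)
  have ge: "t \<le> (expander a ^^ n) t" for n
    by (induction n) (auto intro: order_trans expander_ge)
  have mono: "(expander a ^^ m) t \<le> (expander a ^^ n) t" if "m \<le> n" for m n
    using that by (induction n rule: dec_induct) (auto intro: order_trans expander_ge)
  have "\<exists>n. b < (expander a ^^ n) t"
  proof (rule ccontr)
    assume "\<not> ?thesis"
    then have le: "(expander a ^^ n) t \<le> b" for n
      by (simp add: not_less)
    then have epos: "0 < e"
      using t b ge[of 0] le[of 0] by (simp add: e_def)
    have "t + real n * e \<le> (expander a ^^ n) t" for n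
    proof (induction n)
      case (Suc n)
      then show ?case
        using step[OF ge le, of n] by (simp add: algebra_simps)
    qed simp
    then have "real n * e \<le> b - t" for n
      using le[of n] by (smt (verit))
    then have "real n \<le> (b - t) / e" for n
      using epos by (simp add: field_simps)
    then show False
      using reals_Archimedean2[of "(b - t) / e"] by (meson not_less)
  qed
  then obtain N where "b < (expander a ^^ N) t"
    by blast
  then show ?thesis
    using mono by (auto simp: eventually_sequentially intro!: exI[of _ N] intro: less_le_trans)
qed

text \<open>The part of \<open>x\<close> beyond \<open>a\<close> is fixed. Of the rest, the piece
  close to \<open>a\<close> is small in norm, uniformly in n by unitarity, and the piece below some
  \<open>b < a\<close> is carried to sets shrinking to the point 0, so pairing with a fixed
  \<open>y\<close> tends to 0.\<close>

lemma expander_weak_limit: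
  assumes \<gamma>: "\<gamma> \<in> circle_auts" "pow2_density \<gamma> (\<lambda>z. d (circle_coord z))"
    and inv: "\<And>z. z \<in> circle \<Longrightarrow> inv_into circle \<gamma> z = circle_param (expander a (circle_coord z))"
      "\<And>z. z \<in> circle \<Longrightarrow> circle_coord (inv_into circle \<gamma> z) = expander a (circle_coord z)"
    and d: "AE z in circle_measure. a < circle_coord z \<longrightarrow> d (circle_coord z) = 1"
    and a: "0 < a"
  shows "(\<lambda>n. cinner ((rho s \<gamma> ^^ n) x) y) \<longlonglongrightarrow> cinner (arc_restrict {a<..} x) y"
proof -
  let ?R = "rho s \<gamma>"
  have R: "unitary_map ?R"
    by (rule unitary_map_rho[OF \<gamma>(1)])
  have norm_R: "norm ((?R ^^ n) u) = norm u" for n u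
  proof (induction n)
    case (Suc n)
    then show ?case
      using R by (simp add: unitary_map_def norm_eq_sqrt_inner inner_eq_Re_cinner)
  qed simp
  have add_R: "(?R ^^ n) (u + v) = (?R ^^ n) u + (?R ^^ n) v" for n u v
    by (induction n) (simp_all add: rho_add[OF \<gamma>])
  have fixed: "?R (arc_restrict {a<..} x) = arc_restrict {a<..} x"
  proof -
    let ?f = "\<lambda>z. indicator {a<..} (circle_coord z) * rep_circle_L2 x z"
    have sq: "square_integrable ?f"
      by (rule square_integrable_arc) auto
    have "abs_circle_L2 ?f = abs_circle_L2 (\<lambda>z. weight s (d (circle_coord z)) * ?f (inv_into circle \<gamma> z))"
    proof (rule abs_circle_L2_eqI[OF sq square_integrable_measurable[OF square_integrable_transform[OF \<gamma> sq]]])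
      show "AE z in circle_measure. ?f z = weight s (d (circle_coord z)) * ?f (inv_into circle \<gamma> z)"
        using d AE_space
      proof eventually_elim
        case (elim z)
        then have z: "z \<in> circle" by simp
        show ?case
        proof (cases "a < circle_coord z")
          case True
          then have "inv_into circle \<gamma> z = z"
            using inv(1)[OF z] expander_affine(4)[OF a, of "circle_coord z"] z by (simp add: circle_param_coord)
          then show ?thesis
            using True elim(1) by simp
        next
          case False
          then have "expander a (circle_coord z) \<le> a"
            using a by (simp add: expander_def max_def min_def)
          then have "\<not> a < circle_coord (inv_into circle \<gamma> z)"
            using inv(2)[OF z] by simp
          then show ?thesis
            using False by simp
        qed
      qed
    qed
    then show ?thesis
      unfolding arc_restrict_def rho_abs[OF \<gamma> sq] by simp
  qed
  have fixed_n: "(?R ^^ n) (arc_restrict {a<..} x) = arc_restrict {a<..} x" for n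
    by (induction n) (simp_all add: fixed)
  have pow: "expander a ^^ n \<in> borel_measurable borel" for n
  proof (induction n)
    case (Suc n)
    then show ?case
      using measurable_comp[OF Suc expander_borel[of a]] by simp
  qed (simp add: id_def)
  have shrink: "(?R ^^ n) (arc_restrict {..b} x) = arc_restrict ((expander a ^^ n) -` {..b}) ((?R ^^ n) x)" for n b
  proof (induction n)
    case (Suc n)
    have "(?R ^^ Suc n) (arc_restrict {..b} x) = ?R (arc_restrict ((expander a ^^ n) -` {..b}) ((?R ^^ n) x))"
      using Suc by simp
    also have "\<dots> = arc_restrict (expander a -` ((expander a ^^ n) -` {..b})) (?R ((?R ^^ n) x))"
      using measurable_sets[OF pow[of n], of "{..b}"] by (intro rho_arc_restrict \<gamma> inv(2)) auto
    also have "expander a -` ((expander a ^^ n) -` {..b}) = (expander a ^^ Suc n) -` {..b}"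
      by (auto simp: funpow_swap1)
    finally show ?case
      by (simp add: comp_def)
  qed simp
  have "(\<lambda>n. cinner ((?R ^^ n) (arc_restrict {..a} x)) y) \<longlonglongrightarrow> 0"
  proof (rule tendstoI)
    fix e :: real assume e: "0 < e"
    \<comment> \<open>The point \<open>a\<close> itself is fixed and never escapes, so a short arc
      below it is cut off first; its length is chosen before n.\<close>
    have "(\<lambda>j. norm (arc_restrict {a - 1 / real (Suc j)<..a} x)) \<longlonglongrightarrow> 0"
    proof (rule norm_arc_restrict_tendsto_0)
      show "AE z in circle_measure. \<forall>\<^sub>F j in sequentially. circle_coord z \<notin> {a - 1 / real (Suc j)<..a}"
        using AE_circle_coord_neq[of a]
      proof eventually_elim
        case (elim z)
        show ?case
        proof (cases "a < circle_coord z")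
          case False
          then have "circle_coord z < a"
            using elim by simp
          moreover have "(\<lambda>j. a - 1 / real (Suc j)) \<longlonglongrightarrow> a - 0"
            by (intro tendsto_diff tendsto_const LIMSEQ_Suc[OF lim_1_over_n])
          ultimately have "\<forall>\<^sub>F j in sequentially. circle_coord z < a - 1 / real (Suc j)"
            by (intro order_tendstoD(1)) auto
          then show ?thesis
            by eventually_elim auto
        qed simp
      qed
    qed simp
    then have "(\<lambda>j. norm (arc_restrict {a - 1 / real (Suc j)<..a} x) * norm y) \<longlonglongrightarrow> 0 * norm y"
      by (intro tendsto_intros)
    then have "\<forall>\<^sub>F j in sequentially. norm (arc_restrict {a - 1 / real (Suc j)<..a} x) * norm y < e / 2"
      using e by (intro order_tendstoD(2)) auto
    then obtain j where j: "norm (arc_restrict {a - 1 / real (Suc j)<..a} x) * norm y < e / 2"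
      by (auto simp: eventually_sequentially)
    define b where "b = a - 1 / real (Suc j)"
    have b: "b < a"
      by (simp add: b_def)
    have split: "arc_restrict {..a} x = arc_restrict {..b} x + arc_restrict {b<..a} x"
    proof -
      have "{..a} = {..b} \<union> {b<..a}"
        using b by auto
      then show ?thesis
        using arc_restrict_split[of "{..b}" "{b<..a}" x] by (simp add: disjoint_iff)
    qed
    have "(\<lambda>n. norm (arc_restrict ((expander a ^^ n) -` {..b}) y)) \<longlonglongrightarrow> 0"
    proof (rule norm_arc_restrict_tendsto_0)
      show "(expander a ^^ n) -` {..b} \<in> sets borel" for n
        using measurable_sets[OF pow[of n], of "{..b}"] by simp
      show "AE z in circle_measure. \<forall>\<^sub>F n in sequentially. circle_coord z \<notin> (expander a ^^ n) -` {..b}"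
        using AE_circle_coord_neq[of 0]
      proof eventually_elim
        case (elim z)
        then have "0 < circle_coord z"
          using circle_coord_bounds(1)[of z] by linarith
        then have "\<forall>\<^sub>F n in sequentially. b < (expander a ^^ n) (circle_coord z)"
          by (rule expander_escape[OF _ b])
        then show ?case
          by eventually_elim auto
      qed
    qed
    then have "(\<lambda>n. norm x * norm (arc_restrict ((expander a ^^ n) -` {..b}) y)) \<longlonglongrightarrow> norm x * 0"
      by (intro tendsto_intros)
    then have "\<forall>\<^sub>F n in sequentially. norm x * norm (arc_restrict ((expander a ^^ n) -` {..b}) y) < e / 2"
      using e by (intro order_tendstoD(2)) auto
    then show "\<forall>\<^sub>F n in sequentially. dist (cinner ((?R ^^ n) (arc_restrict {..a} x)) y) 0 < e"
    proof eventually_elim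
      case (elim n)
      \<comment> \<open>The cutoff is self-adjoint and can be moved to the fixed vector
        \<open>y\<close>, where dominated convergence applies; the other factor keeps the norm of
        \<open>x\<close>.\<close>
      have "cinner ((?R ^^ n) (arc_restrict {..b} x)) y = cinner ((?R ^^ n) x) (arc_restrict ((expander a ^^ n) -` {..b}) y)"
        unfolding shrink using measurable_sets[OF pow[of n], of "{..b}"] by (intro cinner_arc_restrict_swap) simp
      then have 1: "norm (cinner ((?R ^^ n) (arc_restrict {..b} x)) y) < e / 2"
        using cinner_norm_le[of "(?R ^^ n) x" "arc_restrict ((expander a ^^ n) -` {..b}) y"] elim by (simp add: norm_R)
      have 2: "norm (cinner ((?R ^^ n) (arc_restrict {b<..a} x)) y) < e / 2"
        using cinner_norm_le[of "(?R ^^ n) (arc_restrict {b<..a} x)" y] j by (simp add: norm_R b_def)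
      have "cinner ((?R ^^ n) (arc_restrict {..a} x)) y =
        cinner ((?R ^^ n) (arc_restrict {..b} x)) y + cinner ((?R ^^ n) (arc_restrict {b<..a} x)) y"
        by (simp add: split add_R cinner_add_left)
      then show ?case
        using norm_triangle_ineq[of "cinner ((?R ^^ n) (arc_restrict {..b} x)) y" "cinner ((?R ^^ n) (arc_restrict {b<..a} x)) y"] 1 2
        by simp
    qed
  qed
  then have "(\<lambda>n. cinner ((?R ^^ n) (arc_restrict {..a} x)) y + cinner (arc_restrict {a<..} x) y) \<longlonglongrightarrow>
      0 + cinner (arc_restrict {a<..} x) y"
    by (intro tendsto_intros)
  moreover have "cinner ((?R ^^ n) (arc_restrict {..a} x)) y + cinner (arc_restrict {a<..} x) y = cinner ((?R ^^ n) x) y" for n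
    using add_R[of n "arc_restrict {..a} x" "arc_restrict {a<..} x"]
    by (simp add: arc_restrict_Compl fixed_n cinner_add_left)
  ultimately show ?thesis
    by simp
qed

text \<open>The element is chosen before s, x and y, so one \<open>\<gamma>\<close> serves two
  representations at once.\<close>

lemma thompson_T_weak_limit:
  assumes a: "a \<in> dyadic" "0 < a" "a \<le> 1"
  obtains \<gamma> where "\<gamma> \<in> carrier thompson_T"
    "\<And>s x y. (\<lambda>n. cinner ((rho s \<gamma> ^^ n) x) y) \<longlonglongrightarrow> cinner (arc_restrict {a<..} x) y"
proof -
  obtain \<gamma> d where *: "\<gamma> \<in> carrier thompson_T" "d \<in> borel_measurable borel"
    "pow2_density \<gamma> (\<lambda>z. d (circle_coord z))"
    "\<And>z. z \<in> circle \<Longrightarrow> inv_into circle \<gamma> z = circle_param (expander a (circle_coord z))"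
    "\<And>z. z \<in> circle \<Longrightarrow> circle_coord (inv_into circle \<gamma> z) = expander a (circle_coord z)"
    "AE z in circle_measure. (circle_coord z < a / 4 \<longrightarrow> d (circle_coord z) = 2) \<and>
       (a < circle_coord z \<longrightarrow> d (circle_coord z) = 1)"
    using expander_thompson_T[OF a] by blast
  have "\<gamma> \<in> circle_auts"
    using *(1) thompson_T_subset by auto
  moreover have "AE z in circle_measure. a < circle_coord z \<longrightarrow> d (circle_coord z) = 1"
    using *(6) by eventually_elim simp
  ultimately show thesis
    using that[OF *(1)] expander_weak_limit[OF _ *(3,4,5) _ a(2)] by blast
qed

section \<open>Irreducibility\<close>

lemma one_circle_L2_neq_0: "abs_circle_L2 (\<lambda>_. 1) \<noteq> 0"
  unfolding zero_circle_L2_abs by (simp add: abs_circle_L2_eq_iff)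

lemma irreducible_rep_rho: "irreducible_rep thompson_T (rho s)"
  unfolding irreducible_rep_def
proof (intro conjI allI impI)
  show "\<exists>x::circle_L2. x \<noteq> 0"
    using one_circle_L2_neq_0 by blast
  fix V :: "circle_L2 set"
  assume "complex_vector.subspace V \<and> closed V \<and> (\<forall>g\<in>carrier thompson_T. rho s g ` V \<subseteq> V)"
  then have sub: "complex_vector.subspace V" and closed: "closed V"
    and inv: "\<And>g v. g \<in> carrier thompson_T \<Longrightarrow> v \<in> V \<Longrightarrow> rho s g v \<in> V"
    by auto
  show "V = {0} \<or> V = UNIV"
  proof (rule ccontr)
    assume "\<not> ?thesis"
    then have "V \<noteq> {0}" "V \<noteq> UNIV" by auto
    moreover have "0 \<in> V"
      using sub by (simp add: complex_vector.subspace_def)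
    ultimately obtain x where x: "x \<in> V" "x \<noteq> 0"
      by blast
    obtain w where w: "w \<noteq> 0" "\<And>v. v \<in> V \<Longrightarrow> cinner v w = 0"
      using exists_orthogonal_vector[OF sub closed \<open>V \<noteq> UNIV\<close>] by blast
    have ortho: "AE z in circle_measure. rep_circle_L2 v z * cnj (rep_circle_L2 w z) = 0" if v: "v \<in> V" for v
    proof (rule AE_zero_of_dyadic_integrals)
      show "integrable circle_measure (\<lambda>z. rep_circle_L2 v z * cnj (rep_circle_L2 w z))"
        by (intro integrable_mult_cnj) auto
      fix y :: real assume y: "y \<in> dyadic" "0 \<le> y" "y \<le> 1"
      have "cinner (arc_restrict {..y} v) w = 0"
      \<comment> \<open>The weak limit requires a nondegenerate arc; for \<open>y = 0\<close> the
        arc is a single null point.\<close>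
      proof (cases "y = 0")
        case True
        have "cinner (arc_restrict {..y} v) w = (\<integral>z. 0 \<partial>circle_measure)"
          unfolding cinner_arc_restrict[OF atMost_borel]
        proof (rule integral_cong_AE)
          show "AE z in circle_measure. rep_circle_L2 v z * cnj (rep_circle_L2 w z) * indicator {..y} (circle_coord z) = 0"
            using AE_circle_coord_neq[of 0]
          proof eventually_elim
            case (elim z)
            then show ?case
              using True circle_coord_bounds(1)[of z] by auto
          qed
        qed measurable
        then show ?thesis by simp
      next
        case False
        then obtain \<gamma> where \<gamma>: "\<gamma> \<in> carrier thompson_T"
          "\<And>s u v. (\<lambda>n. cinner ((rho s \<gamma> ^^ n) u) v) \<longlonglongrightarrow> cinner (arc_restrict {y<..} u) v"
          using thompson_T_weak_limit[OF y(1) _ y(3)] y(2) by (metis less_eq_real_def)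
        have "(rho s \<gamma> ^^ n) v \<in> V" for n
          by (induction n) (auto intro: inv \<gamma>(1) v)
        \<comment> \<open>All powers keep \<open>v\<close> inside \<open>V\<close>, so the
          convergent sequence of inner products is constantly 0.\<close>
        then have "cinner (arc_restrict {y<..} v) w = 0"
          using \<gamma>(2)[of s v w] w(2) LIMSEQ_unique[OF _ tendsto_const] by auto
        moreover have "cinner (arc_restrict {..y} v) w + cinner (arc_restrict {y<..} v) w = 0"
          unfolding cinner_add_left[symmetric] arc_restrict_Compl by (rule w(2)[OF v])
        ultimately show ?thesis by simp
      qed
      then have "(\<integral>z. rep_circle_L2 v z * cnj (rep_circle_L2 w z) * indicator {..y} (circle_coord z) \<partial>circle_measure) = 0"
        by (simp add: cinner_arc_restrict)
      then show "(\<integral>z. rep_circle_L2 v z * cnj (rep_circle_L2 w z) * indicator {z. circle_coord z \<le> y} z \<partial>circle_measure) = 0"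
        by (simp add: indicator_def)
    qed
    define F where "F = rep_circle_L2 x"
    have [measurable]: "F \<in> borel_measurable circle_measure"
      by (simp add: F_def)
    have rot: "AE z in circle_measure. F (circle_param r * z) * cnj (rep_circle_L2 w z) = 0" if r: "r \<in> dyadic" for r
    proof -
      \<comment> \<open>The angle is negated because the representation composes with the
        inverse.\<close>
      let ?g = "restrict (\<lambda>z. circle_param (- r) * z) circle"
      have g: "?g \<in> carrier thompson_T"
        by (intro rotation_thompson_T dyadic_minus r)
      have sq: "square_integrable (\<lambda>z. weight s 1 * F (inv_into circle ?g z))"
        by (rule square_integrable_transform[OF rotation_circle_auts rotation_density]) (simp add: F_def)
      have "rho s ?g x = abs_circle_L2 (\<lambda>z. weight s 1 * F (inv_into circle ?g z))"
        using rho_abs[OF rotation_circle_auts rotation_density square_integrable_rep, of s "- r" x] by (simp add: F_def)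
      then have "AE z in circle_measure. rep_circle_L2 (rho s ?g x) z = weight s 1 * F (inv_into circle ?g z)"
        using rep_abs_circle_L2[OF sq] by simp
      with ortho[OF inv[OF g x(1)]] AE_space show ?thesis
        by eventually_elim (simp add: rotation_inv)
    qed
    \<comment> \<open>The union of the rotated supports of \<open>F\<close> is rotation invariant, hence conull.\<close>
    define h :: "complex \<Rightarrow> complex" where "h z = (if \<exists>r\<in>dyadic. F (circle_param r * z) \<noteq> 0 then 1 else 0)" for z
    have [measurable]: "{z \<in> space circle_measure. \<exists>r\<in>dyadic. F (circle_param r * z) \<noteq> 0} \<in> sets circle_measure"
    proof -
      have "{z \<in> space circle_measure. \<exists>r\<in>dyadic. F (circle_param r * z) \<noteq> 0} =
          (\<Union>r\<in>dyadic. {z \<in> space circle_measure. F (circle_param r * z) \<noteq> 0})"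
        by blast
      also have "\<dots> \<in> sets circle_measure"
        by (rule sets.countable_UN''[OF countable_dyadic]) measurable
      finally show ?thesis .
    qed
    have [measurable]: "h \<in> borel_measurable circle_measure"
      unfolding h_def by measurable
    have "integrable circle_measure h"
      by (rule circle_measure.integrable_const_bound[of _ 1]) (auto simp: h_def)
    moreover have "h (circle_param q * z) = h z" if q: "q \<in> dyadic" for q z
    proof -
      have "(\<exists>r\<in>dyadic. F (circle_param r * (circle_param q * z)) \<noteq> 0) \<longleftrightarrow> (\<exists>r\<in>dyadic. F (circle_param r * z) \<noteq> 0)"
      proof safe
        fix r assume "r \<in> dyadic" "F (circle_param r * (circle_param q * z)) \<noteq> 0"
        then show "\<exists>r\<in>dyadic. F (circle_param r * z) \<noteq> 0"
          using q by (intro bexI[of _ "r + q"]) (auto simp: circle_param_add mult.assoc dyadic_add)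
      next
        fix r assume "r \<in> dyadic" "F (circle_param r * z) \<noteq> 0"
        moreover have "circle_param (r - q) * (circle_param q * z) = circle_param r * z"
          by (simp add: mult.assoc[symmetric] circle_param_add[symmetric])
        ultimately show "\<exists>r\<in>dyadic. F (circle_param r * (circle_param q * z)) \<noteq> 0"
          using q by (intro bexI[of _ "r - q"]) (simp_all only: dyadic_diff not_False_eq_True)
      qed
      then show ?thesis
        by (simp add: h_def)
    qed
    ultimately obtain c where c: "AE z in circle_measure. h z = c"
      using AE_const_of_rotation_invariant[of h] by auto
    have "c \<noteq> 0"
    proof
      \<comment> \<open>Then already the unrotated function \<open>F\<close>, the case r = 0 in
        \<open>h\<close>, vanishes almost everywhere, contrary to the choice of
        \<open>x\<close>.\<close>
      assume c0: "c = 0"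
      have "AE z in circle_measure. rep_circle_L2 x z = rep_circle_L2 0 z"
        using c rep_abs_circle_L2[OF square_integrable_zero, folded zero_circle_L2_abs]
      proof eventually_elim
        case (elim z)
        then have "F (circle_param 0 * z) = 0"
          using c0 by (auto simp: h_def simp del: circle_param_0 split: if_splits)
        then show ?case
          using elim by (simp add: F_def)
      qed
      then show False
        using x(2) circle_L2_eqI by blast
    qed
    \<comment> \<open>Countability of the dyadic numbers merges the exceptional null sets. Almost
      every point has some rotated value of \<open>F\<close> nonzero, which forces \<open>w\<close>
      to vanish there.\<close>
    have "AE z in circle_measure. \<forall>r\<in>dyadic. F (circle_param r * z) * cnj (rep_circle_L2 w z) = 0"
      using rot by (subst AE_ball_countable[OF countable_dyadic]) auto
    with c rep_abs_circle_L2[OF square_integrable_zero, folded zero_circle_L2_abs]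
    have "AE z in circle_measure. rep_circle_L2 w z = rep_circle_L2 0 z"
      by eventually_elim (use \<open>c \<noteq> 0\<close> in \<open>auto simp: h_def split: if_splits\<close>)
    then show False
      using w(1) circle_L2_eqI by blast
  qed
qed

section \<open>Unitary equivalence\<close>

text \<open>For d = 2^m the exponents differ by (s - t) m log 2 times the imaginary unit, a multiple
  of 2\<pi>\<i>.\<close>

lemma weight_pow2_eq:
  assumes "s - t = 2 * real_of_int k * pi / ln 2" "d \<in> pow2"
  shows "weight s d = weight t d"
proof -
  obtain m :: int where m: "d = 2 powi m"
    using assms(2) by (auto simp: pow2_def)
  have ln: "ln d = real_of_int m * ln 2"
    by (simp add: m powr_real_of_int'[symmetric] ln_powr)
  have "weight r d = exp ((1 / 2 + \<i> * r) * complex_of_real (ln d))" for r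
    using pow2_pos[OF assms(2)] by (simp add: weight_def powr_def Ln_of_real)
  moreover have "(1 / 2 + \<i> * s) * complex_of_real (ln d) =
      (1 / 2 + \<i> * t) * complex_of_real (ln d) + (of_int (2 * (k * m)) * pi) * \<i>"
  proof -
    have "(s - t) * ln d = 2 * real_of_int k * pi * real_of_int m"
      by (simp add: assms(1) ln)
    then have "s * ln d = t * ln d + 2 * real_of_int k * pi * real_of_int m"
      by (simp add: algebra_simps)
    then have "complex_of_real (s * ln d) = complex_of_real (t * ln d + 2 * real_of_int k * pi * real_of_int m)"
      by (rule arg_cong)
    then show ?thesis
      by (simp add: algebra_simps)
  qed
  then have "exp ((1 / 2 + \<i> * s) * complex_of_real (ln d)) = exp ((1 / 2 + \<i> * t) * complex_of_real (ln d))"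
    unfolding exp_eq by blast
  ultimately show ?thesis
    by simp
qed

lemma rho_eq_of_periods:
  assumes "s - t = 2 * real_of_int k * pi / ln 2" "\<gamma> \<in> circle_auts"
  shows "rho s \<gamma> = rho t \<gamma>"
proof
  fix x
  obtain d where d: "pow2_density \<gamma> d"
    using assms(2) by (auto simp: circle_auts_def)
  obtain f where f: "x = abs_circle_L2 f" "square_integrable f"
    by (metis circle_L2_cases)
  have "weight s (d z) = weight t (d z)" for z
    using d by (intro weight_pow2_eq[OF assms(1)]) (simp add: pow2_density_def)
  then show "rho s \<gamma> x = rho t \<gamma> x"
    by (simp add: f(1) rho_abs[OF assms(2) d f(2)])
qed

lemma eq_of_cinner:
  fixes x y :: "'a::complex_inner"
  assumes "\<And>w. cinner x w = cinner y w"
  shows "x = y"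
proof -
  have "cinner (x - y) w + cinner y w = cinner x w" for w
    by (simp add: cinner_add_left[symmetric])
  then have "cinner (x - y) w = 0" for w
    using assms[of w] by (metis add_cancel_left_left)
  then have "inner (x - y) (x - y) = 0"
    by (simp add: inner_eq_Re_cinner)
  then show ?thesis
    by simp
qed

text \<open>Restriction to an arc is a weak limit of powers of the same group element in both
  representations, and a unitary intertwiner carries weak limits to weak limits.\<close>

lemma intertwiner_arc_restrict:
  assumes U: "unitary_map U" "\<And>g. g \<in> carrier thompson_T \<Longrightarrow> U \<circ> rho s g = rho t g \<circ> U"
    and a: "a \<in> dyadic" "0 < a" "a \<le> 1"
  shows "U (arc_restrict {..a} x) = arc_restrict {..a} (U x)"
proof -
  obtain \<gamma> where \<gamma>: "\<gamma> \<in> carrier thompson_T"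
    "\<And>s u v. (\<lambda>n. cinner ((rho s \<gamma> ^^ n) u) v) \<longlonglongrightarrow> cinner (arc_restrict {a<..} u) v"
    using thompson_T_weak_limit[OF a] by blast
  have Ulin: "U (u + v) = U u + U v" for u v
    using U(1) by (simp add: unitary_map_def Vector_Spaces.linear_iff)
  have Uinner: "cinner (U u) (U v) = cinner u v" for u v
    using U(1) by (simp add: unitary_map_def)
  have Upow: "U ((rho s \<gamma> ^^ n) x) = (rho t \<gamma> ^^ n) (U x)" for n
    by (induction n) (use U(2)[OF \<gamma>(1)] in \<open>auto simp: fun_eq_iff\<close>)
  have "U (arc_restrict {a<..} x) = arc_restrict {a<..} (U x)"
  proof (rule eq_of_cinner)
    fix w
    \<comment> \<open>Surjectivity turns every test vector into an image under \<open>U\<close>, so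
      inner products can be pulled back.\<close>
    obtain v where v: "w = U v"
      using U(1) unfolding unitary_map_def by (metis surjD)
    have "(\<lambda>n. cinner ((rho t \<gamma> ^^ n) (U x)) w) \<longlonglongrightarrow> cinner (arc_restrict {a<..} x) v"
      using \<gamma>(2)[of s x v] by (simp add: Upow[symmetric] v Uinner)
    then have "cinner (arc_restrict {a<..} x) v = cinner (arc_restrict {a<..} (U x)) w"
      using \<gamma>(2)[of t "U x" w] by (rule LIMSEQ_unique)
    then show "cinner (U (arc_restrict {a<..} x)) w = cinner (arc_restrict {a<..} (U x)) w"
      by (simp add: v Uinner)
  qed
  moreover have "U (arc_restrict {..a} x) + U (arc_restrict {a<..} x) = U x"
    by (simp add: Ulin[symmetric] arc_restrict_Compl)
  moreover have "arc_restrict {..a} (U x) + arc_restrict {a<..} (U x) = U x"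
    by (rule arc_restrict_Compl)
  ultimately show ?thesis
    by (metis add_right_cancel)
qed

text \<open>Rotations have density 1 and fix the constant function in every representation; its
  image is therefore rotation invariant, and ergodicity applies.\<close>

lemma intertwiner_one:
  assumes U: "unitary_map U" "\<And>g. g \<in> carrier thompson_T \<Longrightarrow> U \<circ> rho s g = rho t g \<circ> U"
  obtains c where "c \<noteq> 0" "U (abs_circle_L2 (\<lambda>_. 1)) = c *\<^sub>C abs_circle_L2 (\<lambda>_. 1)"
proof -
  let ?one = "abs_circle_L2 (\<lambda>_. 1)"
  define g where "g = rep_circle_L2 (U ?one)"
  have sq: "square_integrable g"
    by (simp add: g_def)
  have "AE z in circle_measure. g (circle_param r * z) = g z" if r: "r \<in> dyadic" for r
  proof -
    let ?\<gamma> = "restrict (\<lambda>z. circle_param (- r) * z) circle"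
    have \<gamma>: "?\<gamma> \<in> carrier thompson_T"
      by (intro rotation_thompson_T dyadic_minus r)
    have "rho s ?\<gamma> ?one = ?one"
      by (simp add: rho_abs[OF rotation_circle_auts rotation_density square_integrable_const])
    then have "rho t ?\<gamma> (U ?one) = U ?one"
      using U(2)[OF \<gamma>] by (metis comp_apply)
    moreover have "rho t ?\<gamma> (abs_circle_L2 g) = abs_circle_L2 (\<lambda>z. weight t 1 * g (inv_into circle ?\<gamma> z))"
      by (rule rho_abs[OF rotation_circle_auts rotation_density sq])
    ultimately have "abs_circle_L2 (\<lambda>z. weight t 1 * g (inv_into circle ?\<gamma> z)) = abs_circle_L2 g"
      by (simp add: g_def)
    then have "AE z in circle_measure. weight t 1 * g (inv_into circle ?\<gamma> z) = g z"
      by (subst (asm) abs_circle_L2_eq_iff[OF square_integrable_transform[OF rotation_circle_auts rotation_density sq] sq])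
    with AE_space show ?thesis
      by eventually_elim (simp add: rotation_inv)
  qed
  moreover have "integrable circle_measure g"
    using integrable_mult_cnj[OF sq square_integrable_const[of 1]] by simp
  ultimately obtain c where c: "AE z in circle_measure. g z = c"
    using AE_const_of_rotation_invariant by blast
  have "abs_circle_L2 g = abs_circle_L2 (\<lambda>_. c)"
    using c sq by (simp add: abs_circle_L2_eq_iff)
  then have U1: "U ?one = c *\<^sub>C ?one"
    by (simp add: g_def scaleC_abs_circle_L2)
  moreover have "c \<noteq> 0"
  proof
    assume "c = 0"
    then have "cinner (U ?one) (U ?one) = 0"
      using U1 cinner_scaleC_left[of 0 ?one] by simp
    then have "cinner ?one ?one = 0"
      using U(1) by (simp add: unitary_map_def)
    then have "inner ?one ?one = 0"
      by (simp only: inner_eq_Re_cinner zero_complex.simps)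
    then show False
      using one_circle_L2_neq_0 by simp
  qed
  ultimately show thesis
    using that by blast
qed

lemma intertwiner_period:
  assumes U: "unitary_map U" "\<And>g. g \<in> carrier thompson_T \<Longrightarrow> U \<circ> rho s g = rho t g \<circ> U"
  shows "\<exists>k::int. s - t = 2 * k * pi / ln 2"
proof -
  \<comment> \<open>The number 1/8 is a dyadic point inside (0,1/4), where the expander for a = 1
    has slope 2.\<close>
  let ?one = "abs_circle_L2 (\<lambda>_. 1)" and ?P = "arc_restrict {..1 / 8 :: real}"
  obtain c where c: "c \<noteq> 0" "U ?one = c *\<^sub>C ?one"
    using intertwiner_one[OF U] by blast
  have "1 / 8 \<in> dyadic"
    using dyadic_nat_fraction[of 1 3] by simp
  then have UP: "U (?P x) = ?P (U x)" for x
    by (intro intertwiner_arc_restrict[OF U]) auto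
  have UC: "U (b *\<^sub>C x) = b *\<^sub>C U x" for b x
    using U(1) by (simp add: unitary_map_def Vector_Spaces.linear_iff)
  obtain \<gamma> d where \<gamma>d: "\<gamma> \<in> carrier thompson_T" "d \<in> borel_measurable borel"
    "pow2_density \<gamma> (\<lambda>z. d (circle_coord z))"
    "\<And>z. z \<in> circle \<Longrightarrow> inv_into circle \<gamma> z = circle_param (expander 1 (circle_coord z))"
    "\<And>z. z \<in> circle \<Longrightarrow> circle_coord (inv_into circle \<gamma> z) = expander 1 (circle_coord z)"
    "AE z in circle_measure. (circle_coord z < 1 / 4 \<longrightarrow> d (circle_coord z) = 2) \<and>
       (1 < circle_coord z \<longrightarrow> d (circle_coord z) = 1)"
    using expander_thompson_T[OF dyadic_1 zero_less_one order_refl] by blast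
  note \<gamma> = \<gamma>d(1,3) and d = \<gamma>d(6)
  have \<gamma>a: "\<gamma> \<in> circle_auts"
    using \<gamma>(1) thompson_T_subset by auto
  have P_rho: "?P (rho r \<gamma> ?one) = weight r 2 *\<^sub>C ?P ?one" for r
  proof -
    note sq = square_integrable_transform[OF \<gamma>a \<gamma>(2) square_integrable_const[of 1], of r]
    have "?P (rho r \<gamma> ?one) = abs_circle_L2 (\<lambda>z. indicator {..1 / 8} (circle_coord z) * (weight r (d (circle_coord z)) * 1))"
      unfolding rho_abs[OF \<gamma>a \<gamma>(2) square_integrable_const] by (rule arc_restrict_abs[OF sq]) simp
    also have "\<dots> = abs_circle_L2 (\<lambda>z. weight r 2 * (indicator {..1 / 8} (circle_coord z) * 1))"
    proof (rule abs_circle_L2_eqI)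
      show "AE z in circle_measure. indicator {..1 / 8} (circle_coord z) * (weight r (d (circle_coord z)) * 1) =
        weight r 2 * (indicator {..1 / 8} (circle_coord z) * 1)"
        using d by eventually_elim (simp add: indicator_def)
      show "square_integrable (\<lambda>z. indicator {..1 / 8} (circle_coord z) * (weight r (d (circle_coord z)) * 1))"
        by (rule square_integrable_arc[OF sq]) simp
    qed (intro square_integrable_measurable square_integrable_scale square_integrable_arc square_integrable_const, simp)
    also have "\<dots> = weight r 2 *\<^sub>C ?P ?one"
      using arc_restrict_abs[OF square_integrable_const[of 1], of "{..1 / 8}"]
      by (simp add: scaleC_abs_circle_L2 square_integrable_arc[OF square_integrable_const[of 1], simplified])
    finally show ?thesis .
  qed
  \<comment> \<open>The vector on the right is evaluated twice: applying the element before
    \<open>U\<close> yields the weight for s, after \<open>U\<close> the weight for t.\<close>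
  have "weight s 2 *\<^sub>C c *\<^sub>C ?P ?one = U (?P (rho s \<gamma> ?one))"
    by (simp add: P_rho UC UP c(2) arc_restrict_scaleC)
  also have "\<dots> = ?P (rho t \<gamma> (U ?one))"
    using U(2)[OF \<gamma>(1)] by (simp add: UP fun_eq_iff)
  also have "\<dots> = weight t 2 *\<^sub>C c *\<^sub>C ?P ?one"
    by (simp add: c(2) rho_scaleC[OF \<gamma>a \<gamma>(2)] arc_restrict_scaleC P_rho scaleC_scaleC mult.commute)
  finally have "(weight s 2 * c) *\<^sub>C ?P ?one = (weight t 2 * c) *\<^sub>C ?P ?one"
    by (simp add: scaleC_scaleC)
  moreover have "?P ?one \<noteq> 0"
  proof
    assume "?P ?one = 0"
    then have "abs_circle_L2 (\<lambda>z. indicator {..1 / 8} (circle_coord z) * 1) = abs_circle_L2 (\<lambda>_. 0)"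
      using arc_restrict_abs[OF square_integrable_const[of 1], of "{..1 / 8}"] by (simp add: zero_circle_L2_abs)
    then have "AE z in circle_measure. indicator {..1 / 8} (circle_coord z) * 1 = (0::complex)"
      by (subst (asm) abs_circle_L2_eq_iff) (auto intro: square_integrable_arc[OF square_integrable_const[of 1], simplified])
    then have "AE z in circle_measure. \<not> circle_coord z \<le> 1 / 8"
      by eventually_elim (auto simp: indicator_def split: if_splits)
    then have "emeasure circle_measure {z \<in> space circle_measure. circle_coord z \<le> 1 / 8} = 0"
      by (rule emeasure_eq_0_AE)
    moreover have "emeasure circle_measure {z \<in> circle. circle_coord z \<le> 1 / 8} = ennreal (1 / 8)"
      by (rule emeasure_circle_coord_le) auto
    ultimately show False
      by (simp only: space_circle_measure) simp
  qed
  ultimately have "weight s 2 = weight t 2"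
    using c(1) by (auto simp: complex_vector.scale_right_imp_eq)
  then have "exp ((1 / 2 + \<i> * s) * complex_of_real (ln 2)) = exp ((1 / 2 + \<i> * t) * complex_of_real (ln 2))"
    by (simp add: weight_def powr_def Ln_of_real[of 2, simplified])
  then obtain n :: int where
    n: "(1 / 2 + \<i> * s) * complex_of_real (ln 2) = (1 / 2 + \<i> * t) * complex_of_real (ln 2) + (of_int (2 * n) * pi) * \<i>"
    unfolding exp_eq by blast
  \<comment> \<open>The real parts of the exponents agree, so the imaginary parts carry all the
    information.\<close>
  have "s * ln 2 = t * ln 2 + 2 * real_of_int n * pi"
    using arg_cong[OF n, of Im] by (simp add: algebra_simps)
  then have "s - t = 2 * real_of_int n * pi / ln 2"
    by (simp add: field_simps)
  then show ?thesis
    by blast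
qed

lemma unitary_map_id: "unitary_map (\<lambda>x::'a::complex_inner. x)"
  unfolding unitary_map_def Vector_Spaces.linear_iff
  using complex_vector.vector_space_axioms by (auto simp: surj_def)

theorem proposition11:
  shows "(\<forall>s::real. unitary_rep thompson_T (rho s) \<and> irreducible_rep thompson_T (rho s)) \<and>
    (\<forall>s t::real. unitarily_equivalent thompson_T (rho s) (rho t) \<longleftrightarrow>
       (\<exists>k::int. s - t = 2 * k * pi / ln 2))"
proof (intro conjI allI)
  fix s t :: real
  show "unitary_rep thompson_T (rho s)"
    by (rule unitary_rep_rho)
  show "irreducible_rep thompson_T (rho s)"
    by (rule irreducible_rep_rho)
  show "unitarily_equivalent thompson_T (rho s) (rho t) \<longleftrightarrow> (\<exists>k::int. s - t = 2 * k * pi / ln 2)"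
  proof
    assume "unitarily_equivalent thompson_T (rho s) (rho t)"
    then show "\<exists>k::int. s - t = 2 * k * pi / ln 2"
      unfolding unitarily_equivalent_def using intertwiner_period by blast
  next
    assume "\<exists>k::int. s - t = 2 * k * pi / ln 2"
    \<comment> \<open>The two representations coincide on T, so the identity map intertwines
      them.\<close>
    then have "rho s g = rho t g" if "g \<in> carrier thompson_T" for g
      using that rho_eq_of_periods thompson_T_subset by blast
    then show "unitarily_equivalent thompson_T (rho s) (rho t)"
      unfolding unitarily_equivalent_def
      by (intro exI[of _ "\<lambda>x. x"] conjI unitary_map_id ballI) (simp add: comp_def)
  qed
qed

end
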